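(* Let $X$ and $P$ be finite-dimensional Euclidean spaces, $f\colon X\times P\to X$, and $g\colon X\times P\to(-\infty,\infty]$ lower semicontinuous. Let $\bar x\in S(\bar v,\bar p)$, put $\hat v:=\bar v-f(\bar x,\bar p)$, and suppose that the assumptions (A1), (A2), (A3) given in the context hold. Then $\bar x$ is a Lipschitzian fully stable solution of the parametric variational system $v\in f(x,p)+\partial_xg(x,p)$ corresponding to $(\bar v,\bar p)$ if and only if the following two conditions hold simultaneously: $$(0,q)\in(D^*\partial_xg)(\bar x,\bar p,\hat v)(0)\Longrightarrow q=0,$$ $$\langle\nabla_xf(\bar x,\bar p)w,w\rangle+\langle z,w\rangle>0\quad\text{for all }(z,q)\in(D^*\partial_xg)(\bar x,\bar p,\hat v)(w),\ w\ne0.$$ Consequently, these two conditions imply that the solution map $S$ admits a Lipschitz continuous single-valued localization around $(\bar v,\bar p,\bar x)$.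
   Context: $d$ denotes the norm distance on $P$, and $\mathbb B$ a closed unit ball. Subdifferentials. For lower semicontinuous $\varphi\colon X\to(-\infty,\infty]$ and $\varphi(\bar x)<\infty$: $\widehat\partial\varphi(\bar x)=\{v:\liminf_{x\to\bar x}[\varphi(x)-\varphi(\bar x)-\langle v,x-\bar x\rangle]/\|x-\bar x\|\ge0\}$; the limiting subdifferential $\partial\varphi(\bar x)$ is the set of limits $v=\lim v_k$ with $v_k\in\widehat\partial\varphi(x_k)$, $x_k\to\bar x$, $\varphi(x_k)\to\varphi(\bar x)$. With $g_p:=g(\cdot,p)$, put $\partial_xg(x,p):=\partial g_p(x)$, a set-valued mapping $X\times P\rightrightarrows X$, with $\mathrm{gph}\,\partial_xg=\{(x,p,v):v\in\partial_xg(x,p)\}$. Limiting coderivative. $\widehat N_\Omega(\bar z)=\{\zeta:\limsup_{z\to\bar z,\,z\in\Omega}\langle\zeta,z-\bar z\rangle/\|z-\bar z\|\le0\}$; $N_\Omega(\bar z)$ is the set of limits $\lim\zeta_k$ with $\zeta_k\in\widehat N_\Omega(z_k)$, $z_k\in\Omega$, $z_k\to\bar z$. $(D^*\partial_xg)(\bar x,\bar p,\hat v)(w)=\{(z,q)\in X\times P:(z,q,-w)\in N_{\mathrm{gph}\,\partial_xg}(\bar x,\bar p,\hat v)\}$, $w\in X$. Solution map. $S(v,p)=\{x\in X:v\in f(x,p)+\partial_xg(x,p)\}$. A single-valued localization of $S$ relative to a neighborhood $V\times Q\times U$ of $(\bar v,\bar p,\bar x)$ is a single-valued mapping $\vartheta\colon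 V\times Q\to U$, defined on all of $V\times Q$, with $\mathrm{gph}\,\vartheta=\mathrm{gph}\,S\cap(V\times Q\times U)$. Lipschitzian full stability. $\bar x\in S(\bar v,\bar p)$ is a Lipschitzian fully stable solution corresponding to $(\bar v,\bar p)$ if $S$ admits a single-valued localization $\vartheta$ relative to some neighborhood $V\times Q\times U$ of $(\bar v,\bar p,\bar x)$ such that for some constants $\kappa,\ell>0$ and all $(v_1,p_1),(v_2,p_2)\in V\times Q$: $\|(v_1-v_2)-2\kappa[\vartheta(v_1,p_1)-\vartheta(v_2,p_2)]\|\le\|v_1-v_2\|+\ell\,d(p_1,p_2)$. Lipschitz-like property. $F\colon P\rightrightarrows Y$ ($Y$ normed) is Lipschitz-like around $(\bar p,\bar y)\in\mathrm{gph}\,F$ if there are neighborhoods $Q$ of $\bar p$, $W$ of $\bar y$ and $\ell>0$ with $F(p)\cap W\subset F(q)+\ell d(p,q)\mathbb B$ for all $p,q\in Q$. Assumptions (with $\hat v=\bar v-f(\bar x,\bar p)\in\partial_xg(\bar x,\bar p)$): (A1) $f$ is differentiable with respect to $x$ at all points $(x,p)$ around $(\bar x,\bar p)$ and $\nabla_xf$ is continuous at $(\bar x,\bar p)$; moreover there are a neighborhood $U\times Q$ of $(\bar x,\bar p)$ and $L>0$ with $\|f(x,p_1)-f(x,p_2)\|\le Ld(p_1,p_2)$ for all $x\in U$, $p_1,p_2\in Q$. (A2) $g$ is parametrically continuously prox-regular at $(\bar x,\bar p)$ for $\hat v$, i.e.: there are neighborhoods $U$ of $\bar x$, $V$ of $\hat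 v$, $Q$ of $\bar p$ and $\varepsilon,r>0$ such that $g(x,p)\ge g(u,p)+\langle v,x-u\rangle-\frac r2\|x-u\|^2$ for all $x\in U$ whenever $v\in\partial_xg(u,p)\cap V$, $u\in U$, $p\in Q$, $g(u,p)\le g(\bar x,\bar p)+\varepsilon$; and the mapping $(x,p,v)\mapsto g(x,p)$ is continuous relative to $\mathrm{gph}\,\partial_xg$ at $(\bar x,\bar p,\hat v)$. (A3) The mapping $p\mapsto\mathrm{epi}\,g(\cdot,p)$ is Lipschitz-like around $(\bar p,(\bar x,g(\bar x,\bar p)))$. *)

theory Defs
  imports "HOL-Analysis.Analysis"
begin

text \<open>
  Neighborhoods need not be open: \<open>N\<close> is a neighborhood of \<open>z\<close> iff \<open>z \<in> interior N\<close>.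
  Products carry the library's inner product, so \<open>('x \<times> 'p) \<times> \<dots>\<close> is again Euclidean and
  the norm distance on a space is \<^const>\<open>dist\<close>.
  Functions into \<open>(-\<infinity>, \<infinity>]\<close> are \<^typ>\<open>ereal\<close>-valued functions avoiding \<open>-\<infinity>\<close>.
\<close>

definition lower_semicontinuous :: "('a::topological_space \<Rightarrow> ereal) \<Rightarrow> bool" where
  "lower_semicontinuous \<phi> \<longleftrightarrow> (\<forall>z. \<phi> z \<le> Liminf (at z) \<phi>)"

definition epi :: "('a \<Rightarrow> ereal) \<Rightarrow> ('a \<times> real) set" where
  "epi \<phi> = {(x, \<alpha>). \<phi> x \<le> ereal \<alpha>}"

text \<open>Both subdifferentials are empty at points where the function is not finite.\<close>

definition regular_subdiff :: "('a::euclidean_space \<Rightarrow> ereal) \<Rightarrow> 'a \<Rightarrow> 'a set" where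
  "regular_subdiff \<phi> xbar = {v. \<bar>\<phi> xbar\<bar> \<noteq> \<infinity> \<and>
     0 \<le> Liminf (at xbar)
           (\<lambda>x. (\<phi> x - \<phi> xbar - ereal (v \<bullet> (x - xbar))) / ereal (norm (x - xbar)))}"

definition limiting_subdiff :: "('a::euclidean_space \<Rightarrow> ereal) \<Rightarrow> 'a \<Rightarrow> 'a set" where
  "limiting_subdiff \<phi> xbar = {v. \<bar>\<phi> xbar\<bar> \<noteq> \<infinity> \<and>
     (\<exists>xs vs. (\<forall>k::nat. vs k \<in> regular_subdiff \<phi> (xs k)) \<and>
        xs \<longlonglongrightarrow> xbar \<and> (\<lambda>k. \<phi> (xs k)) \<longlonglongrightarrow> \<phi> xbar \<and> vs \<longlonglongrightarrow> v)}"

definition partial_subdiff ::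
    "('x::euclidean_space \<times> 'p \<Rightarrow> ereal) \<Rightarrow> 'x \<Rightarrow> 'p \<Rightarrow> 'x set" where
  "partial_subdiff g x p = limiting_subdiff (\<lambda>u. g (u, p)) x"

definition gph2 :: "('a \<Rightarrow> 'b \<Rightarrow> 'c set) \<Rightarrow> ('a \<times> 'b \<times> 'c) set" where
  "gph2 F = {(a, b, c). c \<in> F a b}"

text \<open>At an isolated point of \<open>\<Omega>\<close> the upper limit is \<open>-\<infinity>\<close>, so every \<open>\<zeta>\<close> is a regular normal.\<close>

definition regular_normal_cone :: "'a::euclidean_space set \<Rightarrow> 'a \<Rightarrow> 'a set" where
  "regular_normal_cone \<Omega> zbar =
     {\<zeta>. Limsup (at zbar within \<Omega>) (\<lambda>z. ereal (\<zeta> \<bullet> (z - zbar) / norm (z - zbar))) \<le> 0}"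

definition limiting_normal_cone :: "'a::euclidean_space set \<Rightarrow> 'a \<Rightarrow> 'a set" where
  "limiting_normal_cone \<Omega> zbar = {\<zeta>. \<exists>zs \<zeta>s.
     (\<forall>k::nat. zs k \<in> \<Omega> \<and> \<zeta>s k \<in> regular_normal_cone \<Omega> (zs k)) \<and>
     zs \<longlonglongrightarrow> zbar \<and> \<zeta>s \<longlonglongrightarrow> \<zeta>}"

definition limiting_coderivative ::
    "('x::euclidean_space \<Rightarrow> 'p::euclidean_space \<Rightarrow> 'y::euclidean_space set)
      \<Rightarrow> 'x \<Rightarrow> 'p \<Rightarrow> 'y \<Rightarrow> 'y \<Rightarrow> ('x \<times> 'p) set" where
  "limiting_coderivative F xbar pbar ybar w =
     {(z, q). (z, q, - w) \<in> limiting_normal_cone (gph2 F) (xbar, pbar, ybar)}"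

definition solution_map ::
    "('x::euclidean_space \<times> 'p \<Rightarrow> 'x) \<Rightarrow> ('x \<times> 'p \<Rightarrow> ereal) \<Rightarrow> 'x \<Rightarrow> 'p \<Rightarrow> 'x set" where
  "solution_map f g v p = {x. \<exists>y \<in> partial_subdiff g x p. v = f (x, p) + y}"

text \<open>Only the values of \<open>\<theta>\<close> on \<open>V \<times> Q\<close> matter.\<close>

definition single_valued_localization ::
    "('v::topological_space \<Rightarrow> 'p::topological_space \<Rightarrow> 'x::topological_space set)
      \<Rightarrow> 'v \<Rightarrow> 'p \<Rightarrow> 'x \<Rightarrow> 'v set \<Rightarrow> 'p set \<Rightarrow> 'x set \<Rightarrow> ('v \<times> 'p \<Rightarrow> 'x) \<Rightarrow> bool" where
  "single_valued_localization S vbar pbar xbar V Q U \<theta> \<longleftrightarrow>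
     vbar \<in> interior V \<and> pbar \<in> interior Q \<and> xbar \<in> interior U \<and>
     \<theta> \<in> V \<times> Q \<rightarrow> U \<and>
     {(v, p, x). v \<in> V \<and> p \<in> Q \<and> x = \<theta> (v, p)} = gph2 S \<inter> (V \<times> Q \<times> U)"

definition lipschitzian_fully_stable ::
    "('v::euclidean_space \<Rightarrow> 'p::euclidean_space \<Rightarrow> 'v set) \<Rightarrow> 'v \<Rightarrow> 'p \<Rightarrow> 'v \<Rightarrow> bool" where
  "lipschitzian_fully_stable S vbar pbar xbar \<longleftrightarrow>
     xbar \<in> S vbar pbar \<and>
     (\<exists>V Q U \<theta>. single_valued_localization S vbar pbar xbar V Q U \<theta> \<and>
       (\<exists>\<kappa>>0. \<exists>l>0. \<forall>v1\<in>V. \<forall>v2\<in>V. \<forall>p1\<in>Q. \<forall>p2\<in>Q.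
          norm ((v1 - v2) - (2 * \<kappa>) *\<^sub>R (\<theta> (v1, p1) - \<theta> (v2, p2)))
            \<le> norm (v1 - v2) + l * dist p1 p2))"

definition lipschitz_localization ::
    "('v::metric_space \<Rightarrow> 'p::metric_space \<Rightarrow> 'x::metric_space set)
      \<Rightarrow> 'v \<Rightarrow> 'p \<Rightarrow> 'x \<Rightarrow> bool" where
  "lipschitz_localization S vbar pbar xbar \<longleftrightarrow>
     (\<exists>V Q U \<theta>. single_valued_localization S vbar pbar xbar V Q U \<theta> \<and>
       (\<exists>L. L-lipschitz_on (V \<times> Q) \<theta>))"

definition lipschitz_like ::
    "('p::metric_space \<Rightarrow> 'y::real_normed_vector set) \<Rightarrow> 'p \<Rightarrow> 'y \<Rightarrow> bool" where
  "lipschitz_like F pbar ybar \<longleftrightarrow>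
     ybar \<in> F pbar \<and>
     (\<exists>Q W. \<exists>l>0. pbar \<in> interior Q \<and> ybar \<in> interior W \<and>
       (\<forall>p\<in>Q. \<forall>q\<in>Q. F p \<inter> W \<subseteq> {y + (l * dist p q) *\<^sub>R b | y b. y \<in> F q \<and> b \<in> cball 0 1}))"

text \<open>Meaningful wherever the partial derivative exists.\<close>

definition grad_x ::
    "('x::euclidean_space \<times> 'p \<Rightarrow> 'x) \<Rightarrow> 'x \<times> 'p \<Rightarrow> 'x \<Rightarrow>\<^sub>L 'x" where
  "grad_x f = (\<lambda>(x, p). Blinfun (frechet_derivative (\<lambda>u. f (u, p)) (at x)))"

definition assumption_A1 ::
    "('x::euclidean_space \<times> 'p::euclidean_space \<Rightarrow> 'x) \<Rightarrow> 'x \<Rightarrow> 'p \<Rightarrow> bool" where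
  "assumption_A1 f xbar pbar \<longleftrightarrow>
     (\<exists>N. (xbar, pbar) \<in> interior N \<and>
        (\<forall>(x, p)\<in>N. (\<lambda>u. f (u, p)) differentiable (at x))) \<and>
     isCont (grad_x f) (xbar, pbar) \<and>
     (\<exists>U Q. \<exists>L>0. xbar \<in> interior U \<and> pbar \<in> interior Q \<and>
        (\<forall>x\<in>U. \<forall>p1\<in>Q. \<forall>p2\<in>Q. norm (f (x, p1) - f (x, p2)) \<le> L * dist p1 p2))"

text \<open>Parametric continuous prox-regularity; \<open>g (xbar, pbar)\<close> is finite as \<open>vhat\<close> is a subgradient.\<close>

definition assumption_A2 ::
    "('x::euclidean_space \<times> 'p::euclidean_space \<Rightarrow> ereal) \<Rightarrow> 'x \<Rightarrow> 'p \<Rightarrow> 'x \<Rightarrow> bool" where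
  "assumption_A2 g xbar pbar vhat \<longleftrightarrow>
     vhat \<in> partial_subdiff g xbar pbar \<and>
     (\<exists>U V Q. \<exists>\<epsilon>>0. \<exists>r>0. xbar \<in> interior U \<and> vhat \<in> interior V \<and> pbar \<in> interior Q \<and>
        (\<forall>u\<in>U. \<forall>p\<in>Q. \<forall>v \<in> partial_subdiff g u p \<inter> V.
           g (u, p) \<le> g (xbar, pbar) + ereal \<epsilon> \<longrightarrow>
           (\<forall>x\<in>U. g (x, p) \<ge> g (u, p) + ereal (v \<bullet> (x - u) - r / 2 * (norm (x - u))\<^sup>2)))) \<and>
     continuous (at (xbar, pbar, vhat) within gph2 (partial_subdiff g)) (\<lambda>(x, p, v). g (x, p))"

definition assumption_A3 ::
    "('x::euclidean_space \<times> 'p::euclidean_space \<Rightarrow> ereal) \<Rightarrow> 'x \<Rightarrow> 'p \<Rightarrow> bool" where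
  "assumption_A3 g xbar pbar \<longleftrightarrow>
     lipschitz_like (\<lambda>p. epi (\<lambda>x. g (x, p))) pbar (xbar, real_of_ereal (g (xbar, pbar)))"

end

theory Submission
  imports Defs
begin

text \<open>
  Let \<open>G\<close> be the graph of \<open>(x, p) \<mapsto> \<partial>\<^sub>x g (x, p)\<close>.  For \<open>p1 = p2\<close> the inequality of full stability says,
  after squaring, that the values \<open>x1\<close>, \<open>x2\<close> of \<open>\<theta>\<close> satisfy \<open>(v1 - v2) \<bullet> (x1 - x2) \<ge> \<kappa> * (norm (x1 - x2))\<^sup>2\<close>; together with
  joint Lipschitz continuity of \<open>\<theta>\<close> this is all of it.

  Necessity.  Near the reference point \<open>G\<close> is parametrized by the localization, so a regular normal
  \<open>(z, q, - w)\<close> can be tested against the points obtained by moving \<open>v\<close> alone or \<open>p\<close> alone.  The first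
  gives \<open>\<nabla>\<^sub>x f w \<bullet> w + z \<bullet> w \<ge> \<kappa> * (norm w)\<^sup>2\<close>, the second bounds \<open>q\<close> by \<open>z\<close> and \<open>w\<close>
  (\<open>normal_coercive_of_localization\<close>, \<open>normal_bound_of_localization\<close>).  Both survive the passage to limiting
  normals.

  Sufficiency.  The difficulty is that \<open>x\<close> is no good coordinate on \<open>G\<close>: limits of normals may
  have \<open>w = 0\<close> and \<open>z \<noteq> 0\<close>, and on those the second condition says nothing.  Let \<open>A\<close> be the symmetric part of
  \<open>\<nabla>\<^sub>x f\<close> at the reference point, and replace \<open>v\<close> by \<open>v + A x\<close> and \<open>x\<close> by \<open>y = x + lam *\<^sub>R (v + A x)\<close> with
  small \<open>lam\<close>.  The point \<open>x\<close> is recovered from \<open>(y, p)\<close> by minimizing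
  \<open>g (x, p) + A x \<bullet> x / 2 + (norm (x - y))\<^sup>2 / (2 * lam)\<close> near \<open>xbar\<close>, and prox-regularity, lower semicontinuity
  and the Lipschitz-like epigraphs make the minimizer \<open>X y p\<close> unique and continuous (\<open>chart_exists\<close>).  In
  the coordinates \<open>(y, p)\<close> the graph is that of \<open>M y p = (y - X y p) / lam\<close>, which is Lipschitz in \<open>y\<close>
  and is the gradient in \<open>y\<close> of a Moreau envelope.

  An approximate mean value theorem (\<open>proximal_mean_value\<close>) turns every difference of values of \<open>M\<close> into a
  regular normal to \<open>G\<close> whose components are controlled.  The first condition, by compactness, bounds \<open>q\<close>, so
  that \<open>M\<close> is Lipschitz in \<open>(y, p)\<close>; the second one, applied to the normal belonging to the direction
  \<open>y2 - y1\<close>, for which \<open>w\<close> is bounded away from zero, makes \<open>M\<close> strongly monotone in \<open>y\<close>.  As \<open>M\<close> is a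
  gradient, the Baillon-Haddad inequality converts this into strong monotonicity with respect to \<open>X\<close>
  (\<open>resolvent_strongly_monotone\<close>).  The difference of \<open>f\<close> and its linearization has a small Lipschitz constant
  in \<open>x\<close>, so \<open>(y, p) \<mapsto> (M y p - A (X y p) + f (X y p, p), p)\<close> is injective and continuous; by invariance of
  domain its image is a neighborhood of \<open>(vbar, pbar)\<close>, and \<open>X\<close> composed with its inverse is the localization.
\<close>

section \<open>Products of metric spaces and null sequences\<close>

lemma dist_Pair_le: "dist (a, b) (c, d) \<le> dist a c + dist b d"
  unfolding dist_Pair_Pair by (rule sqrt_sum_squares_le_sum) auto

lemma dist_triple_less:
  assumes "dist x x' < d / 3" "dist p p' < d / 3" "dist v v' < d / 3"
  shows "dist (x, p, v) (x', p', v') < d"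
  using dist_Pair_le[of x "(p, v)" x' "(p', v')"] dist_Pair_le[of p v p' v'] assms by linarith

lemma ball_in_interior:
  fixes z :: "'a::metric_space"
  assumes "z \<in> interior S"
  obtains e where "e > 0" "ball z e \<subseteq> S"
proof -
  obtain e where "e > 0" "ball z e \<subseteq> interior S"
    using assms open_interior open_contains_ball by blast
  then show thesis using that interior_subset by blast
qed

lemma tendsto_dist_bound:
  assumes "\<And>n. dist (X n) l \<le> b n" "b \<longlonglongrightarrow> 0"
  shows "X \<longlonglongrightarrow> l"
  by (rule tendsto_dist_iff[THEN iffD2], rule Lim_null_comparison[OF _ assms(2)]) (simp add: assms(1))

lemma divide_Suc_tendsto_0: "(\<lambda>n. c / real (Suc n)) \<longlonglongrightarrow> 0"
  using tendsto_mult_right_zero[OF LIMSEQ_inverse_real_of_nat, of c] by (simp add: divide_inverse)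

section \<open>Regular and limiting normals\<close>

lemma regular_normal_cone_iff:
  "\<zeta> \<in> regular_normal_cone \<Omega> zbar \<longleftrightarrow>
    (\<forall>e>0. eventually (\<lambda>z. \<zeta> \<bullet> (z - zbar) \<le> e * norm (z - zbar)) (at zbar within \<Omega>))"
proof
  assume "\<zeta> \<in> regular_normal_cone \<Omega> zbar"
  then have L: "Limsup (at zbar within \<Omega>) (\<lambda>z. ereal (\<zeta> \<bullet> (z - zbar) / norm (z - zbar))) \<le> 0"
    by (simp add: regular_normal_cone_def)
  show "\<forall>e>0. eventually (\<lambda>z. \<zeta> \<bullet> (z - zbar) \<le> e * norm (z - zbar)) (at zbar within \<Omega>)"
  proof (intro allI impI)
    fix e :: real assume "e > 0"
    then have "0 < ereal e" by simp
    with L have "eventually (\<lambda>z. ereal (\<zeta> \<bullet> (z - zbar) / norm (z - zbar)) < ereal e) (at zbar within \<Omega>)"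
      by (simp only: Limsup_le_iff)
    then show "eventually (\<lambda>z. \<zeta> \<bullet> (z - zbar) \<le> e * norm (z - zbar)) (at zbar within \<Omega>)"
      unfolding eventually_at_filter
      by eventually_elim (auto simp: divide_simps split: if_splits)
  qed
next
  assume R: "\<forall>e>0. eventually (\<lambda>z. \<zeta> \<bullet> (z - zbar) \<le> e * norm (z - zbar)) (at zbar within \<Omega>)"
  have "Limsup (at zbar within \<Omega>) (\<lambda>z. ereal (\<zeta> \<bullet> (z - zbar) / norm (z - zbar))) \<le> 0"
  proof (subst Limsup_le_iff, intro allI impI)
    fix y :: ereal assume "y > 0"
    then obtain e where e: "e > 0" "ereal e < y"
      by (metis ereal_dense2 ereal_less(2) less_ereal.simps(1) zero_ereal_def)
    have "eventually (\<lambda>z. \<zeta> \<bullet> (z - zbar) \<le> e * norm (z - zbar)) (at zbar within \<Omega>)"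
      using R e by blast
    then show "eventually (\<lambda>z. y > ereal (\<zeta> \<bullet> (z - zbar) / norm (z - zbar))) (at zbar within \<Omega>)"
      unfolding eventually_at_filter
    proof eventually_elim
      case (elim z)
      show ?case
      proof (intro impI)
        assume z: "z \<noteq> zbar" "z \<in> \<Omega>"
        then have "\<zeta> \<bullet> (z - zbar) / norm (z - zbar) \<le> e"
          using elim by (simp add: divide_simps)
        then show "ereal (\<zeta> \<bullet> (z - zbar) / norm (z - zbar)) < y"
          using e(2) by (meson ereal_less_eq(3) order_le_less_trans)
      qed
    qed
  qed
  then show "\<zeta> \<in> regular_normal_cone \<Omega> zbar" by (simp add: regular_normal_cone_def)
qed

lemma regular_normal_coneD:
  assumes "\<zeta> \<in> regular_normal_cone \<Omega> zbar" "e > 0"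
  shows "\<exists>d>0. \<forall>z\<in>\<Omega>. dist z zbar < d \<longrightarrow> \<zeta> \<bullet> (z - zbar) \<le> e * norm (z - zbar)"
proof -
  have "eventually (\<lambda>z. \<zeta> \<bullet> (z - zbar) \<le> e * norm (z - zbar)) (at zbar within \<Omega>)"
    using assms by (simp add: regular_normal_cone_iff)
  then obtain d where d: "d > 0"
      "\<And>z. z \<in> \<Omega> \<Longrightarrow> z \<noteq> zbar \<Longrightarrow> dist z zbar < d \<Longrightarrow> \<zeta> \<bullet> (z - zbar) \<le> e * norm (z - zbar)"
    unfolding eventually_at by auto
  have "\<forall>z\<in>\<Omega>. dist z zbar < d \<longrightarrow> \<zeta> \<bullet> (z - zbar) \<le> e * norm (z - zbar)"
    using d by (metis diff_self inner_zero_right mult_zero_right norm_zero order_refl)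
  then show ?thesis using d(1) by blast
qed

text \<open>All normals constructed below come from quadratic estimates, that is, they are proximal normals.\<close>

lemma regular_normal_coneI_quadratic:
  assumes "d > 0" "\<And>z. z \<in> \<Omega> \<Longrightarrow> dist z zbar < d \<Longrightarrow> \<zeta> \<bullet> (z - zbar) \<le> K * (norm (z - zbar))\<^sup>2"
  shows "\<zeta> \<in> regular_normal_cone \<Omega> zbar"
  unfolding regular_normal_cone_iff
proof (intro allI impI)
  fix e :: real assume e: "e > 0"
  define d' where "d' = min d (e / (\<bar>K\<bar> + 1))"
  have "d' > 0" using assms(1) e by (auto simp: d'_def)
  moreover have "\<zeta> \<bullet> (z - zbar) \<le> e * norm (z - zbar)" if "z \<in> \<Omega>" "dist z zbar < d'" for z
  proof -
    let ?n = "norm (z - zbar)"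
    have n: "?n < d" "?n < e / (\<bar>K\<bar> + 1)" using that by (auto simp: d'_def dist_norm)
    have "\<bar>K\<bar> * ?n \<le> (\<bar>K\<bar> + 1) * ?n" by (simp add: mult_right_mono)
    also have "\<dots> \<le> e" using n(2) by (simp add: field_simps add_pos_nonneg)
    finally have "\<bar>K\<bar> * ?n \<le> e" .
    have "\<zeta> \<bullet> (z - zbar) \<le> K * ?n\<^sup>2" using assms(2) that n by (simp add: dist_norm)
    also have "\<dots> \<le> (\<bar>K\<bar> * ?n) * ?n" by (simp add: power2_eq_square mult_right_mono flip: mult.assoc)
    also have "\<dots> \<le> e * ?n" using \<open>\<bar>K\<bar> * ?n \<le> e\<close> by (simp add: mult_right_mono)
    finally show ?thesis .
  qed
  ultimately show "eventually (\<lambda>z. \<zeta> \<bullet> (z - zbar) \<le> e * norm (z - zbar)) (at zbar within \<Omega>)"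
    unfolding eventually_at by blast
qed

lemma limiting_normal_coneI:
  assumes "\<And>k::nat. zs k \<in> \<Omega>" "\<And>k. \<zeta>s k \<in> regular_normal_cone \<Omega> (zs k)"
    and "zs \<longlonglongrightarrow> zbar" "\<zeta>s \<longlonglongrightarrow> \<zeta>"
  shows "\<zeta> \<in> limiting_normal_cone \<Omega> zbar"
  unfolding limiting_normal_cone_def using assms by blast

lemma regular_normal_cone_scaleR:
  assumes "\<zeta> \<in> regular_normal_cone \<Omega> zbar" "c > 0"
  shows "c *\<^sub>R \<zeta> \<in> regular_normal_cone \<Omega> zbar"
  unfolding regular_normal_cone_iff
proof (intro allI impI)
  fix e :: real assume "e > 0"
  then have "eventually (\<lambda>z. \<zeta> \<bullet> (z - zbar) \<le> (e / c) * norm (z - zbar)) (at zbar within \<Omega>)"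
    using assms(1)[unfolded regular_normal_cone_iff, rule_format, of "e / c"] assms(2) by (metis divide_pos_pos)
  then show "eventually (\<lambda>z. c *\<^sub>R \<zeta> \<bullet> (z - zbar) \<le> e * norm (z - zbar)) (at zbar within \<Omega>)"
    by eventually_elim (use assms(2) in \<open>simp add: pos_le_divide_eq mult.commute\<close>)
qed

text \<open>A violating sequence, scaled to \<open>norm q = 1\<close>, would accumulate at a nonzero limiting normal
  \<open>(0, q, 0)\<close>.\<close>

lemma middle_normal_bound:
  fixes G :: "('a::euclidean_space \<times> 'b::euclidean_space \<times> 'c::euclidean_space) set"
  assumes crit: "\<forall>q. (0, q, 0) \<in> limiting_normal_cone G gbar \<longrightarrow> q = 0"
  obtains C d where "C > 0" "d > 0"
    "\<And>\<gamma> z q w. \<gamma> \<in> G \<Longrightarrow> dist \<gamma> gbar < d \<Longrightarrow> (z, q, w) \<in> regular_normal_cone G \<gamma> \<Longrightarrow>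
       norm q \<le> C * (norm z + norm w)"
proof -
  have "\<exists>n::nat. \<forall>\<gamma> z q w. \<gamma> \<in> G \<longrightarrow> dist \<gamma> gbar < 1 / real (Suc n) \<longrightarrow>
      (z, q, w) \<in> regular_normal_cone G \<gamma> \<longrightarrow> norm q \<le> real (Suc n) * (norm z + norm w)"
  proof (rule ccontr)
    assume "\<not> ?thesis"
    then obtain \<gamma> z q w where
      seq: "\<And>n::nat. \<gamma> n \<in> G" "\<And>n. dist (\<gamma> n) gbar < 1 / real (Suc n)"
        "\<And>n. (z n, q n, w n) \<in> regular_normal_cone G (\<gamma> n)"
        "\<And>n. norm (q n) > real (Suc n) * (norm (z n) + norm (w n))"
      unfolding not_ex not_all not_imp not_le by metis
    have qpos: "norm (q n) > 0" for n
      using seq(4)[of n] by (smt (verit) mult_nonneg_nonneg norm_ge_zero of_nat_0_le_iff)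
    define q' where "q' n = q n /\<^sub>R norm (q n)" for n
    have q1: "norm (q' n) = 1" for n using qpos[of n] by (simp add: q'_def)
    have "bounded (range q')"
      by (rule boundedI[of _ 1]) (metis imageE order_refl q1)
    then obtain qq \<sigma> where \<sigma>: "strict_mono \<sigma>" "(q' \<circ> \<sigma>) \<longlonglongrightarrow> qq"
      using bounded_imp_convergent_subsequence by blast
    have "(\<lambda>n. norm ((q' \<circ> \<sigma>) n)) = (\<lambda>n. 1)" by (simp only: comp_apply q1)
    moreover have "(\<lambda>n. norm ((q' \<circ> \<sigma>) n)) \<longlonglongrightarrow> norm qq" using \<sigma>(2) by (rule tendsto_norm)
    ultimately have nq: "norm qq = 1" using LIMSEQ_const_iff by metis
    have zw: "norm (z n /\<^sub>R norm (q n)) \<le> 1 / real (Suc n)" "norm (w n /\<^sub>R norm (q n)) \<le> 1 / real (Suc n)" for n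
    proof -
      have "real (Suc n) * norm (z n) \<le> norm (q n)" "real (Suc n) * norm (w n) \<le> norm (q n)"
        using seq(4)[of n] by (smt (verit) mult_left_mono norm_ge_zero of_nat_0_le_iff)+
      then show "norm (z n /\<^sub>R norm (q n)) \<le> 1 / real (Suc n)" "norm (w n /\<^sub>R norm (q n)) \<le> 1 / real (Suc n)"
        using qpos[of n] by (simp_all add: field_simps del: of_nat_Suc)
    qed
    have z0: "(\<lambda>n. z n /\<^sub>R norm (q n)) \<longlonglongrightarrow> 0"
      by (rule Lim_null_comparison[OF _ divide_Suc_tendsto_0[of 1]]) (use zw in auto)
    have w0: "(\<lambda>n. w n /\<^sub>R norm (q n)) \<longlonglongrightarrow> 0"
      by (rule Lim_null_comparison[OF _ divide_Suc_tendsto_0[of 1]]) (use zw in auto)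
    have g0: "\<gamma> \<longlonglongrightarrow> gbar"
      by (rule tendsto_dist_bound[OF less_imp_le[OF seq(2)] divide_Suc_tendsto_0])
    define \<zeta> where "\<zeta> n = (z n /\<^sub>R norm (q n), q' n, w n /\<^sub>R norm (q n))" for n
    have "\<zeta> n = (1 / norm (q n)) *\<^sub>R (z n, q n, w n)" for n
      by (simp add: \<zeta>_def q'_def inverse_eq_divide)
    then have "\<zeta> n \<in> regular_normal_cone G (\<gamma> n)" for n
      using regular_normal_cone_scaleR[OF seq(3)[of n], of "1 / norm (q n)"] qpos[of n] by simp
    moreover have "(\<zeta> \<circ> \<sigma>) \<longlonglongrightarrow> (0, qq, 0)"
      unfolding \<zeta>_def comp_def
      using tendsto_Pair[OF LIMSEQ_subseq_LIMSEQ[OF z0 \<sigma>(1)] tendsto_Pair[OF \<sigma>(2) LIMSEQ_subseq_LIMSEQ[OF w0 \<sigma>(1)]]]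
      by (simp add: comp_def)
    moreover have "(\<gamma> \<circ> \<sigma>) \<longlonglongrightarrow> gbar" using LIMSEQ_subseq_LIMSEQ[OF g0 \<sigma>(1)] .
    ultimately have "(0, qq, 0) \<in> limiting_normal_cone G gbar"
      by (intro limiting_normal_coneI[of "\<gamma> \<circ> \<sigma>" _ "\<zeta> \<circ> \<sigma>"]) (simp_all add: seq(1))
    then have "qq = 0" using crit by blast
    with nq show False by simp
  qed
  then obtain n :: nat where n: "\<forall>\<gamma> z q w. \<gamma> \<in> G \<longrightarrow> dist \<gamma> gbar < 1 / real (Suc n) \<longrightarrow>
      (z, q, w) \<in> regular_normal_cone G \<gamma> \<longrightarrow> norm q \<le> real (Suc n) * (norm z + norm w)" by blast
  show thesis
    by (rule that[of "real (Suc n)" "1 / real (Suc n)"]) (simp, simp, use n in blast)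
qed

text \<open>The cap \<open>norm z \<le> K * norm w\<close> keeps a violating sequence scaled to \<open>norm w = 1\<close> bounded:
  without it \<open>z\<close> may blow up relative to \<open>w\<close>, and the hypotheses do not cover limits
  \<open>(z, q, 0)\<close> with \<open>z \<noteq> 0\<close>.\<close>

lemma normal_coercivity:
  fixes G :: "('a::euclidean_space \<times> 'b::euclidean_space \<times> 'a) set"
  assumes crit: "\<forall>q. (0, q, 0) \<in> limiting_normal_cone G gbar \<longrightarrow> q = 0"
    and pd: "\<forall>z q w. w \<noteq> 0 \<longrightarrow> (z, q, - w) \<in> limiting_normal_cone G gbar \<longrightarrow> A w \<bullet> w + z \<bullet> w > 0"
    and A: "bounded_linear A"
  obtains \<kappa> d where "\<kappa> > 0" "d > 0"
    "\<And>\<gamma> z q w. \<gamma> \<in> G \<Longrightarrow> dist \<gamma> gbar < d \<Longrightarrow> (z, q, - w) \<in> regular_normal_cone G \<gamma> \<Longrightarrow>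
       norm z \<le> K * norm w \<Longrightarrow> A w \<bullet> w + z \<bullet> w \<ge> \<kappa> * (norm w)\<^sup>2"
proof -
  obtain C d0 where C: "C > 0" "d0 > 0"
    "\<And>\<gamma> z q w. \<gamma> \<in> G \<Longrightarrow> dist \<gamma> gbar < d0 \<Longrightarrow> (z, q, w) \<in> regular_normal_cone G \<gamma> \<Longrightarrow>
       norm q \<le> C * (norm z + norm w)"
    using middle_normal_bound[OF crit] by metis
  have "\<exists>n::nat. \<forall>\<gamma> z q w. \<gamma> \<in> G \<longrightarrow> dist \<gamma> gbar < d0 / real (Suc n) \<longrightarrow>
      (z, q, -w) \<in> regular_normal_cone G \<gamma> \<longrightarrow> norm z \<le> K * norm w \<longrightarrow>
       A w \<bullet> w + z \<bullet> w \<ge> 1 / real (Suc n) * (norm w)\<^sup>2"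
  proof (rule ccontr)
    assume "\<not> ?thesis"
    then obtain \<gamma> z q w where
      seq: "\<And>n::nat. \<gamma> n \<in> G" "\<And>n. dist (\<gamma> n) gbar < d0 / real (Suc n)"
        "\<And>n. (z n, q n, - w n) \<in> regular_normal_cone G (\<gamma> n)"
        "\<And>n. norm (z n) \<le> K * norm (w n)"
        "\<And>n. A (w n) \<bullet> w n + z n \<bullet> w n < 1 / real (Suc n) * (norm (w n))\<^sup>2"
      unfolding not_ex not_all not_imp not_le by metis
    have w0: "w n \<noteq> 0" for n
    proof
      assume "w n = 0"
      then show False using seq(5)[of n] by (simp add: linear_0[OF bounded_linear.linear[OF A]])
    qed
    then have wpos: "norm (w n) > 0" for n by simp
    define \<zeta> where "\<zeta> n = (1 / norm (w n)) *\<^sub>R (z n, q n, - w n)" for n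
    have \<zeta>: "\<zeta> n \<in> regular_normal_cone G (\<gamma> n)" for n
      unfolding \<zeta>_def using regular_normal_cone_scaleR[OF seq(3)[of n], of "1 / norm (w n)"] wpos[of n] by simp
    have g0: "\<gamma> \<longlonglongrightarrow> gbar"
      by (rule tendsto_dist_bound[OF less_imp_le[OF seq(2)] divide_Suc_tendsto_0])
    have "norm (\<zeta> n) \<le> K + C * (K + 1) + 1" for n
    proof -
      have "d0 / real (Suc n) \<le> d0" using C(2) by (simp add: field_simps)
      then have "dist (\<gamma> n) gbar < d0" using seq(2)[of n] by linarith
      then have "norm (q n) \<le> C * (norm (z n) + norm (w n))"
        using C(3)[OF seq(1)[of n] _ seq(3)[of n]] by simp
      also have "\<dots> \<le> C * (K * norm (w n) + norm (w n))"
        using C(1) seq(4)[of n] by (intro mult_left_mono) auto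
      finally have q: "norm (q n) \<le> C * (K + 1) * norm (w n)" by (simp add: algebra_simps)
      have "norm (z n, q n, - w n) \<le> norm (z n) + (norm (q n) + norm (- w n))"
        by (intro order_trans[OF norm_Pair_le] add_left_mono norm_Pair_le)
      also have "\<dots> \<le> (K + C * (K + 1) + 1) * norm (w n)"
        using q seq(4)[of n] by (simp add: algebra_simps)
      finally show ?thesis unfolding \<zeta>_def norm_scaleR using wpos[of n] by (simp add: pos_divide_le_eq)
    qed
    then have "bounded (range \<zeta>)" by (intro boundedI) auto
    then obtain \<zeta>0 \<sigma> where \<sigma>: "strict_mono \<sigma>" "(\<zeta> \<circ> \<sigma>) \<longlonglongrightarrow> \<zeta>0"
      using bounded_imp_convergent_subsequence by blast
    obtain z0 q0 w0' where z0: "\<zeta>0 = (z0, q0, w0')" by (cases \<zeta>0)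
    define w1 where "w1 = - w0'"
    have "\<zeta>0 \<in> limiting_normal_cone G gbar"
      using \<sigma>(2) LIMSEQ_subseq_LIMSEQ[OF g0 \<sigma>(1)]
      by (intro limiting_normal_coneI[of "\<gamma> \<circ> \<sigma>" _ "\<zeta> \<circ> \<sigma>"]) (simp_all add: seq(1) \<zeta>)
    then have lim: "(z0, q0, - w1) \<in> limiting_normal_cone G gbar" by (simp add: z0 w1_def)
    let ?z = "\<lambda>n. (1 / norm (w (\<sigma> n))) *\<^sub>R z (\<sigma> n)"
    let ?w = "\<lambda>n. (1 / norm (w (\<sigma> n))) *\<^sub>R w (\<sigma> n)"
    have zl: "?z \<longlonglongrightarrow> z0" using tendsto_fst[OF \<sigma>(2)] by (simp add: \<zeta>_def z0 comp_def)
    have wl: "?w \<longlonglongrightarrow> w1"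
      using tendsto_minus[OF tendsto_snd[OF tendsto_snd[OF \<sigma>(2)]]] by (simp add: \<zeta>_def z0 comp_def w1_def)
    have "norm (?w n) = 1" for n using wpos[of "\<sigma> n"] by simp
    then have "(\<lambda>n. norm (?w n)) = (\<lambda>n. 1)" by simp
    moreover have "(\<lambda>n. norm (?w n)) \<longlonglongrightarrow> norm w1" using wl by (rule tendsto_norm)
    ultimately have "norm w1 = 1" using LIMSEQ_const_iff by metis
    then have "w1 \<noteq> 0" by auto
    then have pos: "A w1 \<bullet> w1 + z0 \<bullet> w1 > 0" using pd lim by blast
    have "(\<lambda>n. A (?w n) \<bullet> ?w n + ?z n \<bullet> ?w n) \<longlonglongrightarrow> A w1 \<bullet> w1 + z0 \<bullet> w1"
      by (intro tendsto_intros bounded_linear.tendsto[OF A] zl wl)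
    moreover have "A (?w n) \<bullet> ?w n + ?z n \<bullet> ?w n \<le> 1 / real (Suc (\<sigma> n))" for n
    proof -
      let ?m = "norm (w (\<sigma> n))"
      have "A (?w n) \<bullet> ?w n + ?z n \<bullet> ?w n = (A (w (\<sigma> n)) \<bullet> w (\<sigma> n) + z (\<sigma> n) \<bullet> w (\<sigma> n)) / ?m\<^sup>2"
        by (simp add: linear_simps(5)[OF A] power2_eq_square add_divide_distrib)
      also have "\<dots> \<le> (1 / real (Suc (\<sigma> n)) * ?m\<^sup>2) / ?m\<^sup>2"
        using less_imp_le[OF seq(5)[of "\<sigma> n"]] by (intro divide_right_mono) auto
      also have "\<dots> = 1 / real (Suc (\<sigma> n))" using wpos[of "\<sigma> n"] by simp
      finally show ?thesis .
    qed
    ultimately have "A w1 \<bullet> w1 + z0 \<bullet> w1 \<le> 0"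
      using LIMSEQ_le[OF _ LIMSEQ_subseq_LIMSEQ[OF divide_Suc_tendsto_0[of 1] \<sigma>(1)]] by (simp add: comp_def)
    with pos show False by simp
  qed
  then obtain n :: nat where n: "\<forall>\<gamma> z q w. \<gamma> \<in> G \<longrightarrow> dist \<gamma> gbar < d0 / real (Suc n) \<longrightarrow>
      (z, q, -w) \<in> regular_normal_cone G \<gamma> \<longrightarrow> norm z \<le> K * norm w \<longrightarrow>
       A w \<bullet> w + z \<bullet> w \<ge> 1 / real (Suc n) * (norm w)\<^sup>2" by blast
  show thesis
    by (rule that[of "1 / real (Suc n)" "d0 / real (Suc n)"]) (simp, simp add: C(2), use n in blast)
qed

section \<open>An approximate mean value theorem\<close>

text \<open>Minimize \<open>\<phi> (a + t *\<^sub>R (b - a) + h) + k * (norm h)\<^sup>2 - t * r\<close> over \<open>0 \<le> t \<le> 1\<close> and small \<open>h\<close>, where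
  \<open>r\<close> is slightly less than \<open>\<phi> b - \<phi> a\<close>.  Optimality in \<open>h\<close> yields the proximal subgradient
  \<open>- (2 * k) *\<^sub>R h\<close>, optimality in \<open>t\<close> its slope along \<open>b - a\<close>.\<close>

lemma proximal_mean_value:
  fixes \<phi> :: "'a::euclidean_space \<Rightarrow> real"
  assumes S: "open S" "convex S" and cont: "continuous_on S \<phi>" and ab: "a \<in> S" "b \<in> S" and eps: "e > 0"
  obtains c \<xi> k d where "c \<in> S" "d > 0"
    "\<And>u. dist u c < d \<Longrightarrow> \<phi> u \<ge> \<phi> c + \<xi> \<bullet> (u - c) - k * (norm (u - c))\<^sup>2"
    "\<xi> \<bullet> (b - a) \<ge> \<phi> b - \<phi> a - e"
proof -
  define s where "s t = a + t *\<^sub>R (b - a)" for t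
  have s01: "s ` {0..1} = closed_segment a b"
  proof -
    have "s t = (1 - t) *\<^sub>R a + t *\<^sub>R b" for t by (simp add: s_def algebra_simps)
    then show ?thesis unfolding closed_segment_def by (auto simp: image_def)
  qed
  have seg: "closed_segment a b \<subseteq> S" using S(2) ab by (simp add: closed_segment_subset)
  obtain d0 where d0: "d0 > 0" "(\<Union>x\<in>closed_segment a b. cball x d0) \<subseteq> S"
    using compact_subset_open_imp_cball_epsilon_subset[OF compact_segment S(1) seg] by blast
  have inS: "s t + h \<in> S" if "t \<in> {0..1}" "norm h \<le> d0" for t h
  proof -
    have "s t + h \<in> cball (s t) d0" using that(2) by (simp add: dist_norm)
    moreover have "s t \<in> closed_segment a b" using s01 that(1) by blast
    ultimately show ?thesis using d0(2) by blast
  qed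
  obtain d1 where d1: "d1 > 0" "\<And>u. u \<in> S \<Longrightarrow> dist u b < d1 \<Longrightarrow> dist (\<phi> u) (\<phi> b) < e"
    using cont ab(2) eps unfolding continuous_on_iff by metis
  define r where "r = \<phi> b - \<phi> a - e"
  define T where "T = {0..1::real} \<times> cball (0::'a) d0"
  have cT: "compact T" unfolding T_def by (intro compact_Times) auto
  have cphi: "continuous_on T (\<lambda>(t, h). \<phi> (s t + h))"
    unfolding split_def
    by (rule continuous_on_compose2[OF cont])
      (auto simp: s_def T_def intro!: continuous_intros inS[unfolded s_def])
  obtain B where B: "\<And>t h. (t, h) \<in> T \<Longrightarrow> \<bar>\<phi> (s t + h)\<bar> \<le> B"
    using compact_imp_bounded[OF compact_continuous_image[OF cphi cT]]
    unfolding bounded_iff by fastforce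
  \<comment> \<open>The penalty is so large that a minimizer has \<open>norm h < min d0 d1\<close>.\<close>
  define m where "m = min d0 d1"
  have m: "m > 0" using d0 d1 by (simp add: m_def)
  define k where "k = (2 * \<bar>B\<bar> + \<bar>r\<bar> + 1) / m\<^sup>2"
  have k: "k > 0" using m by (simp add: k_def add_nonneg_pos)
  define \<Phi> where "\<Phi> = (\<lambda>(t, h). \<phi> (s t + h) + k * (norm h)\<^sup>2 - t * r)"
  have "continuous_on T \<Phi>"
    unfolding \<Phi>_def using cphi unfolding split_def by (intro continuous_intros)
  moreover have "(0, 0) \<in> T" using d0 by (simp add: T_def)
  ultimately obtain th where th: "th \<in> T" "\<And>x. x \<in> T \<Longrightarrow> \<Phi> th \<le> \<Phi> x"
    using continuous_attains_inf[OF cT] by blast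
  obtain t h where th_eq: "th = (t, h)" by (cases th)
  have tT: "t \<in> {0..1}" "norm h \<le> d0" using th(1) by (auto simp: th_eq T_def)
  have min: "\<phi> (s t + h) + k * (norm h)\<^sup>2 - t * r \<le> \<phi> (s t' + h') + k * (norm h')\<^sup>2 - t' * r"
    if "t' \<in> {0..1}" "norm h' \<le> d0" for t' h'
    using th(2)[of "(t', h')"] that by (simp add: th_eq \<Phi>_def T_def)
  have min0: "\<phi> (s t + h) + k * (norm h)\<^sup>2 - t * r \<le> \<phi> a"
    using min[of 0 0] d0 by (simp add: s_def)
  have hm: "norm h < m"
  proof (rule ccontr)
    assume "\<not> ?thesis"
    then have "m\<^sup>2 \<le> (norm h)\<^sup>2" using m by (simp add: power_mono)
    then have "k * m\<^sup>2 \<le> k * (norm h)\<^sup>2" using k by (simp add: mult_left_mono)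
    moreover have "k * m\<^sup>2 = 2 * \<bar>B\<bar> + \<bar>r\<bar> + 1" using m by (simp add: k_def)
    moreover have "\<bar>\<phi> (s t + h)\<bar> \<le> B" "\<bar>\<phi> a\<bar> \<le> B"
      using B[of t h] B[of 0 0] tT d0 by (auto simp: T_def s_def)
    moreover have "t * r \<le> \<bar>r\<bar>"
      using tT by (smt (verit, best) atLeastAtMost_iff mult_left_le_one_le mult_nonneg_nonpos)
    ultimately show False using min0 by linarith
  qed
  then have hd: "norm h < d0" "norm h < d1" by (auto simp: m_def)
  \<comment> \<open>Here the loss \<open>e\<close> pays off: the end point \<open>t = 1\<close> is worse than the starting point \<open>a\<close>.\<close>
  have t1: "t < 1"
  proof (rule ccontr)
    assume "\<not> ?thesis"
    then have "t = 1" using tT by simp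
    then have st: "s t = b" by (simp add: s_def)
    have "dist (b + h) b < d1" using hd by (simp add: dist_norm)
    then have "\<phi> (b + h) > \<phi> b - e"
      using d1(2)[of "b + h"] inS[OF tT] st by (simp add: dist_real_def)
    moreover have "\<phi> (b + h) + k * (norm h)\<^sup>2 - r \<le> \<phi> a" using min0 st \<open>t = 1\<close> by simp
    moreover have "k * (norm h)\<^sup>2 \<ge> 0" using k by simp
    ultimately show False by (simp add: r_def)
  qed
  define \<xi> where "\<xi> = - (2 * k) *\<^sub>R h"
  define c where "c = s t + h"
  have 1: "\<phi> u \<ge> \<phi> c + \<xi> \<bullet> (u - c) - k * (norm (u - c))\<^sup>2" if "dist u c < d0 - norm h" for u
  proof -
    have "norm (h + (u - c)) \<le> norm h + norm (u - c)" by (rule norm_triangle_ineq)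
    also have "\<dots> \<le> d0" using that by (simp add: dist_norm)
    finally have "\<phi> c + k * (norm h)\<^sup>2 \<le> \<phi> u + k * (norm (h + (u - c)))\<^sup>2"
      using min[OF tT(1), of "h + (u - c)"] by (simp add: c_def)
    moreover have "(norm (h + (u - c)))\<^sup>2 = (norm h)\<^sup>2 + 2 * (h \<bullet> (u - c)) + (norm (u - c))\<^sup>2"
      by (simp add: power2_norm_eq_inner inner_simps inner_commute)
    then have "k * (norm (h + (u - c)))\<^sup>2 = k * (norm h)\<^sup>2 - \<xi> \<bullet> (u - c) + k * (norm (u - c))\<^sup>2"
      by (simp only: distrib_left) (simp add: \<xi>_def)
    ultimately show ?thesis by linarith
  qed
  \<comment> \<open>Moving \<open>t\<close> up by \<open>\<tau>\<close> while keeping the point \<open>s t + h\<close> fixed gives the slope estimate.\<close>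
  have 2: "\<xi> \<bullet> (b - a) \<ge> r"
  proof (rule ccontr)
    assume neg: "\<not> ?thesis"
    define D where "D = b - a"
    have D0: "r - \<xi> \<bullet> D > 0" using neg by (simp add: D_def)
    define \<tau> where "\<tau> = min (1 - t) (min ((d0 - norm h) / (norm D + 1)) ((r - \<xi> \<bullet> D) / (2 * (k * (norm D)\<^sup>2 + 1))))"
    have den: "2 * (k * (norm D)\<^sup>2 + 1) > 0" using k by (simp add: add_nonneg_pos)
    have \<tau>0: "\<tau> > 0" using t1 hd D0 den by (auto simp: \<tau>_def add_nonneg_pos intro!: divide_pos_pos)
    have \<tau>1: "\<tau> \<le> 1 - t" by (simp add: \<tau>_def)
    have \<tau>2: "\<tau> * norm D \<le> d0 - norm h"
    proof -
      have "\<tau> \<le> (d0 - norm h) / (norm D + 1)" by (simp add: \<tau>_def)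
      then have "\<tau> * (norm D + 1) \<le> d0 - norm h" by (simp add: pos_le_divide_eq add_nonneg_pos)
      then show ?thesis using \<tau>0 by (simp add: algebra_simps)
    qed
    have \<tau>3: "\<tau> * (2 * (k * (norm D)\<^sup>2 + 1)) \<le> r - \<xi> \<bullet> D"
    proof -
      have "\<tau> \<le> (r - \<xi> \<bullet> D) / (2 * (k * (norm D)\<^sup>2 + 1))" by (simp add: \<tau>_def)
      then show ?thesis using den by (simp add: pos_le_divide_eq)
    qed
    have "norm (h - \<tau> *\<^sub>R D) \<le> norm h + \<tau> * norm D"
      using norm_triangle_ineq4[of h "\<tau> *\<^sub>R D"] \<tau>0 by simp
    then have "norm (h - \<tau> *\<^sub>R D) \<le> d0" using \<tau>2 by linarith
    moreover have "t + \<tau> \<in> {0..1}" using tT \<tau>0 \<tau>1 by simp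
    moreover have same: "s (t + \<tau>) + (h - \<tau> *\<^sub>R D) = s t + h" by (simp add: s_def D_def algebra_simps)
    ultimately have "k * (norm h)\<^sup>2 - t * r \<le> k * (norm (h - \<tau> *\<^sub>R D))\<^sup>2 - (t + \<tau>) * r"
      using min[of "t + \<tau>" "h - \<tau> *\<^sub>R D"] unfolding same by linarith
    moreover have "(norm (h - \<tau> *\<^sub>R D))\<^sup>2 = (norm h)\<^sup>2 - 2 * \<tau> * (h \<bullet> D) + \<tau>\<^sup>2 * (norm D)\<^sup>2"
      unfolding power2_norm_eq_inner by (simp add: inner_simps inner_commute power2_eq_square)
    then have "k * (norm (h - \<tau> *\<^sub>R D))\<^sup>2 = k * (norm h)\<^sup>2 + \<tau> * (\<xi> \<bullet> D) + \<tau> * (\<tau> * (k * (norm D)\<^sup>2))"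
      by (simp only:) (simp add: \<xi>_def algebra_simps power2_eq_square)
    ultimately have "\<tau> * r \<le> \<tau> * (\<xi> \<bullet> D + \<tau> * (k * (norm D)\<^sup>2))"
      by (simp only: distrib_left distrib_right)
    then have "r \<le> \<xi> \<bullet> D + \<tau> * (k * (norm D)\<^sup>2)" using \<tau>0 by simp
    moreover have "\<tau> * (k * (norm D)\<^sup>2) < \<tau> * (2 * (k * (norm D)\<^sup>2 + 1))"
      using \<tau>0 k by (intro mult_strict_left_mono) (auto simp: add_nonneg_pos)
    ultimately show False using \<tau>3 by linarith
  qed
  show thesis
    using that[of c "d0 - norm h" \<xi> k] 1 2 hd inS[OF tT] by (simp add: c_def r_def)
qed

section \<open>A local Baillon-Haddad inequality\<close>

lemma monotone_gradient_lower_bound: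
  fixes E :: "'a::real_inner \<Rightarrow> real" and M :: "'a \<Rightarrow> 'a"
  assumes B: "convex B"
    and upper: "\<And>u v. u \<in> B \<Longrightarrow> v \<in> B \<Longrightarrow> E v \<le> E u + M u \<bullet> (v - u) + K * (norm (v - u))\<^sup>2"
    and mono: "\<And>u v. u \<in> B \<Longrightarrow> v \<in> B \<Longrightarrow> (M v - M u) \<bullet> (v - u) \<ge> c * (norm (v - u))\<^sup>2"
    and lip: "\<And>u v. u \<in> B \<Longrightarrow> v \<in> B \<Longrightarrow> norm (M v - M u) \<le> L * norm (v - u)"
    and uv: "u \<in> B" "v \<in> B"
  shows "E v \<ge> E u + M u \<bullet> (v - u) + c / 2 * (norm (v - u))\<^sup>2"
proof -
  define D where "D = v - u"
  define s where "s t = u + t *\<^sub>R D" for t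
  have sB: "s t \<in> B" if "t \<in> {0..1}" for t
  proof -
    have "s t = (1 - t) *\<^sub>R u + t *\<^sub>R v" by (simp add: s_def D_def algebra_simps)
    then show ?thesis using that B uv by (simp add: convexD_alt)
  qed
  define \<phi> where "\<phi> t = E (s t) - t * (M u \<bullet> D) - c / 2 * (norm D)\<^sup>2 * t\<^sup>2" for t
  \<comment> \<open>The upper bound, used in both directions, makes \<open>M\<close> the gradient of \<open>E\<close>.\<close>
  have two_sided: "\<bar>E b - E a - M a \<bullet> (b - a)\<bar> \<le> (\<bar>K\<bar> + \<bar>L\<bar>) * (norm (b - a))\<^sup>2" if "a \<in> B" "b \<in> B" for a b
  proof -
    have "K * (norm (b - a))\<^sup>2 \<le> \<bar>K\<bar> * (norm (b - a))\<^sup>2" by (simp add: mult_right_mono)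
    moreover have "E b \<le> E a + M a \<bullet> (b - a) + K * (norm (b - a))\<^sup>2" using upper that by blast
    moreover have "E a \<le> E b + M b \<bullet> (a - b) + K * (norm (b - a))\<^sup>2"
      using upper[of b a] that by (simp add: norm_minus_commute)
    moreover have "\<bar>(M b - M a) \<bullet> (b - a)\<bar> \<le> \<bar>L\<bar> * (norm (b - a))\<^sup>2"
    proof -
      have "\<bar>(M b - M a) \<bullet> (b - a)\<bar> \<le> norm (M b - M a) * norm (b - a)" by (rule Cauchy_Schwarz_ineq2)
      also have "\<dots> \<le> (L * norm (b - a)) * norm (b - a)" using lip that by (intro mult_right_mono) auto
      also have "\<dots> = L * (norm (b - a))\<^sup>2" by (simp add: power2_eq_square)
      also have "\<dots> \<le> \<bar>L\<bar> * (norm (b - a))\<^sup>2" by (simp add: mult_right_mono)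
      finally show ?thesis .
    qed
    moreover have "M b \<bullet> (a - b) = - (M a \<bullet> (b - a)) - (M b - M a) \<bullet> (b - a)" by (simp add: inner_simps)
    moreover have "(\<bar>K\<bar> + \<bar>L\<bar>) * (norm (b - a))\<^sup>2 = \<bar>K\<bar> * (norm (b - a))\<^sup>2 + \<bar>L\<bar> * (norm (b - a))\<^sup>2"
      by (simp add: algebra_simps)
    moreover have "\<bar>L\<bar> * (norm (b - a))\<^sup>2 \<ge> 0" by simp
    ultimately show ?thesis by linarith
  qed
  have dE: "((\<lambda>t. E (s t)) has_derivative (\<lambda>h. h * (M (s t) \<bullet> D))) (at t within {0..1})" if t: "t \<in> {0..1}" for t
  proof (rule has_derivativeI_sandwich[of 1])
    show "bounded_linear (\<lambda>h. h * (M (s t) \<bullet> D))" by (rule bounded_linear_mult_left)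
    show "((\<lambda>y. (\<bar>K\<bar> + \<bar>L\<bar>) * (norm D)\<^sup>2 * \<bar>y - t\<bar>) \<longlongrightarrow> 0) (at t within {0..1})"
      by (auto intro!: tendsto_eq_intros)
    fix y assume y: "y \<in> {0..1}" "y \<noteq> t"
    have d: "s y - s t = (y - t) *\<^sub>R D" by (simp add: s_def algebra_simps)
    have "\<bar>E (s y) - E (s t) - M (s t) \<bullet> (s y - s t)\<bar> \<le> (\<bar>K\<bar> + \<bar>L\<bar>) * (norm (s y - s t))\<^sup>2"
      using two_sided sB y t by blast
    then have "\<bar>E (s y) - E (s t) - (y - t) * (M (s t) \<bullet> D)\<bar> \<le> ((\<bar>K\<bar> + \<bar>L\<bar>) * (norm D)\<^sup>2 * \<bar>y - t\<bar>) * \<bar>y - t\<bar>"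
      unfolding d by (simp add: power_mult_distrib power2_eq_square ac_simps)
    then show "norm (E (s y) - E (s t) - (y - t) * (M (s t) \<bullet> D)) / norm (y - t)
        \<le> (\<bar>K\<bar> + \<bar>L\<bar>) * (norm D)\<^sup>2 * \<bar>y - t\<bar>"
      using y by (simp add: pos_divide_le_eq)
  qed simp
  have d\<phi>: "(\<phi> has_derivative (\<lambda>h. h * ((M (s t) - M u) \<bullet> D - c * t * (norm D)\<^sup>2))) (at t within {0..1})"
    if t: "0 \<le> t" "t \<le> 1" for t
  proof -
    have 1: "((\<lambda>t. t * (M u \<bullet> D)) has_derivative (\<lambda>h. h * (M u \<bullet> D))) (at t within {0..1})"
      by (rule bounded_linear_imp_has_derivative) (rule bounded_linear_mult_left)
    have 2: "((\<lambda>t. c / 2 * (norm D)\<^sup>2 * t\<^sup>2) has_derivative (\<lambda>h. h * (c * t * (norm D)\<^sup>2))) (at t within {0..1})"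
      by (auto intro!: derivative_eq_intros simp: fun_eq_iff)
    have "t \<in> {0..1}" using t by simp
    then have "(\<phi> has_derivative (\<lambda>h. h * (M (s t) \<bullet> D) - h * (M u \<bullet> D) - h * (c * t * (norm D)\<^sup>2))) (at t within {0..1})"
      unfolding \<phi>_def by (intro has_derivative_diff dE 1 2)
    then show ?thesis by (simp add: inner_diff_left right_diff_distrib)
  qed
  obtain t where t: "t \<in> {0..1}" "\<phi> 1 - \<phi> 0 = (1 - 0) * ((M (s t) - M u) \<bullet> D - c * t * (norm D)\<^sup>2)"
    using mvt_very_simple[of 0 1 \<phi> "\<lambda>t h. h * ((M (s t) - M u) \<bullet> D - c * t * (norm D)\<^sup>2)"] d\<phi> by auto
  have "(M (s t) - M u) \<bullet> D - c * t * (norm D)\<^sup>2 \<ge> 0"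
  proof (cases "t = 0")
    case True then show ?thesis by (simp add: s_def)
  next
    case False
    then have tp: "t > 0" using t by simp
    have su: "s t - u = t *\<^sub>R D" by (simp add: s_def)
    have "c * (norm (s t - u))\<^sup>2 \<le> (M (s t) - M u) \<bullet> (s t - u)" using mono sB t uv by blast
    then have "t * (c * t * (norm D)\<^sup>2) \<le> t * ((M (s t) - M u) \<bullet> D)"
      unfolding su by (simp add: power_mult_distrib power2_eq_square ac_simps)
    then show ?thesis using tp by simp
  qed
  then have "\<phi> 1 \<ge> \<phi> 0" using t by simp
  then show ?thesis by (simp add: \<phi>_def s_def D_def)
qed

text \<open>Strong monotonicity in \<open>y\<close> is upgraded to strong monotonicity in \<open>y - lam *\<^sub>R M y\<close>.  This needs \<open>M\<close> to
  be a gradient: in the plane, a quarter turn plus a small multiple of the identity is strongly monotone in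
  \<open>y\<close> but violates the conclusion.  The convexity inequality at \<open>u\<close> and the quadratic upper bound at \<open>v\<close>
  are compared at the point that minimizes the difference of the two; this point may leave the ball of
  \<open>u\<close> and \<open>v\<close>, whence the two radii.\<close>

lemma local_Baillon_Haddad:
  fixes E :: "'a::real_inner \<Rightarrow> real" and M :: "'a \<Rightarrow> 'a"
  assumes lam: "lam > 0" and c: "c > 0" "2 * (c * lam) \<le> 1" and L: "L \<ge> 0"
    and upper: "\<And>u v. u \<in> ball y0 R \<Longrightarrow> v \<in> ball y0 R \<Longrightarrow>
        E v \<le> E u + M u \<bullet> (v - u) + (norm (v - u))\<^sup>2 / (2 * lam)"
    and mono: "\<And>u v. u \<in> ball y0 R \<Longrightarrow> v \<in> ball y0 R \<Longrightarrow>
        (M v - M u) \<bullet> (v - u) \<ge> c * (norm (v - u))\<^sup>2"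
    and lip: "\<And>u v. u \<in> ball y0 R \<Longrightarrow> v \<in> ball y0 R \<Longrightarrow> norm (M v - M u) \<le> L * norm (v - u)"
    and \<rho>: "\<rho> * (1 + 4 * lam * (L + c)) \<le> R"
    and uv: "u \<in> ball y0 \<rho>" "v \<in> ball y0 \<rho>"
  shows "(M v - M u) \<bullet> ((v - lam *\<^sub>R M v) - (u - lam *\<^sub>R M u)) \<ge>
      c * (norm ((v - lam *\<^sub>R M v) - (u - lam *\<^sub>R M u)))\<^sup>2"
proof -
  define N where "N w = M w - c *\<^sub>R w" for w
  define \<Lambda> where "\<Lambda> = 1 / lam - c"
  have c2: "c \<le> 1 / lam / 2" using c lam by (simp add: field_simps)
  have \<Lambda>: "\<Lambda> > 0" "1 / \<Lambda> \<le> 2 * lam"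
  proof -
    have "\<Lambda> \<ge> 1 / lam / 2" using c2 by (simp add: \<Lambda>_def)
    moreover have "1 / lam / 2 > 0" using lam by simp
    ultimately show "\<Lambda> > 0" by linarith
    then show "1 / \<Lambda> \<le> 2 * lam"
      using \<open>\<Lambda> \<ge> 1 / lam / 2\<close> lam by (simp add: field_simps)
  qed
  have \<rho>0: "\<rho> > 0" using uv by (metis ball_eq_empty empty_iff not_less)
  have fac: "4 * lam * (L + c) \<ge> 0" using lam L c by simp
  have \<rho>R: "\<rho> \<le> R"
  proof -
    have "\<rho> * 1 \<le> \<rho> * (1 + 4 * lam * (L + c))" using \<rho>0 fac by (intro mult_left_mono) auto
    then show ?thesis using \<rho> by simp
  qed
  have half: "(norm (N b - N a))\<^sup>2 / (2 * \<Lambda>) \<le> E b - E a - c / 2 * ((norm b)\<^sup>2 - (norm a)\<^sup>2) - N a \<bullet> (b - a)"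
    if ab: "a \<in> ball y0 \<rho>" "b \<in> ball y0 \<rho>" for a b
  proof -
    have abR: "a \<in> ball y0 R" "b \<in> ball y0 R" using ab \<rho>R by auto
    define g where "g = N b - N a"
    define y where "y = b - (1 / \<Lambda>) *\<^sub>R g"
    have "norm (b - a) \<le> 2 * \<rho>"
      using ab norm_triangle_ineq4[of "b - y0" "a - y0"] by (simp add: dist_norm norm_minus_commute)
    have "g = (M b - M a) - c *\<^sub>R (b - a)" by (simp add: g_def N_def algebra_simps)
    then have "norm g \<le> norm (M b - M a) + c * norm (b - a)"
      using norm_triangle_ineq4[of "M b - M a" "c *\<^sub>R (b - a)"] c by simp
    also have "\<dots> \<le> (L + c) * norm (b - a)" using lip[OF abR] by (simp add: algebra_simps)
    also have "\<dots> \<le> (L + c) * (2 * \<rho>)" using \<open>norm (b - a) \<le> 2 * \<rho>\<close> L c by (intro mult_left_mono) auto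
    finally have g: "norm g \<le> (L + c) * (2 * \<rho>)" .
    have "1 / \<Lambda> * norm g \<le> (2 * lam) * ((L + c) * (2 * \<rho>))"
      using \<Lambda> g lam by (intro mult_mono) auto
    then have "dist b y \<le> \<rho> * (4 * lam * (L + c))"
      using \<Lambda> by (simp add: y_def dist_norm algebra_simps)
    moreover have "dist y0 b < \<rho>" using ab by simp
    ultimately have "dist y0 y < R"
      using dist_triangle[of y0 y b] \<rho> by (simp add: algebra_simps)
    then have yR: "y \<in> ball y0 R" by simp
    have "E a + M a \<bullet> (y - a) + c / 2 * (norm (y - a))\<^sup>2 \<le> E y"
      by (rule monotone_gradient_lower_bound[of "ball y0 R" E M "1 / (2 * lam)" c L])
        (use upper mono lip abR yR in auto)
    also have "E y \<le> E b + M b \<bullet> (y - b) + (norm (y - b))\<^sup>2 / (2 * lam)" using upper abR yR by blast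
    finally have main: "E a + M a \<bullet> (y - a) + c / 2 * (norm (y - a))\<^sup>2
        \<le> E b + M b \<bullet> (y - b) + (norm (y - b))\<^sup>2 / (2 * lam)" .
    have Ma: "M a = N a + c *\<^sub>R a" "M b = N b + c *\<^sub>R b" by (simp_all add: N_def)
    have e1: "M a \<bullet> (y - a) + c / 2 * (norm (y - a))\<^sup>2 = N a \<bullet> (y - a) + c / 2 * ((norm y)\<^sup>2 - (norm a)\<^sup>2)"
      unfolding Ma power2_norm_eq_inner by (simp add: inner_simps inner_commute algebra_simps)
    have e2: "M b \<bullet> (y - b) + (norm (y - b))\<^sup>2 / (2 * lam)
        = N b \<bullet> (y - b) + c / 2 * ((norm y)\<^sup>2 - (norm b)\<^sup>2) + \<Lambda> / 2 * (norm (y - b))\<^sup>2"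
      unfolding Ma power2_norm_eq_inner \<Lambda>_def
      by (simp add: inner_simps inner_commute algebra_simps diff_divide_distrib add_divide_distrib)
    have yb: "y - b = - (1 / \<Lambda>) *\<^sub>R g" "y - a = (b - a) - (1 / \<Lambda>) *\<^sub>R g" by (simp_all add: y_def)
    have "N b \<bullet> (y - b) - N a \<bullet> (y - a) + \<Lambda> / 2 * (norm (y - b))\<^sup>2
        = - (1 / \<Lambda>) * (g \<bullet> g) + \<Lambda> / 2 * ((1 / \<Lambda>)\<^sup>2 * (g \<bullet> g)) - N a \<bullet> (b - a)"
      unfolding yb power2_norm_eq_inner
      by (simp add: g_def inner_simps inner_commute algebra_simps power2_eq_square)
    also have "\<dots> = - (norm g)\<^sup>2 / (2 * \<Lambda>) - N a \<bullet> (b - a)"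
      using \<Lambda> by (simp add: dot_square_norm power2_eq_square field_simps)
    finally have e3: "N b \<bullet> (y - b) - N a \<bullet> (y - a) + \<Lambda> / 2 * (norm (y - b))\<^sup>2
        = - (norm g)\<^sup>2 / (2 * \<Lambda>) - N a \<bullet> (b - a)" .
    show ?thesis using main e1 e2 e3 unfolding g_def by (simp add: algebra_simps)
  qed
  define d where "d = v - u"
  define m where "m = M v - M u"
  have Nd: "N v - N u = m - c *\<^sub>R d" by (simp add: N_def m_def d_def algebra_simps)
  have "(norm (N v - N u))\<^sup>2 / (2 * \<Lambda>) + (norm (N u - N v))\<^sup>2 / (2 * \<Lambda>) \<le> (N v - N u) \<bullet> (v - u)"
    using half[OF uv] half[OF uv(2,1)] by (simp add: inner_simps algebra_simps)
  then have "(norm (m - c *\<^sub>R d))\<^sup>2 / \<Lambda> \<le> (m - c *\<^sub>R d) \<bullet> d"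
    by (simp add: norm_minus_commute[of "N u"] Nd d_def)
  then have "(norm (m - c *\<^sub>R d))\<^sup>2 \<le> \<Lambda> * ((m - c *\<^sub>R d) \<bullet> d)" using \<Lambda> by (simp add: field_simps)
  then have "lam * (norm (m - c *\<^sub>R d))\<^sup>2 \<le> lam * (\<Lambda> * ((m - c *\<^sub>R d) \<bullet> d))" using lam by simp
  also have "\<dots> = (1 - c * lam) * ((m - c *\<^sub>R d) \<bullet> d)" using lam by (simp add: \<Lambda>_def field_simps)
  finally have "(m - c *\<^sub>R d) \<bullet> ((1 - c * lam) *\<^sub>R d - lam *\<^sub>R (m - c *\<^sub>R d)) \<ge> 0"
    by (simp add: power2_norm_eq_inner inner_simps)
  moreover have "(1 - c * lam) *\<^sub>R d - lam *\<^sub>R (m - c *\<^sub>R d) = d - lam *\<^sub>R m" by (simp add: algebra_simps)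
  ultimately have fin: "(m - c *\<^sub>R d) \<bullet> (d - lam *\<^sub>R m) \<ge> 0" by simp
  define x where "x = d - lam *\<^sub>R m"
  have "d = x + lam *\<^sub>R m" by (simp add: x_def)
  then have "(m - c *\<^sub>R d) \<bullet> x = (1 - c * lam) * (m \<bullet> x) - c * (norm x)\<^sup>2"
    by (simp add: power2_norm_eq_inner inner_simps algebra_simps)
  then have ineq: "c * (norm x)\<^sup>2 \<le> (1 - c * lam) * (m \<bullet> x)" using fin by (simp add: x_def)
  have cl: "c * lam > 0" using c lam by simp
  have "m \<bullet> x \<ge> 0"
  proof (rule ccontr)
    assume "\<not> ?thesis"
    then have "(1 - c * lam) * (m \<bullet> x) < 0" using c by (intro mult_pos_neg) auto
    then show False using ineq c by (smt (verit) mult_nonneg_nonneg zero_le_power2)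
  qed
  then have "(1 - c * lam) * (m \<bullet> x) \<le> 1 * (m \<bullet> x)" using cl by (intro mult_right_mono) auto
  then have "c * (norm x)\<^sup>2 \<le> m \<bullet> x" using ineq by simp
  moreover have "x = (v - lam *\<^sub>R M v) - (u - lam *\<^sub>R M u)" by (simp add: x_def d_def m_def algebra_simps)
  ultimately show ?thesis by (simp add: m_def)
qed

section \<open>Graphs with a resolvent chart\<close>

text \<open>The coordinates \<open>y = x + lam *\<^sub>R (v + A x)\<close> and \<open>p\<close> on a set \<open>G\<close> of triples \<open>(x, p, v)\<close> near a reference
  point: \<open>X\<close> recovers \<open>x\<close>, and then \<open>M\<close> is \<open>v + A x\<close> and \<open>V\<close> is \<open>v\<close>.  The function \<open>h\<close> stands for
  \<open>g (x, p) + A x \<bullet> x / 2\<close> along the graph; \<open>prox\<close> is prox-regularity with a modulus that is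
  small against \<open>1 / lam\<close>.\<close>

locale resolvent_chart =
  fixes G :: "('x::euclidean_space \<times> 'p::euclidean_space \<times> 'x) set"
    and A :: "'x \<Rightarrow> 'x" and lam :: real
    and X :: "'x \<Rightarrow> 'p \<Rightarrow> 'x" and h :: "'x \<Rightarrow> 'p \<Rightarrow> real"
    and ybar :: 'x and pbar :: 'p and eta :: real
    and M :: "'x \<Rightarrow> 'p \<Rightarrow> 'x" and V :: "'x \<Rightarrow> 'p \<Rightarrow> 'x" and ref :: "'x \<times> 'p \<times> 'x"
  defines "M \<equiv> \<lambda>y p. (1 / lam) *\<^sub>R (y - X y p)"
    and "V \<equiv> \<lambda>y p. M y p - A (X y p)"
    and "ref \<equiv> (X ybar pbar, pbar, V ybar pbar)"
  assumes A: "bounded_linear A" and sym: "A u \<bullet> v = u \<bullet> A v"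
    and lam: "lam > 0" and eta: "eta > 0"
    and cont_X: "continuous_on (ball ybar eta \<times> ball pbar eta) (\<lambda>(y, p). X y p)"
    and in_G: "y \<in> ball ybar eta \<Longrightarrow> p \<in> ball pbar eta \<Longrightarrow> (X y p, p, V y p) \<in> G"
    and covers: "\<exists>d>0. \<forall>x p v. (x, p, v) \<in> G \<longrightarrow> dist (x, p, v) ref < d \<longrightarrow>
      x + lam *\<^sub>R (v + A x) \<in> ball ybar eta \<and> p \<in> ball pbar eta \<and> X (x + lam *\<^sub>R (v + A x)) p = x"
    and prox: "y1 \<in> ball ybar eta \<Longrightarrow> y2 \<in> ball ybar eta \<Longrightarrow> p \<in> ball pbar eta \<Longrightarrow>
      h y2 p \<ge> h y1 p + M y1 p \<bullet> (X y2 p - X y1 p) - (norm (X y2 p - X y1 p))\<^sup>2 / (4 * lam)"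
begin

lemma y_eq: "y = X y p + lam *\<^sub>R M y p"
  using lam by (simp add: M_def)

lemma hypomonotone:
  assumes "y1 \<in> ball ybar eta" "y2 \<in> ball ybar eta" "p \<in> ball pbar eta"
  shows "(M y2 p - M y1 p) \<bullet> (X y2 p - X y1 p) \<ge> - ((norm (X y2 p - X y1 p))\<^sup>2 / (2 * lam))"
  using prox[OF assms] prox[OF assms(2,1,3)]
  by (simp add: norm_minus_commute[of "X y1 p"] inner_simps field_simps)

lemma X_Lipschitz:
  assumes "y1 \<in> ball ybar eta" "y2 \<in> ball ybar eta" "p \<in> ball pbar eta"
  shows "norm (X y2 p - X y1 p) \<le> 2 * norm (y2 - y1)"
proof -
  let ?x = "X y2 p - X y1 p" and ?m = "M y2 p - M y1 p"
  have d: "y2 - y1 = ?x + lam *\<^sub>R ?m" using y_eq[of y1 p] y_eq[of y2 p] by (simp add: algebra_simps)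
  have "(norm ?x)\<^sup>2 / 2 \<le> (norm ?x)\<^sup>2 + lam * (?m \<bullet> ?x)"
    using mult_left_mono[OF hypomonotone[OF assms], of lam] lam by simp
  also have "\<dots> = (y2 - y1) \<bullet> ?x" unfolding d by (simp only: inner_add_left power2_norm_eq_inner inner_scaleR_left)
  also have "\<dots> \<le> norm (y2 - y1) * norm ?x" by (rule norm_cauchy_schwarz)
  finally have "norm ?x * norm ?x \<le> 2 * norm (y2 - y1) * norm ?x" by (simp add: power2_eq_square)
  then show ?thesis by (cases "norm ?x = 0") (auto simp: mult_le_cancel_right)
qed

lemma M_Lipschitz:
  assumes "y1 \<in> ball ybar eta" "y2 \<in> ball ybar eta" "p \<in> ball pbar eta"
  shows "norm (M y2 p - M y1 p) \<le> 3 / lam * norm (y2 - y1)"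
proof -
  have "M y2 p - M y1 p = (1 / lam) *\<^sub>R ((y2 - y1) - (X y2 p - X y1 p))" by (simp add: M_def algebra_simps)
  then have "norm (M y2 p - M y1 p) = 1 / lam * norm ((y2 - y1) - (X y2 p - X y1 p))" using lam by simp
  also have "\<dots> \<le> 1 / lam * (norm (y2 - y1) + norm (X y2 p - X y1 p))"
    using lam by (intro mult_left_mono norm_triangle_ineq4) auto
  also have "\<dots> \<le> 1 / lam * (3 * norm (y2 - y1))"
    using lam X_Lipschitz[OF assms] by (intro mult_left_mono) auto
  finally show ?thesis by simp
qed

text \<open>\<open>y \<mapsto> h y p + lam / 2 * (norm (M y p))\<^sup>2\<close> is the Moreau envelope and \<open>M\<close> its gradient.\<close>

lemma envelope_upper:
  assumes "y1 \<in> ball ybar eta" "y2 \<in> ball ybar eta" "p \<in> ball pbar eta"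
  shows "h y2 p + lam / 2 * (norm (M y2 p))\<^sup>2 \<le>
    (h y1 p + lam / 2 * (norm (M y1 p))\<^sup>2) + M y1 p \<bullet> (y2 - y1) + (norm (y2 - y1))\<^sup>2 / (2 * lam)"
proof -
  define x where "x = X y2 p - X y1 p"
  define m where "m = M y2 p - M y1 p"
  have d: "y2 - y1 = x + lam *\<^sub>R m" using y_eq[of y1 p] y_eq[of y2 p] by (simp add: x_def m_def algebra_simps)
  have M2: "M y2 p = M y1 p + m" by (simp add: m_def)
  have "X y1 p - X y2 p = - x" by (simp add: x_def)
  then have "h y2 p \<le> h y1 p + (M y1 p \<bullet> x + m \<bullet> x) + (norm x)\<^sup>2 / (4 * lam)"
    using prox[OF assms(2,1,3)] unfolding M2 by (simp add: inner_add_left)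
  moreover have "(norm x)\<^sup>2 / (4 * lam) \<le> (norm x)\<^sup>2 / (2 * lam)"
    using lam by (intro divide_left_mono) auto
  moreover have "(norm (y2 - y1))\<^sup>2 / (2 * lam) = (norm x)\<^sup>2 / (2 * lam) + m \<bullet> x + lam / 2 * (norm m)\<^sup>2"
    unfolding d power2_norm_eq_inner using lam by (simp add: inner_simps inner_commute field_simps)
  moreover have "lam / 2 * (norm (M y2 p))\<^sup>2 = lam / 2 * (norm (M y1 p))\<^sup>2 + lam * (M y1 p \<bullet> m) + lam / 2 * (norm m)\<^sup>2"
    unfolding M2 power2_norm_eq_inner by (simp add: inner_simps inner_commute field_simps)
  moreover have "M y1 p \<bullet> (y2 - y1) = M y1 p \<bullet> x + lam * (M y1 p \<bullet> m)"
    unfolding d by (simp add: inner_simps)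
  ultimately show ?thesis by linarith
qed

lemma cont_M: "continuous_on (ball ybar eta \<times> ball pbar eta) (\<lambda>(y, p). M y p)"
  using cont_X unfolding M_def split_def by (intro continuous_intros)

lemma cont_V: "continuous_on (ball ybar eta \<times> ball pbar eta) (\<lambda>(y, p). V y p)"
  using cont_M cont_X unfolding V_def split_def
  by (intro continuous_intros bounded_linear.continuous_on[OF A])

lemma near_ref:
  assumes "d > 0"
  obtains \<rho> where "\<rho> > 0" "\<rho> \<le> eta"
    "\<And>y p. y \<in> ball ybar \<rho> \<Longrightarrow> p \<in> ball pbar \<rho> \<Longrightarrow> dist (X y p, p, V y p) ref < d"
proof -
  let ?B = "ball ybar eta \<times> ball pbar eta"
  have "continuous_on ?B (\<lambda>yp. (X (fst yp) (snd yp), snd yp, V (fst yp) (snd yp)))"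
    using cont_X cont_V unfolding split_def by (intro continuous_intros)
  moreover have "(ybar, pbar) \<in> ?B" using eta by simp
  ultimately obtain s where s: "s > 0" "\<And>yp. yp \<in> ?B \<Longrightarrow> dist yp (ybar, pbar) < s \<Longrightarrow>
      dist (X (fst yp) (snd yp), snd yp, V (fst yp) (snd yp)) ref < d"
    using assms unfolding continuous_on_iff ref_def by (metis fst_conv snd_conv)
  define \<rho> where "\<rho> = min eta (s / 2)"
  have "dist (X y p, p, V y p) ref < d" if "y \<in> ball ybar \<rho>" "p \<in> ball pbar \<rho>" for y p
  proof -
    have "dist (y, p) (ybar, pbar) \<le> dist y ybar + dist p pbar"
      by (rule dist_Pair_le)
    then have "dist (y, p) (ybar, pbar) < s"
      using that by (simp add: \<rho>_def dist_commute)
    moreover have "(y, p) \<in> ?B" using that by (simp add: \<rho>_def)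
    ultimately show ?thesis using s(2)[of "(y, p)"] by simp
  qed
  then show thesis using that[of \<rho>] s(1) eta by (simp add: \<rho>_def)
qed

text \<open>A proximal subgradient \<open>(\<zeta>, q)\<close> of \<open>e \<bullet> M\<close> gives the normal \<open>(\<zeta>, q, - e)\<close> to the graph of
  \<open>(y, p) \<mapsto> M y p\<close>; the components of the normal to \<open>G\<close> follow by substituting
  \<open>y = x + lam *\<^sub>R (v + A x)\<close> and \<open>M = v + A x\<close>.\<close>

lemma subgradient_gives_normal:
  assumes near: "dist (X y p, p, V y p) ref < d"
    and covers_d: "\<And>x p v. (x, p, v) \<in> G \<Longrightarrow> dist (x, p, v) ref < d \<Longrightarrow>
      x + lam *\<^sub>R (v + A x) \<in> ball ybar eta \<and> p \<in> ball pbar eta \<and> X (x + lam *\<^sub>R (v + A x)) p = x"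
    and s: "s > 0"
    and sub: "\<And>y' p'. y' \<in> ball ybar eta \<Longrightarrow> p' \<in> ball pbar eta \<Longrightarrow> dist (y', p') (y, p) < s \<Longrightarrow>
      e \<bullet> M y' p' \<ge> e \<bullet> M y p + \<zeta> \<bullet> (y' - y) + q \<bullet> (p' - p) - k * (norm ((y', p') - (y, p)))\<^sup>2"
  shows "(\<zeta> - A (e - lam *\<^sub>R \<zeta>), q, - (e - lam *\<^sub>R \<zeta>)) \<in> regular_normal_cone G (X y p, p, V y p)"
proof -
  define w where "w = e - lam *\<^sub>R \<zeta>"
  define H where "H = (\<lambda>(x, p::'p, v). (x + lam *\<^sub>R (v + A x), p))"
  have H: "bounded_linear H"
    unfolding H_def split_def
    by (intro bounded_linear_Pair bounded_linear_add bounded_linear_fst bounded_linear_scaleR_right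
      bounded_linear_compose[OF bounded_linear_scaleR_right] bounded_linear_compose[OF A]
      bounded_linear_compose[OF bounded_linear_fst] bounded_linear_compose[OF bounded_linear_snd] bounded_linear_snd bounded_linear_ident)
  obtain b where b: "b > 0" "\<And>\<gamma>. norm (H \<gamma>) \<le> norm \<gamma> * b"
    using bounded_linear.pos_bounded[OF H] by blast
  define \<gamma>0 where "\<gamma>0 = (X y p, p, V y p)"
  define d' where "d' = min (d - dist \<gamma>0 ref) (s / b)"
  have d': "d' > 0" using near s b by (simp add: d'_def \<gamma>0_def)
  have "(\<zeta> - A w, q, - w) \<in> regular_normal_cone G \<gamma>0"
  proof (rule regular_normal_coneI_quadratic[OF d'])
    fix \<gamma> assume \<gamma>: "\<gamma> \<in> G" "dist \<gamma> \<gamma>0 < d'"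
    obtain x p' v where xv: "\<gamma> = (x, p', v)" by (cases \<gamma>)
    define y' where "y' = x + lam *\<^sub>R (v + A x)"
    have "dist \<gamma> ref < d" using \<gamma>(2) dist_triangle[of \<gamma> ref \<gamma>0] by (simp add: d'_def)
    then have cov: "y' \<in> ball ybar eta" "p' \<in> ball pbar eta" "X y' p' = x"
      using covers_d[of x p' v] \<gamma>(1) by (auto simp: xv y'_def)
    then have m: "M y' p' = v + A x" using lam by (simp add: M_def y'_def)
    have m0: "M y p = V y p + A (X y p)" by (simp add: V_def)
    have y0: "y = X y p + lam *\<^sub>R (V y p + A (X y p))" using y_eq[of y p] by (simp add: V_def)
    have HH: "H \<gamma> = (y', p')" "H \<gamma>0 = (y, p)" using y0 by (simp_all add: H_def xv y'_def \<gamma>0_def)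
    then have Hd: "(y', p') - (y, p) = H (\<gamma> - \<gamma>0)" by (simp add: linear_diff[OF bounded_linear.linear[OF H]])
    have nb: "norm ((y', p') - (y, p)) \<le> b * norm (\<gamma> - \<gamma>0)" unfolding Hd using b(2)[of "\<gamma> - \<gamma>0"] by (simp add: mult.commute)
    have "b * norm (\<gamma> - \<gamma>0) < s" using \<gamma>(2) b(1) by (simp add: d'_def dist_norm pos_less_divide_eq mult.commute)
    then have "dist (y', p') (y, p) < s" using nb unfolding dist_norm by linarith
    then have 1: "\<zeta> \<bullet> (y' - y) + q \<bullet> (p' - p) - e \<bullet> (M y' p' - M y p) \<le> k * (norm ((y', p') - (y, p)))\<^sup>2"
      using sub[OF cov(1,2)] by (simp add: inner_diff_right)
    have "(norm ((y', p') - (y, p)))\<^sup>2 \<le> (b * norm (\<gamma> - \<gamma>0))\<^sup>2" using nb by (intro power_mono) auto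
    then have "k * (norm ((y', p') - (y, p)))\<^sup>2 \<le> \<bar>k\<bar> * (b * norm (\<gamma> - \<gamma>0))\<^sup>2"
      by (meson abs_ge_self abs_ge_zero mult_mono zero_le_power2)
    then have 2: "k * (norm ((y', p') - (y, p)))\<^sup>2 \<le> (\<bar>k\<bar> * b\<^sup>2) * (norm (\<gamma> - \<gamma>0))\<^sup>2"
      by (simp add: power_mult_distrib)
    define a where "a = v + A x - (V y p + A (X y p))"
    have va: "v - V y p = a - A (x - X y p)" by (simp add: a_def linear_diff[OF bounded_linear.linear[OF A]])
    have ya: "y' - y = (x - X y p) + lam *\<^sub>R a" 
    proof -
      have "y' - y = (x + lam *\<^sub>R (v + A x)) - (X y p + lam *\<^sub>R (V y p + A (X y p)))"
        unfolding y'_def y0[symmetric] ..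
      also have "\<dots> = (x - X y p) + lam *\<^sub>R a" by (simp add: a_def algebra_simps)
      finally show ?thesis .
    qed
    have "(\<zeta> - A w, q, - w) \<bullet> (\<gamma> - \<gamma>0) = (\<zeta> - A w) \<bullet> (x - X y p) + q \<bullet> (p' - p) - w \<bullet> (v - V y p)"
      by (simp add: xv \<gamma>0_def)
    also have "\<dots> = \<zeta> \<bullet> (x - X y p) + q \<bullet> (p' - p) - w \<bullet> a"
      unfolding va by (simp only: inner_diff_left inner_diff_right[of w] sym[of w])
    also have "\<dots> = \<zeta> \<bullet> (y' - y) + q \<bullet> (p' - p) - e \<bullet> (M y' p' - M y p)"
      unfolding ya m m0 w_def by (simp add: a_def[symmetric] inner_simps)
    finally show "(\<zeta> - A w, q, - w) \<bullet> (\<gamma> - \<gamma>0) \<le> (\<bar>k\<bar> * b\<^sup>2) * (norm (\<gamma> - \<gamma>0))\<^sup>2"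
      using 1 2 by linarith
  qed
  then show ?thesis by (simp add: w_def \<gamma>0_def)
qed

text \<open>The bound on \<open>\<zeta>\<close> is the Lipschitz constant of \<open>M\<close> in \<open>y\<close>.  It is available before any Lipschitz
  property in \<open>p\<close>; the component \<open>q\<close> is therefore not bounded here.\<close>

lemma mean_value_normal:
  assumes "\<delta> > 0"
  obtains \<rho> where "\<rho> > 0" "\<rho> \<le> eta"
    "\<And>y1 p1 y2 p2 e \<epsilon>. y1 \<in> ball ybar \<rho> \<Longrightarrow> y2 \<in> ball ybar \<rho> \<Longrightarrow> p1 \<in> ball pbar \<rho> \<Longrightarrow> p2 \<in> ball pbar \<rho> \<Longrightarrow>
      \<epsilon> > 0 \<Longrightarrow> \<exists>\<zeta> q \<gamma>. \<gamma> \<in> G \<and> dist \<gamma> ref < \<delta> \<and> norm \<zeta> \<le> 3 / lam * norm e \<and>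
        (\<zeta> - A (e - lam *\<^sub>R \<zeta>), q, - (e - lam *\<^sub>R \<zeta>)) \<in> regular_normal_cone G \<gamma> \<and>
        \<zeta> \<bullet> (y2 - y1) + q \<bullet> (p2 - p1) \<ge> e \<bullet> (M y2 p2 - M y1 p1) - \<epsilon>"
proof -
  obtain d where d: "d > 0" "\<And>x p v. (x, p, v) \<in> G \<Longrightarrow> dist (x, p, v) ref < d \<Longrightarrow>
      x + lam *\<^sub>R (v + A x) \<in> ball ybar eta \<and> p \<in> ball pbar eta \<and> X (x + lam *\<^sub>R (v + A x)) p = x"
    using covers by blast
  obtain \<rho> where \<rho>: "\<rho> > 0" "\<rho> \<le> eta"
    "\<And>y p. y \<in> ball ybar \<rho> \<Longrightarrow> p \<in> ball pbar \<rho> \<Longrightarrow> dist (X y p, p, V y p) ref < min d \<delta>"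
    using near_ref[of "min d \<delta>"] d(1) assms by auto
  let ?S = "ball ybar \<rho> \<times> ball pbar \<rho>"
  have sub: "?S \<subseteq> ball ybar eta \<times> ball pbar eta" using \<rho>(2) by auto
  have "\<exists>\<zeta> q \<gamma>. \<gamma> \<in> G \<and> dist \<gamma> ref < \<delta> \<and> norm \<zeta> \<le> 3 / lam * norm e \<and>
        (\<zeta> - A (e - lam *\<^sub>R \<zeta>), q, - (e - lam *\<^sub>R \<zeta>)) \<in> regular_normal_cone G \<gamma> \<and>
        \<zeta> \<bullet> (y2 - y1) + q \<bullet> (p2 - p1) \<ge> e \<bullet> (M y2 p2 - M y1 p1) - \<epsilon>"
    if in1: "y1 \<in> ball ybar \<rho>" "y2 \<in> ball ybar \<rho>" "p1 \<in> ball pbar \<rho>" "p2 \<in> ball pbar \<rho>" and \<epsilon>: "\<epsilon> > 0"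
    for y1 p1 y2 p2 e \<epsilon>
  proof -
    define \<phi> where "\<phi> = (\<lambda>(y, p). e \<bullet> M y p)"
    have "continuous_on ?S \<phi>"
      using continuous_on_subset[OF cont_M sub] unfolding \<phi>_def split_def by (intro continuous_intros)
    moreover have "open ?S" "convex ?S" by (auto intro: open_Times convex_Times)
    moreover have "(y1, p1) \<in> ?S" "(y2, p2) \<in> ?S" using in1 by auto
    ultimately obtain c \<xi> k s where c: "c \<in> ?S" "s > 0"
      "\<And>u. dist u c < s \<Longrightarrow> \<phi> u \<ge> \<phi> c + \<xi> \<bullet> (u - c) - k * (norm (u - c))\<^sup>2"
      "\<xi> \<bullet> ((y2, p2) - (y1, p1)) \<ge> \<phi> (y2, p2) - \<phi> (y1, p1) - \<epsilon>"
      using proximal_mean_value[of ?S \<phi> "(y1, p1)" "(y2, p2)" \<epsilon>] \<epsilon> by metis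
    obtain y p where yp: "c = (y, p)" by (cases c)
    obtain \<zeta> q where \<zeta>q: "\<xi> = (\<zeta>, q)" by (cases \<xi>)
    have ypS: "y \<in> ball ybar \<rho>" "p \<in> ball pbar \<rho>" using c(1) yp by auto
    have ypE: "y \<in> ball ybar eta" "p \<in> ball pbar eta" using ypS \<rho>(2) by auto
    have subg: "e \<bullet> M y' p' \<ge> e \<bullet> M y p + \<zeta> \<bullet> (y' - y) + q \<bullet> (p' - p) - k * (norm ((y', p') - (y, p)))\<^sup>2"
      if "dist (y', p') (y, p) < s" for y' p'
      using c(3)[of "(y', p')"] that by (simp add: yp \<zeta>q \<phi>_def add.assoc)
    have near: "dist (X y p, p, V y p) ref < min d \<delta>" using \<rho>(3) ypS by blast
    have nor: "(\<zeta> - A (e - lam *\<^sub>R \<zeta>), q, - (e - lam *\<^sub>R \<zeta>)) \<in> regular_normal_cone G (X y p, p, V y p)"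
      by (rule subgradient_gives_normal[OF _ d(2) c(2)]) (use near subg in auto)
    \<comment> \<open>Test the subgradient in the direction \<open>\<zeta>\<close> with \<open>p\<close> fixed.\<close>
    have "norm \<zeta> \<le> 3 / lam * norm e"
    proof (rule ccontr)
      assume big: "\<not> ?thesis"
      define a where "a = norm \<zeta> - 3 / lam * norm e"
      have a: "a > 0" using big by (simp add: a_def)
      have z: "norm \<zeta> > 0" using big lam by (smt (verit) divide_nonneg_pos mult_nonneg_nonneg norm_ge_zero)
      define r where "r = eta - dist ybar y"
      have r: "r > 0" using ypE by (simp add: r_def)
      define t where "t = min (s / 2) (min (r / 2) (a / (2 * (\<bar>k\<bar> + 1))))"
      have t: "t > 0" "t < s" "t < r" using c(2) r a by (auto simp: t_def)
      have "t \<le> a / (2 * (\<bar>k\<bar> + 1))" by (simp add: t_def)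
      then have t4: "t * (2 * (\<bar>k\<bar> + 1)) \<le> a" by (simp add: pos_le_divide_eq add_nonneg_pos)
      define y' where "y' = y + (t / norm \<zeta>) *\<^sub>R \<zeta>"
      have ny: "norm (y' - y) = t" using z t by (simp add: y'_def)
      have "dist ybar y' < eta" using dist_triangle[of ybar y' y] ny t(3) by (simp add: r_def dist_norm norm_minus_commute)
      then have y'E: "y' \<in> ball ybar eta" by simp
      have n2: "norm ((y', p) - (y, p)) = t" using ny by simp
      then have "dist (y', p) (y, p) < s" using t(2) unfolding dist_norm by linarith
      then have "e \<bullet> M y' p \<ge> e \<bullet> M y p + \<zeta> \<bullet> (y' - y) - k * t\<^sup>2"
        using subg[of y' p] n2 by simp
      moreover have "\<zeta> \<bullet> (y' - y) = t * norm \<zeta>"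
        using z by (simp add: y'_def dot_square_norm power2_eq_square)
      moreover have "e \<bullet> (M y' p - M y p) \<le> norm e * (3 / lam * t)"
        using norm_cauchy_schwarz[of e "M y' p - M y p"] M_Lipschitz[OF ypE(1) y'E ypE(2)] ny
        by (smt (verit) mult_left_mono norm_ge_zero)
      ultimately have "t * norm \<zeta> - k * t\<^sup>2 \<le> t * (3 / lam * norm e)" by (simp add: inner_diff_right mult.commute mult.left_commute)
      then have "t * a \<le> t * (k * t)" by (simp add: a_def power2_eq_square algebra_simps)
      then have "a \<le> k * t" using t(1) by simp
      also have "k * t \<le> \<bar>k\<bar> * t" using t(1) by (simp add: mult_right_mono)
      also have "\<dots> < t * (2 * (\<bar>k\<bar> + 1))" using t(1) by (simp add: algebra_simps) (smt (verit) mult_nonneg_nonneg)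
      finally show False using t4 by simp
    qed
    moreover have "\<zeta> \<bullet> (y2 - y1) + q \<bullet> (p2 - p1) \<ge> e \<bullet> (M y2 p2 - M y1 p1) - \<epsilon>"
      using c(4) by (simp add: \<zeta>q \<phi>_def inner_diff_right)
    moreover have "(X y p, p, V y p) \<in> G" using in_G ypE by blast
    moreover have "dist (X y p, p, V y p) ref < \<delta>" using near by simp
    ultimately show ?thesis using nor by blast
  qed
  then show thesis using that[OF \<rho>(1,2)] by blast
qed

lemma A_bound:
  obtains a where "a > 0" "\<And>w. norm (A w) \<le> a * norm w"
  using bounded_linear.pos_bounded[OF A] by (metis mult.commute)

text \<open>Scalarize along the unit vector of \<open>M y2 p2 - M y1 p1\<close>: the normal that detects the difference has bounded
  \<open>z\<close> and \<open>w\<close>, hence bounded \<open>q\<close>.\<close>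

lemma joint_Lipschitz:
  assumes crit: "\<forall>q. (0, q, 0) \<in> limiting_normal_cone G ref \<longrightarrow> q = 0"
  obtains \<rho> L where "\<rho> > 0" "\<rho> \<le> eta" "L > 0"
    "\<And>y1 p1 y2 p2. y1 \<in> ball ybar \<rho> \<Longrightarrow> y2 \<in> ball ybar \<rho> \<Longrightarrow> p1 \<in> ball pbar \<rho> \<Longrightarrow> p2 \<in> ball pbar \<rho> \<Longrightarrow>
       norm (M y2 p2 - M y1 p1) \<le> L * (norm (y2 - y1) + norm (p2 - p1))"
proof -
  obtain C d where C: "C > 0" "d > 0"
    "\<And>\<gamma> z q w. \<gamma> \<in> G \<Longrightarrow> dist \<gamma> ref < d \<Longrightarrow> (z, q, w) \<in> regular_normal_cone G \<gamma> \<Longrightarrow>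
       norm q \<le> C * (norm z + norm w)"
    using middle_normal_bound[OF crit] by metis
  obtain \<rho> where \<rho>: "\<rho> > 0" "\<rho> \<le> eta"
    "\<And>y1 p1 y2 p2 e \<epsilon>. y1 \<in> ball ybar \<rho> \<Longrightarrow> y2 \<in> ball ybar \<rho> \<Longrightarrow> p1 \<in> ball pbar \<rho> \<Longrightarrow> p2 \<in> ball pbar \<rho> \<Longrightarrow>
      \<epsilon> > 0 \<Longrightarrow> \<exists>\<zeta> q \<gamma>. \<gamma> \<in> G \<and> dist \<gamma> ref < d \<and> norm \<zeta> \<le> 3 / lam * norm e \<and>
        (\<zeta> - A (e - lam *\<^sub>R \<zeta>), q, - (e - lam *\<^sub>R \<zeta>)) \<in> regular_normal_cone G \<gamma> \<and>
        \<zeta> \<bullet> (y2 - y1) + q \<bullet> (p2 - p1) \<ge> e \<bullet> (M y2 p2 - M y1 p1) - \<epsilon>"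
    using mean_value_normal[OF C(2)] by metis
  obtain a where a: "a > 0" "\<And>w. norm (A w) \<le> a * norm w" by (rule A_bound) (rule that)
  define L where "L = 3 / lam + C * (3 / lam + 4 * a + 4)"
  have L: "L > 0" using C(1) a(1) lam by (simp add: L_def add_pos_pos)
  have "norm (M y2 p2 - M y1 p1) \<le> L * (norm (y2 - y1) + norm (p2 - p1))"
    if in1: "y1 \<in> ball ybar \<rho>" "y2 \<in> ball ybar \<rho>" "p1 \<in> ball pbar \<rho>" "p2 \<in> ball pbar \<rho>" for y1 y2 p1 p2
  proof (cases "M y2 p2 - M y1 p1 = 0")
    case True
    then show ?thesis using L by simp
  next
    case False
    define m where "m = M y2 p2 - M y1 p1"
    have m: "norm m > 0" using False by (simp add: m_def)
    define e where "e = (1 / norm m) *\<^sub>R m"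
    have e: "norm e = 1" "e \<bullet> m = norm m" using m by (simp_all add: e_def dot_square_norm power2_eq_square)
    show ?thesis unfolding m_def[symmetric]
    proof (rule field_le_epsilon)
      fix \<epsilon> :: real assume "\<epsilon> > 0"
      then obtain \<zeta> q \<gamma> where n: "\<gamma> \<in> G" "dist \<gamma> ref < d" "norm \<zeta> \<le> 3 / lam * norm e"
        "(\<zeta> - A (e - lam *\<^sub>R \<zeta>), q, - (e - lam *\<^sub>R \<zeta>)) \<in> regular_normal_cone G \<gamma>"
        "\<zeta> \<bullet> (y2 - y1) + q \<bullet> (p2 - p1) \<ge> e \<bullet> m - \<epsilon>"
        using \<rho>(3)[OF in1, of \<epsilon> e] unfolding m_def by blast
      have z: "norm \<zeta> \<le> 3 / lam" using n(3) e by simp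
      have "lam * norm \<zeta> \<le> lam * (3 / lam)" using z lam by (intro mult_left_mono) auto
      then have w: "norm (e - lam *\<^sub>R \<zeta>) \<le> 4"
        using norm_triangle_ineq4[of e "lam *\<^sub>R \<zeta>"] e lam by simp
      have "a * norm (e - lam *\<^sub>R \<zeta>) \<le> a * 4" using w a by (intro mult_left_mono) auto
      then have "norm (A (e - lam *\<^sub>R \<zeta>)) \<le> 4 * a" using a(2)[of "e - lam *\<^sub>R \<zeta>"] by linarith
      then have "norm (\<zeta> - A (e - lam *\<^sub>R \<zeta>)) \<le> 3 / lam + 4 * a"
        using norm_triangle_ineq4[of \<zeta> "A (e - lam *\<^sub>R \<zeta>)"] z by linarith
      then have "norm (\<zeta> - A (e - lam *\<^sub>R \<zeta>)) + norm (- (e - lam *\<^sub>R \<zeta>)) \<le> 3 / lam + 4 * a + 4"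
        using w unfolding norm_minus_cancel by linarith
      then have "C * (norm (\<zeta> - A (e - lam *\<^sub>R \<zeta>)) + norm (- (e - lam *\<^sub>R \<zeta>))) \<le> C * (3 / lam + 4 * a + 4)"
        using C(1) by (intro mult_left_mono) auto
      then have q: "norm q \<le> C * (3 / lam + 4 * a + 4)" using C(3)[OF n(1,2,4)] by linarith
      have "norm m - \<epsilon> \<le> norm \<zeta> * norm (y2 - y1) + norm q * norm (p2 - p1)"
        using n(5) e norm_cauchy_schwarz[of \<zeta> "y2 - y1"] norm_cauchy_schwarz[of q "p2 - p1"] by linarith
      also have "\<dots> \<le> L * norm (y2 - y1) + L * norm (p2 - p1)"
        using z q C(1) a(1) lam
        by (intro add_mono mult_right_mono) (auto simp: L_def add_pos_pos add_increasing2 add_increasing)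
      finally show "norm m \<le> L * (norm (y2 - y1) + norm (p2 - p1)) + \<epsilon>" by (simp add: algebra_simps)
    qed
  qed
  then show thesis using that[OF \<rho>(1,2) L] by blast
qed

text \<open>If the inequality failed for \<open>y1\<close> and \<open>y2\<close>, the normal obtained by scalarizing along \<open>y1 - y2\<close>
  would have \<open>\<zeta> \<bullet> (y2 - y1)\<close> nearly nonnegative.  This keeps \<open>w\<close> away from zero, so that the
  coercivity estimate applies to it.\<close>

lemma gradient_strongly_monotone:
  assumes crit: "\<forall>q. (0, q, 0) \<in> limiting_normal_cone G ref \<longrightarrow> q = 0"
    and pd: "\<forall>z q w. w \<noteq> 0 \<longrightarrow> (z, q, - w) \<in> limiting_normal_cone G ref \<longrightarrow> A w \<bullet> w + z \<bullet> w > 0"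
  obtains \<rho> c where "\<rho> > 0" "\<rho> \<le> eta" "c > 0" "2 * (c * lam) \<le> 1"
    "\<And>y1 y2 p. y1 \<in> ball ybar \<rho> \<Longrightarrow> y2 \<in> ball ybar \<rho> \<Longrightarrow> p \<in> ball pbar \<rho> \<Longrightarrow>
       (M y2 p - M y1 p) \<bullet> (y2 - y1) \<ge> c * (norm (y2 - y1))\<^sup>2"
proof -
  obtain a where a: "a > 0" "\<And>w. norm (A w) \<le> a * norm w" by (rule A_bound) (rule that)
  define K where "K = 6 / lam + a"
  obtain \<kappa> d where \<kappa>: "\<kappa> > 0" "d > 0"
    "\<And>\<gamma> z q w. \<gamma> \<in> G \<Longrightarrow> dist \<gamma> ref < d \<Longrightarrow> (z, q, - w) \<in> regular_normal_cone G \<gamma> \<Longrightarrow>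
       norm z \<le> K * norm w \<Longrightarrow> A w \<bullet> w + z \<bullet> w \<ge> \<kappa> * (norm w)\<^sup>2"
    using normal_coercivity[OF crit pd A, where K = K] by metis
  obtain \<rho> where \<rho>: "\<rho> > 0" "\<rho> \<le> eta"
    "\<And>y1 p1 y2 p2 e \<epsilon>. y1 \<in> ball ybar \<rho> \<Longrightarrow> y2 \<in> ball ybar \<rho> \<Longrightarrow> p1 \<in> ball pbar \<rho> \<Longrightarrow> p2 \<in> ball pbar \<rho> \<Longrightarrow>
      \<epsilon> > 0 \<Longrightarrow> \<exists>\<zeta> q \<gamma>. \<gamma> \<in> G \<and> dist \<gamma> ref < d \<and> norm \<zeta> \<le> 3 / lam * norm e \<and>
        (\<zeta> - A (e - lam *\<^sub>R \<zeta>), q, - (e - lam *\<^sub>R \<zeta>)) \<in> regular_normal_cone G \<gamma> \<and>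
        \<zeta> \<bullet> (y2 - y1) + q \<bullet> (p2 - p1) \<ge> e \<bullet> (M y2 p2 - M y1 p1) - \<epsilon>"
    using mean_value_normal[OF \<kappa>(2)] by metis
  \<comment> \<open>The first bound contradicts coercivity, the second one gives \<open>norm (y2 - y1) \<le> 2 * norm w\<close>.\<close>
  define c where "c = min (\<kappa> / 8) (1 / (2 * lam))"
  have c: "c > 0" "c \<le> \<kappa> / 8" using \<kappa>(1) lam by (auto simp: c_def)
  have "c \<le> 1 / (2 * lam)" by (simp add: c_def)
  then have cl: "2 * (c * lam) \<le> 1" using lam by (simp add: field_simps)
  have "(M y2 p - M y1 p) \<bullet> (y2 - y1) \<ge> c * (norm (y2 - y1))\<^sup>2"
    if in1: "y1 \<in> ball ybar \<rho>" "y2 \<in> ball ybar \<rho>" "p \<in> ball pbar \<rho>" for y1 y2 p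
  proof (rule ccontr)
    assume neg: "\<not> ?thesis"
    define D where "D = y2 - y1"
    define \<epsilon> where "\<epsilon> = c * (norm D)\<^sup>2 - (M y2 p - M y1 p) \<bullet> D"
    have \<epsilon>: "\<epsilon> > 0" using neg by (simp add: \<epsilon>_def D_def)
    then have D: "norm D > 0" by (auto simp: \<epsilon>_def)
    define e where "e = - D"
    obtain \<zeta> q \<gamma> where n: "\<gamma> \<in> G" "dist \<gamma> ref < d" "norm \<zeta> \<le> 3 / lam * norm e"
        "(\<zeta> - A (e - lam *\<^sub>R \<zeta>), q, - (e - lam *\<^sub>R \<zeta>)) \<in> regular_normal_cone G \<gamma>"
        "\<zeta> \<bullet> (y2 - y1) + q \<bullet> (p - p) \<ge> e \<bullet> (M y2 p - M y1 p) - \<epsilon>"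
      using \<rho>(3)[OF in1(1,2,3,3) \<epsilon>, of e] by blast
    define w where "w = e - lam *\<^sub>R \<zeta>"
    have zD: "- (\<zeta> \<bullet> D) \<le> c * (norm D)\<^sup>2"
      using n(5) by (simp add: e_def \<epsilon>_def D_def[symmetric] inner_commute)
    have "lam * - (\<zeta> \<bullet> D) \<le> lam * (c * (norm D)\<^sup>2)" using zD lam by (intro mult_left_mono) auto
    also have "\<dots> = (c * lam) * (norm D)\<^sup>2" by simp
    also have "\<dots> \<le> 1 / 2 * (norm D)\<^sup>2" using cl by (intro mult_right_mono) auto
    finally have "- (w \<bullet> D) \<ge> 1 / 2 * (norm D)\<^sup>2"
      by (simp add: w_def e_def inner_diff_left dot_square_norm)
    moreover have "- (w \<bullet> D) \<le> norm w * norm D"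
      using norm_cauchy_schwarz[of "- w" D] by simp
    ultimately have "norm D * norm D \<le> (2 * norm w) * norm D" by (simp add: power2_eq_square)
    then have wD: "norm D \<le> 2 * norm w" using D by simp
    have "3 / lam * norm D \<le> 3 / lam * (2 * norm w)" using wD lam by (intro mult_left_mono) auto
    then have "norm \<zeta> \<le> 6 / lam * norm w" using n(3) by (simp add: e_def)
    then have "norm (\<zeta> - A w) \<le> K * norm w"
      using norm_triangle_ineq4[of \<zeta> "A w"] a(2)[of w] by (simp add: K_def algebra_simps)
    then have "\<kappa> * (norm w)\<^sup>2 \<le> A w \<bullet> w + (\<zeta> - A w) \<bullet> w"
      using \<kappa>(3)[OF n(1,2), of "\<zeta> - A w" q w] n(4) by (simp add: w_def)
    also have "\<dots> = \<zeta> \<bullet> w" by (simp add: inner_diff_left)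
    also have "\<dots> = - (\<zeta> \<bullet> D) - lam * (norm \<zeta>)\<^sup>2"
      by (simp add: w_def e_def inner_diff_right dot_square_norm)
    also have "\<dots> \<le> c * (norm D)\<^sup>2" using zD lam by (smt (verit) mult_nonneg_nonneg zero_le_power2)
    also have "\<dots> \<le> c * (2 * norm w)\<^sup>2" using wD c by (intro mult_left_mono power_mono) auto
    also have "\<dots> \<le> (\<kappa> / 8) * (2 * norm w)\<^sup>2" using c by (intro mult_right_mono) auto
    also have "\<dots> = \<kappa> / 2 * (norm w)\<^sup>2" by (simp add: power_mult_distrib)
    finally have "\<kappa> / 2 * (norm w)\<^sup>2 \<le> 0" by simp
    moreover have "norm w > 0" using wD D by linarith
    ultimately show False using \<kappa>(1) by (simp add: mult_le_0_iff)
  qed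
  then show thesis using that[OF \<rho>(1,2) c(1) cl] by blast
qed

lemma resolvent_strongly_monotone:
  assumes crit: "\<forall>q. (0, q, 0) \<in> limiting_normal_cone G ref \<longrightarrow> q = 0"
    and pd: "\<forall>z q w. w \<noteq> 0 \<longrightarrow> (z, q, - w) \<in> limiting_normal_cone G ref \<longrightarrow> A w \<bullet> w + z \<bullet> w > 0"
  obtains \<rho> c where "\<rho> > 0" "\<rho> \<le> eta" "c > 0"
    "\<And>y1 y2 p. y1 \<in> ball ybar \<rho> \<Longrightarrow> y2 \<in> ball ybar \<rho> \<Longrightarrow> p \<in> ball pbar \<rho> \<Longrightarrow>
       (M y2 p - M y1 p) \<bullet> (X y2 p - X y1 p) \<ge> c * (norm (X y2 p - X y1 p))\<^sup>2"
proof -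
  obtain R c where R: "R > 0" "R \<le> eta" "c > 0" "2 * (c * lam) \<le> 1"
    "\<And>y1 y2 p. y1 \<in> ball ybar R \<Longrightarrow> y2 \<in> ball ybar R \<Longrightarrow> p \<in> ball pbar R \<Longrightarrow>
       (M y2 p - M y1 p) \<bullet> (y2 - y1) \<ge> c * (norm (y2 - y1))\<^sup>2"
    by (rule gradient_strongly_monotone[OF crit pd]) (rule that)
  define F where "F = 1 + 4 * lam * (3 / lam + c)"
  have F: "F \<ge> 1" using lam R(3) by (simp add: F_def)
  define \<rho> where "\<rho> = R / F"
  have \<rho>: "\<rho> > 0" "\<rho> * F = R" using F R(1) by (auto simp: \<rho>_def)
  have "\<rho> \<le> R" unfolding \<rho>_def using F R(1) by (simp add: divide_le_eq)
  have "(M y2 p - M y1 p) \<bullet> (X y2 p - X y1 p) \<ge> c * (norm (X y2 p - X y1 p))\<^sup>2"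
    if in1: "y1 \<in> ball ybar \<rho>" "y2 \<in> ball ybar \<rho>" "p \<in> ball pbar \<rho>" for y1 y2 p
  proof -
    have Xe: "X y p = y - lam *\<^sub>R M y p" for y using y_eq[of y p] by (simp add: algebra_simps)
    have p: "p \<in> ball pbar R" "p \<in> ball pbar eta" using in1(3) \<open>\<rho> \<le> R\<close> R(2) by auto
    have e: "y \<in> ball ybar eta" if "y \<in> ball ybar R" for y using that R(2) by auto
    have up: "h v p + lam / 2 * (norm (M v p))\<^sup>2 \<le>
          h u p + lam / 2 * (norm (M u p))\<^sup>2 + M u p \<bullet> (v - u) + (norm (v - u))\<^sup>2 / (2 * lam)"
      if "u \<in> ball ybar R" "v \<in> ball ybar R" for u v
      by (rule envelope_upper[OF e[OF that(1)] e[OF that(2)] p(2)])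
    have mono: "c * (norm (v - u))\<^sup>2 \<le> (M v p - M u p) \<bullet> (v - u)"
      if "u \<in> ball ybar R" "v \<in> ball ybar R" for u v
      by (rule R(5)[OF that p(1)])
    have lip: "norm (M v p - M u p) \<le> 3 / lam * norm (v - u)"
      if "u \<in> ball ybar R" "v \<in> ball ybar R" for u v
      by (rule M_Lipschitz[OF e[OF that(1)] e[OF that(2)] p(2)])
    have "0 \<le> 3 / lam" using lam by simp
    moreover have "\<rho> * (1 + 4 * lam * (3 / lam + c)) \<le> R" using \<rho>(2) by (simp add: F_def)
    ultimately show ?thesis unfolding Xe
      using local_Baillon_Haddad[OF lam R(3,4) _ up mono lip _ in1(1,2)] by blast
  qed
  then show thesis using that[of \<rho> c] \<rho>(1) \<open>\<rho> \<le> R\<close> R(2,3) by simp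
qed

end

section \<open>Subgradients and minimizers\<close>

lemma proximal_imp_regular_subdiff:
  fixes \<phi> :: "'a::euclidean_space \<Rightarrow> ereal"
  assumes fin: "\<phi> x = ereal \<alpha>" and d: "d > 0"
    and prox: "\<And>u. dist u x < d \<Longrightarrow> \<phi> u \<ge> ereal (\<alpha> + v \<bullet> (u - x) - k * (norm (u - x))\<^sup>2)"
  shows "v \<in> regular_subdiff \<phi> x"
proof -
  have "0 \<le> Liminf (at x) (\<lambda>u. (\<phi> u - \<phi> x - ereal (v \<bullet> (u - x))) / ereal (norm (u - x)))"
  proof (subst le_Liminf_iff, intro allI impI)
    fix y :: ereal assume "y < 0"
    then obtain e where e: "e > 0" "y < ereal (- e)"
      using ereal_dense2[of y 0] by (metis ereal_less(1) ereal_less_eq(3) less_ereal.simps(1) minus_minus neg_less_0_iff_less zero_ereal_def)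
    define d' where "d' = min d (e / (\<bar>k\<bar> + 1))"
    have "d' > 0" using d e by (simp add: d'_def add_nonneg_pos)
    moreover have "y < (\<phi> u - \<phi> x - ereal (v \<bullet> (u - x))) / ereal (norm (u - x))"
      if u: "u \<noteq> x" "dist u x < d'" for u
    proof -
      let ?n = "norm (u - x)"
      have n: "?n > 0" "dist u x < d" "?n < e / (\<bar>k\<bar> + 1)" using u by (auto simp: d'_def dist_norm)
      have "\<phi> u \<ge> ereal (\<alpha> + v \<bullet> (u - x) - k * ?n\<^sup>2)" using prox n(2) .
      have "?n * (\<bar>k\<bar> + 1) \<le> e" using n(3) by (simp add: pos_less_divide_eq add_nonneg_pos)
      then have "k * ?n \<le> e" using n(1) by (smt (verit) abs_ge_self mult.commute mult_right_mono)
      then have kn: "- e \<le> - k * ?n" by simp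
      show ?thesis
      proof (cases "\<phi> u")
        case (real b)
        then have "b - \<alpha> - v \<bullet> (u - x) \<ge> (- k * ?n) * ?n"
          using \<open>\<phi> u \<ge> _\<close> by (simp add: power2_eq_square)
        also have "(- k * ?n) * ?n \<ge> (- e) * ?n" using kn n(1) by (intro mult_right_mono) auto
        finally have "- e \<le> (b - \<alpha> - v \<bullet> (u - x)) / ?n" using n(1) by (simp add: pos_le_divide_eq)
        then have "ereal (- e) \<le> (\<phi> u - \<phi> x - ereal (v \<bullet> (u - x))) / ereal ?n"
          using n(1) by (simp add: real fin)
        with e(2) show ?thesis by (rule order_less_le_trans)
      next
        case PInf
        then have "(\<phi> u - \<phi> x - ereal (v \<bullet> (u - x))) / ereal ?n = \<infinity>" using n(1) by (simp add: fin)
        then show ?thesis using \<open>y < 0\<close> by auto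
      next
        case MInf
        then show ?thesis using \<open>\<phi> u \<ge> _\<close> by simp
      qed
    qed
    ultimately show "eventually (\<lambda>u. y < (\<phi> u - \<phi> x - ereal (v \<bullet> (u - x))) / ereal (norm (u - x))) (at x)"
      unfolding eventually_at by blast
  qed
  then show ?thesis by (simp add: regular_subdiff_def fin)
qed

lemma regular_subset_limiting_subdiff: "regular_subdiff \<phi> x \<subseteq> limiting_subdiff \<phi> x"
proof
  fix v assume v: "v \<in> regular_subdiff \<phi> x"
  then have "\<bar>\<phi> x\<bar> \<noteq> \<infinity>" by (simp add: regular_subdiff_def)
  moreover have "\<exists>xs vs. (\<forall>k::nat. vs k \<in> regular_subdiff \<phi> (xs k)) \<and>
      xs \<longlonglongrightarrow> x \<and> (\<lambda>k. \<phi> (xs k)) \<longlonglongrightarrow> \<phi> x \<and> vs \<longlonglongrightarrow> v"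
    by (rule exI[of _ "\<lambda>_. x"], rule exI[of _ "\<lambda>_. v"]) (use v in simp)
  ultimately show "v \<in> limiting_subdiff \<phi> x" by (simp add: limiting_subdiff_def)
qed

lemma lower_semicontinuous_eventually:
  assumes "lower_semicontinuous \<phi>" "c < \<phi> z"
  shows "eventually (\<lambda>u. c < \<phi> u) (nhds z)"
proof -
  have "\<phi> z \<le> Liminf (at z) \<phi>" using assms(1) by (simp add: lower_semicontinuous_def)
  then have "eventually (\<lambda>u. c < \<phi> u) (at z)" using assms(2) by (simp add: le_Liminf_iff)
  then show ?thesis
    unfolding eventually_at_filter by (rule eventually_mono) (use assms(2) in auto)
qed

lemma lower_semicontinuous_add:
  fixes \<phi> :: "'a::t2_space \<Rightarrow> ereal" and \<psi> :: "'a \<Rightarrow> real"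
  assumes lsc: "lower_semicontinuous \<phi>" and cont: "isCont \<psi> z" and c: "ereal c < \<phi> z + ereal (\<psi> z)"
  shows "eventually (\<lambda>u. ereal c < \<phi> u + ereal (\<psi> u)) (nhds z)"
proof -
  have "ereal (c - \<psi> z) < \<phi> z" using c by (cases "\<phi> z") auto
  then obtain m where m: "c - \<psi> z < m" "ereal m < \<phi> z" using ereal_dense2 by force
  have "eventually (\<lambda>u. ereal m < \<phi> u) (nhds z)"
    using lower_semicontinuous_eventually[OF lsc m(2)] .
  moreover have "(\<psi> \<longlongrightarrow> \<psi> z) (nhds z)"
    using cont tendsto_at_iff_tendsto_nhds by (auto simp: isCont_def)
  then have "eventually (\<lambda>u. c - m < \<psi> u) (nhds z)"
    using m(1) by (intro order_tendstoD(1)) auto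
  ultimately show ?thesis
  proof eventually_elim
    case (elim u)
    then show ?case by (cases "\<phi> u") auto
  qed
qed

lemma lower_semicontinuous_attains_inf:
  fixes \<phi> :: "'a::topological_space \<Rightarrow> ereal"
  assumes K: "compact K" "K \<noteq> {}"
    and lsc: "\<And>x c. x \<in> K \<Longrightarrow> ereal c < \<phi> x \<Longrightarrow> eventually (\<lambda>u. ereal c < \<phi> u) (nhds x)"
  shows "\<exists>x\<in>K. \<forall>u\<in>K. \<phi> x \<le> \<phi> u"
proof (rule ccontr)
  assume "\<not> ?thesis"
  then have no: "\<forall>x\<in>K. \<exists>u\<in>K. \<phi> u < \<phi> x" by (meson not_le)
  have ex: "\<exists>u\<in>K. \<exists>T. open T \<and> x \<in> T \<and> (\<forall>z\<in>T. \<phi> u < \<phi> z)" if x: "x \<in> K" for x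
  proof -
    obtain u where u: "u \<in> K" "\<phi> u < \<phi> x" using no x by blast
    then obtain c where c: "\<phi> u < ereal c" "ereal c < \<phi> x" using ereal_dense2 by blast
    have "eventually (\<lambda>z. ereal c < \<phi> z) (nhds x)" using lsc[OF x c(2)] .
    then obtain T where "open T" "x \<in> T" "\<forall>z\<in>T. ereal c < \<phi> z" unfolding eventually_nhds by blast
    then show ?thesis using u(1) c(1) by (meson less_trans)
  qed
  then obtain u T where uT: "\<And>x. x \<in> K \<Longrightarrow> u x \<in> K \<and> open (T x) \<and> x \<in> T x \<and> (\<forall>z\<in>T x. \<phi> (u x) < \<phi> z)"
    by metis
  obtain D where D: "D \<subseteq> K" "finite D" "K \<subseteq> (\<Union>x\<in>D. T x)"
    using compactE_image[OF K(1), of K T] uT by (metis UN_I subsetI)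
  have "D \<noteq> {}" using D(3) K(2) by auto
  then obtain x where x: "x \<in> D" "\<And>z. z \<in> D \<Longrightarrow> \<phi> (u x) \<le> \<phi> (u z)"
    using ex_is_arg_min_if_finite[OF D(2), of "\<lambda>x. \<phi> (u x)"] unfolding is_arg_min_linorder by blast
  have "u x \<in> K" using x(1) D(1) uT by blast
  then obtain z where z: "z \<in> D" "u x \<in> T z" using D(3) by blast
  then have "\<phi> (u z) < \<phi> (u x)" using uT D(1) by blast
  then show False using x(2)[OF z(1)] by simp
qed

section \<open>The resolvent chart of a prox-regular subdifferential\<close>

text \<open>The consequences of the assumptions on \<open>g\<close> that the construction of the chart uses.  On the box of
  radius \<open>\<delta>\<close> the values of \<open>g\<close> along the graph are close to the reference value, so prox-regularity holds
  without a bound on \<open>g\<close>.  Of the Lipschitz-like epigraphs there remains that a graph point has nearby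
  competitors of almost the same value at nearby parameters.\<close>

locale parametric_prox =
  fixes g :: "'x::euclidean_space \<times> 'p::euclidean_space \<Rightarrow> ereal"
    and A :: "'x \<Rightarrow> 'x" and a r lam l \<delta> :: real
    and xbar vhat :: 'x and pbar :: 'p
  assumes not_minf: "g z \<noteq> - \<infinity>" and lsc: "lower_semicontinuous g"
    and A: "bounded_linear A" and sym: "A u \<bullet> v = u \<bullet> A v" and A_norm: "norm (A w) \<le> a * norm w"
    and a: "a > 0" and r: "r > 0" and l: "l > 0" and \<delta>: "\<delta> > 0" and lam_eq: "lam = 1 / (2 * (r + a))"
    and ref_subgradient: "vhat \<in> partial_subdiff g xbar pbar"
    and prox_regular: "v \<in> partial_subdiff g x p \<Longrightarrow> x \<in> ball xbar \<delta> \<Longrightarrow> p \<in> ball pbar \<delta> \<Longrightarrow> v \<in> ball vhat \<delta> \<Longrightarrow>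
      u \<in> cball xbar \<delta> \<Longrightarrow> g (u, p) \<ge> g (x, p) + ereal (v \<bullet> (u - x) - r / 2 * (norm (u - x))\<^sup>2)"
    and inner_Lipschitz: "v \<in> partial_subdiff g x p \<Longrightarrow> x \<in> ball xbar \<delta> \<Longrightarrow> p \<in> ball pbar \<delta> \<Longrightarrow> v \<in> ball vhat \<delta> \<Longrightarrow>
      p' \<in> ball pbar \<delta> \<Longrightarrow> \<exists>x'. dist x' x \<le> l * dist p p' \<and> g (x', p') \<le> g (x, p) + ereal (l * dist p p')"
begin

lemma lam_pos: "lam > 0" using r a by (simp add: lam_eq)

lemma lam_eq': "(r + a) / 2 = 1 / (4 * lam)" using r a by (simp add: lam_eq)

definition near :: "'x \<Rightarrow> 'p \<Rightarrow> 'x \<Rightarrow> bool" where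
  "near x p v \<longleftrightarrow> v \<in> partial_subdiff g x p \<and> x \<in> ball xbar \<delta> \<and> p \<in> ball pbar \<delta> \<and> v \<in> ball vhat \<delta>"

definition quad :: "'x \<Rightarrow> 'x \<Rightarrow> real" where
  "quad y x = A x \<bullet> x / 2 + (norm (x - y))\<^sup>2 / (2 * lam)"

definition minimizer :: "'x \<Rightarrow> 'p \<Rightarrow> 'x \<Rightarrow> bool" where
  "minimizer y p x \<longleftrightarrow> x \<in> cball xbar \<delta> \<and>
     (\<forall>u\<in>cball xbar \<delta>. g (x, p) + ereal (quad y x) \<le> g (u, p) + ereal (quad y u))"

lemma near_finite: "near x p v \<Longrightarrow> \<exists>\<alpha>. g (x, p) = ereal \<alpha>"
  unfolding near_def partial_subdiff_def limiting_subdiff_def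
  by (cases "g (x, p)") auto

lemma A_expand: "A u \<bullet> u / 2 \<ge> A x \<bullet> x / 2 + A x \<bullet> (u - x) - a / 2 * (norm (u - x))\<^sup>2"
proof -
  define d where "d = u - x"
  have u: "u = x + d" by (simp add: d_def)
  have "A u \<bullet> u = A x \<bullet> x + 2 * (A x \<bullet> d) + A d \<bullet> d"
    unfolding u using sym[of d x]
    by (simp add: linear_add[OF bounded_linear.linear[OF A]] inner_add_left inner_add_right inner_commute)
  moreover have "\<bar>A d \<bullet> d\<bar> \<le> a * (norm d)\<^sup>2"
    using Cauchy_Schwarz_ineq2[of "A d" d] mult_right_mono[OF A_norm[of d], of "norm d"]
    by (simp add: power2_eq_square)
  ultimately show ?thesis unfolding d_def[symmetric] by (simp add: abs_le_iff)
qed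

lemma quad_expand: "quad y u \<ge> quad y x + (A x + (1 / lam) *\<^sub>R (x - y)) \<bullet> (u - x)
    + (1 / (2 * lam) - a / 2) * (norm (u - x))\<^sup>2"
proof -
  have "(norm (u - y))\<^sup>2 = (norm (x - y))\<^sup>2 + 2 * ((x - y) \<bullet> (u - x)) + (norm (u - x))\<^sup>2"
    by (simp add: power2_norm_eq_inner inner_simps inner_commute)
  then have "(norm (u - y))\<^sup>2 / (2 * lam) = (norm (x - y))\<^sup>2 / (2 * lam) + ((x - y) \<bullet> (u - x)) / lam
      + 1 / (2 * lam) * (norm (u - x))\<^sup>2"
    using lam_pos by (simp add: field_simps)
  moreover have "((1 / lam) *\<^sub>R (x - y)) \<bullet> (u - x) = ((x - y) \<bullet> (u - x)) / lam" by simp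
  ultimately show ?thesis using A_expand[of x u] unfolding quad_def by (simp add: inner_add_left algebra_simps)
qed

lemma quad_expand_upper: "quad y u \<le> quad y x + (A x + (1 / lam) *\<^sub>R (x - y)) \<bullet> (u - x)
    + (1 / (2 * lam) + 3 * a / 2) * (norm (u - x))\<^sup>2"
proof -
  have "quad y x \<ge> quad y u + (A u + (1 / lam) *\<^sub>R (u - y)) \<bullet> (x - u) + (1 / (2 * lam) - a / 2) * (norm (u - x))\<^sup>2"
    using quad_expand[of y u x] by (simp add: norm_minus_commute)
  moreover have "(A u + (1 / lam) *\<^sub>R (u - y)) \<bullet> (x - u)
      = - ((A x + (1 / lam) *\<^sub>R (x - y)) \<bullet> (u - x)) - A (u - x) \<bullet> (u - x) - 1 / lam * (norm (u - x))\<^sup>2"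
    by (simp add: linear_diff[OF bounded_linear.linear[OF A]] power2_norm_eq_inner inner_simps algebra_simps)
  moreover have "A (u - x) \<bullet> (u - x) \<le> a * (norm (u - x))\<^sup>2"
    using norm_cauchy_schwarz[of "A (u - x)" "u - x"] mult_right_mono[OF A_norm[of "u - x"], of "norm (u - x)"]
    by (simp add: power2_eq_square)
  moreover have "(1 / (2 * lam) + 3 * a / 2) * (norm (u - x))\<^sup>2
      = 1 / lam * (norm (u - x))\<^sup>2 + a * (norm (u - x))\<^sup>2 - (1 / (2 * lam) - a / 2) * (norm (u - x))\<^sup>2"
    by (simp add: field_simps)
  ultimately show ?thesis by linarith
qed

text \<open>\<open>lam\<close> is chosen so that the quadratic term dominates both the prox-regularity defect
  \<open>r\<close> and the concavity of the form of \<open>A\<close>.\<close>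

lemma growth:
  assumes n: "near x p v" and u: "u \<in> cball xbar \<delta>"
  shows "g (u, p) + ereal (quad (x + lam *\<^sub>R (v + A x)) u)
    \<ge> g (x, p) + ereal (quad (x + lam *\<^sub>R (v + A x)) x + (norm (u - x))\<^sup>2 / (4 * lam))"
proof -
  let ?y = "x + lam *\<^sub>R (v + A x)"
  obtain \<alpha> where \<alpha>: "g (x, p) = ereal \<alpha>" using near_finite[OF n] by blast
  have "g (u, p) \<ge> ereal (\<alpha> + (v \<bullet> (u - x) - r / 2 * (norm (u - x))\<^sup>2))"
    using prox_regular[of v x p u] n u by (simp add: near_def \<alpha>)
  moreover have "A x + (1 / lam) *\<^sub>R (x - ?y) = - v" using lam_pos by (simp add: algebra_simps)
  then have "quad ?y u \<ge> quad ?y x - v \<bullet> (u - x) + (1 / (2 * lam) - a / 2) * (norm (u - x))\<^sup>2"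
    using quad_expand[where y = ?y and x = x and u = u] by simp
  moreover have "(1 / (2 * lam) - a / 2) * (norm (u - x))\<^sup>2 - r / 2 * (norm (u - x))\<^sup>2 = (norm (u - x))\<^sup>2 / (4 * lam)"
  proof -
    have "1 / (2 * lam) - a / 2 - r / 2 = 1 / (4 * lam)" using r a by (simp add: lam_eq field_simps)
    then show ?thesis by (metis left_diff_distrib mult.left_neutral times_divide_eq_left)
  qed
  ultimately show ?thesis by (cases "g (u, p)") (auto simp: \<alpha>)
qed

lemma minimizer_exists: "\<exists>x. minimizer y p x"
proof -
  have "cball xbar \<delta> \<noteq> {}" using \<delta> by simp
  moreover have "eventually (\<lambda>u. ereal c < g (u, p) + ereal (quad y u)) (nhds x)"
    if c: "ereal c < g (x, p) + ereal (quad y x)" for x c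
  proof -
    have "isCont (\<lambda>z. quad y (fst z)) (x, p)"
      unfolding quad_def using lam_pos by (intro continuous_intros bounded_linear.isCont[OF A]) auto
    then have "eventually (\<lambda>z. ereal c < g z + ereal (quad y (fst z))) (nhds (x, p))"
      using lower_semicontinuous_add[OF lsc, where \<psi> = "\<lambda>z. quad y (fst z)" and z = "(x, p)" and c = c] c by simp
    moreover have "((\<lambda>u. (u, p)) \<longlongrightarrow> (x, p)) (nhds x)" by (intro tendsto_intros tendsto_ident_at filterlim_ident)
    ultimately show ?thesis using eventually_compose_filterlim by fastforce
  qed
  ultimately have "\<exists>x\<in>cball xbar \<delta>. \<forall>u\<in>cball xbar \<delta>. g (x, p) + ereal (quad y x) \<le> g (u, p) + ereal (quad y u)"
    by (intro lower_semicontinuous_attains_inf) auto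
  then show ?thesis unfolding minimizer_def by blast
qed

lemma minimizer_unique:
  assumes "near x p v" "minimizer (x + lam *\<^sub>R (v + A x)) p u"
  shows "u = x"
proof -
  let ?y = "x + lam *\<^sub>R (v + A x)"
  obtain \<alpha> where \<alpha>: "g (x, p) = ereal \<alpha>" using near_finite[OF assms(1)] by blast
  have "x \<in> cball xbar \<delta>" "u \<in> cball xbar \<delta>" using assms by (auto simp: near_def minimizer_def)
  then have "g (x, p) + ereal (quad ?y x + (norm (u - x))\<^sup>2 / (4 * lam)) \<le> g (x, p) + ereal (quad ?y x)"
    using growth[OF assms(1), of u] assms(2) by (meson minimizer_def order_trans)
  then have "(norm (u - x))\<^sup>2 / (4 * lam) \<le> 0" by (simp add: \<alpha>)
  then show ?thesis using lam_pos by (simp add: divide_le_0_iff)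
qed

text \<open>Lower semicontinuity of \<open>g\<close> bounds the value at a limit of minimizers from above by the limit of the minimal
  values; the competitors from \<open>inner_Lipschitz\<close> bound this limit by the value at \<open>x0\<close>, which by
  \<open>growth\<close> is attained at \<open>x0\<close> only.\<close>

lemma minimizer_stable:
  assumes n0: "near x0 p0 v0" and e: "e > 0"
  shows "\<exists>d>0. \<forall>y p x. dist p p0 < d \<longrightarrow> dist y (x0 + lam *\<^sub>R (v0 + A x0)) < d \<longrightarrow> minimizer y p x \<longrightarrow>
     dist x x0 < e \<and> g (x, p) \<noteq> \<infinity>"
proof (rule ccontr)
  assume neg: "\<not> ?thesis"
  define y0 where "y0 = x0 + lam *\<^sub>R (v0 + A x0)"
  obtain \<alpha> where \<alpha>: "g (x0, p0) = ereal \<alpha>" using near_finite[OF n0] by blast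
  have "\<exists>y p x. dist p p0 < 1 / real (Suc n) \<and> dist y y0 < 1 / real (Suc n) \<and> minimizer y p x \<and>
      \<not> (dist x x0 < e \<and> g (x, p) \<noteq> \<infinity>)" for n
    using neg unfolding y0_def[symmetric] by (metis of_nat_0_less_iff zero_less_Suc zero_less_divide_1_iff)
  then obtain y p x where seq: "\<And>n::nat. dist (p n) p0 < 1 / real (Suc n)" "\<And>n. dist (y n) y0 < 1 / real (Suc n)"
    "\<And>n. minimizer (y n) (p n) (x n)" "\<And>n. \<not> (dist (x n) x0 < e \<and> g (x n, p n) \<noteq> \<infinity>)" by metis
  have pl: "p \<longlonglongrightarrow> p0"
    by (rule tendsto_dist_bound[OF less_imp_le[OF seq(1)] divide_Suc_tendsto_0])
  have yl: "y \<longlonglongrightarrow> y0"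
    by (rule tendsto_dist_bound[OF less_imp_le[OF seq(2)] divide_Suc_tendsto_0])
  have "\<exists>x'. dist x' x0 \<le> l * dist (p n) p0 \<and> (p n \<in> ball pbar \<delta> \<longrightarrow> g (x', p n) \<le> ereal (\<alpha> + l * dist (p n) p0))" for n
  proof (cases "p n \<in> ball pbar \<delta>")
    case True
    then show ?thesis
      using inner_Lipschitz[of v0 x0 p0 "p n"] n0 by (auto simp: near_def \<alpha> dist_commute[of p0])
  next
    case False
    then show ?thesis using l by (intro exI[of _ x0]) auto
  qed
  then obtain x' where x': "\<And>n. dist (x' n) x0 \<le> l * dist (p n) p0"
    "\<And>n. p n \<in> ball pbar \<delta> \<Longrightarrow> g (x' n, p n) \<le> ereal (\<alpha> + l * dist (p n) p0)" by metis
  have lp: "(\<lambda>n. l * dist (p n) p0) \<longlonglongrightarrow> 0"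
    using tendsto_mult_right_zero[OF tendsto_dist_iff[THEN iffD1, OF pl]] .
  have x'l: "x' \<longlonglongrightarrow> x0"
    by (rule tendsto_dist_bound[OF x'(1) lp])
  have quad_lim: "(\<lambda>n. quad (b n) (c n)) \<longlonglongrightarrow> quad b0 c0" if "b \<longlonglongrightarrow> b0" "c \<longlonglongrightarrow> c0" for b c b0 c0
    unfolding quad_def using that lam_pos by (intro tendsto_intros bounded_linear.tendsto[OF A]) auto
  define B where "B n = \<alpha> + l * dist (p n) p0 + quad (y n) (x' n)" for n
  have Bl: "B \<longlonglongrightarrow> \<alpha> + quad y0 x0"
    unfolding B_def using tendsto_add[OF tendsto_add[OF tendsto_const[of \<alpha>] lp] quad_lim[OF yl x'l]] by simp
  have "eventually (\<lambda>n. p n \<in> ball pbar \<delta>) sequentially"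
    using n0 by (intro topological_tendstoD[OF pl]) (auto simp: near_def)
  moreover have "eventually (\<lambda>n. x' n \<in> ball xbar \<delta>) sequentially"
    using n0 by (intro topological_tendstoD[OF x'l]) (auto simp: near_def)
  ultimately have up: "eventually (\<lambda>n. g (x n, p n) + ereal (quad (y n) (x n)) \<le> ereal (B n)) sequentially"
  proof eventually_elim
    case (elim n)
    have "x' n \<in> cball xbar \<delta>" using elim by auto
    then have "g (x n, p n) + ereal (quad (y n) (x n)) \<le> g (x' n, p n) + ereal (quad (y n) (x' n))"
      using seq(3)[of n] unfolding minimizer_def by blast
    also have "\<dots> \<le> ereal (\<alpha> + l * dist (p n) p0) + ereal (quad (y n) (x' n))"
      using x'(2) elim by (intro add_right_mono) auto
    finally show ?case by (simp add: B_def)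
  qed
  have "bounded (range x)"
    by (rule bounded_subset[OF bounded_cball[of xbar \<delta>]]) (use seq(3) in \<open>auto simp: minimizer_def\<close>)
  then obtain x1 \<sigma> where \<sigma>: "strict_mono \<sigma>" "(x \<circ> \<sigma>) \<longlonglongrightarrow> x1"
    using bounded_imp_convergent_subsequence by blast
  have "(x \<circ> \<sigma>) n \<in> cball xbar \<delta>" for n using seq(3)[of "\<sigma> n"] by (simp add: minimizer_def)
  then have x1K: "x1 \<in> cball xbar \<delta>"
    using closed_sequentially[OF closed_cball _ \<sigma>(2)] by blast
  have upS: "eventually (\<lambda>n. g (x (\<sigma> n), p (\<sigma> n)) + ereal (quad (y (\<sigma> n)) (x (\<sigma> n))) \<le> ereal (B (\<sigma> n))) sequentially"
    using eventually_subseq[OF \<sigma>(1) up] .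
  have le: "g (x1, p0) + ereal (quad y0 x1) \<le> ereal (\<alpha> + quad y0 x0)"
  proof (rule ccontr)
    assume "\<not> ?thesis"
    then obtain c where c: "\<alpha> + quad y0 x0 < c" "ereal c < g (x1, p0) + ereal (quad y0 x1)"
      using ereal_dense2 by (metis less_ereal.simps(1) not_le)
    define \<psi> where "\<psi> = (\<lambda>z::('x \<times> 'p) \<times> 'x. quad (snd z) (fst (fst z)))"
    have lsc3: "lower_semicontinuous (\<lambda>z::('x \<times> 'p) \<times> 'x. g (fst z))"
      unfolding lower_semicontinuous_def
    proof (rule allI, subst le_Liminf_iff, intro allI impI)
      fix z :: "('x \<times> 'p) \<times> 'x" and b assume "b < g (fst z)"
      then have "eventually (\<lambda>u. b < g u) (nhds (fst z))" by (rule lower_semicontinuous_eventually[OF lsc])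
      moreover have "(fst \<longlongrightarrow> fst z) (at z)" by (intro tendsto_intros)
      ultimately show "eventually (\<lambda>u. b < g (fst u)) (at z)" by (rule eventually_compose_filterlim)
    qed
    have "isCont \<psi> ((x1, p0), y0)"
      unfolding \<psi>_def quad_def using lam_pos by (intro continuous_intros bounded_linear.isCont[OF A]) auto
    then have "eventually (\<lambda>z. ereal c < g (fst z) + ereal (\<psi> z)) (nhds ((x1, p0), y0))"
      using lower_semicontinuous_add[OF lsc3, where \<psi> = \<psi> and z = "((x1, p0), y0)" and c = c] c(2) by (simp add: \<psi>_def)
    moreover have "((\<lambda>n. ((x (\<sigma> n), p (\<sigma> n)), y (\<sigma> n))) \<longlongrightarrow> ((x1, p0), y0)) sequentially"
      using \<sigma>(2) LIMSEQ_subseq_LIMSEQ[OF pl \<sigma>(1)] LIMSEQ_subseq_LIMSEQ[OF yl \<sigma>(1)]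
      by (intro tendsto_intros) (auto simp: comp_def)
    ultimately have "eventually (\<lambda>n. ereal c < g (x (\<sigma> n), p (\<sigma> n)) + ereal (quad (y (\<sigma> n)) (x (\<sigma> n)))) sequentially"
      using eventually_compose_filterlim by (fastforce simp: \<psi>_def)
    moreover have "eventually (\<lambda>n. B (\<sigma> n) < c) sequentially"
      using order_tendstoD(2)[OF LIMSEQ_subseq_LIMSEQ[OF Bl \<sigma>(1)] c(1)] by (simp add: comp_def)
    ultimately have "eventually (\<lambda>n. False) sequentially"
      using upS
    proof eventually_elim
      case (elim n)
      have "ereal c < ereal (B (\<sigma> n))" using elim(1,3) by (rule order_less_le_trans)
      then show ?case using elim(2) by simp
    qed
    then show False by simp
  qed
  have "x1 = x0"
  proof -
    have "ereal (\<alpha> + (quad y0 x0 + (norm (x1 - x0))\<^sup>2 / (4 * lam))) \<le> ereal (\<alpha> + quad y0 x0)"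
      using order_trans[OF growth[OF n0 x1K] le[unfolded y0_def]] by (simp add: \<alpha> y0_def)
    then have "(norm (x1 - x0))\<^sup>2 / (4 * lam) \<le> 0" by simp
    then show ?thesis using lam_pos by (simp add: divide_le_0_iff)
  qed
  then have "eventually (\<lambda>n. dist (x (\<sigma> n)) x0 < e) sequentially"
    using tendstoD[OF \<sigma>(2) e] by (simp add: comp_def)
  then have "eventually (\<lambda>n. False) sequentially" using upS
  proof eventually_elim
    case (elim n)
    then have "g (x (\<sigma> n), p (\<sigma> n)) \<noteq> \<infinity>" by auto
    then show ?case using seq(4)[of "\<sigma> n"] elim by blast
  qed
  then show False by simp
qed

lemma minimizer_subgradient:
  assumes m: "minimizer y p x" and int: "x \<in> ball xbar \<delta>" and fin: "g (x, p) \<noteq> \<infinity>"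
  shows "(1 / lam) *\<^sub>R (y - x) - A x \<in> partial_subdiff g x p"
proof -
  define v where "v = (1 / lam) *\<^sub>R (y - x) - A x"
  obtain \<alpha> where \<alpha>: "g (x, p) = ereal \<alpha>" using fin not_minf[of "(x, p)"] by (cases "g (x, p)") auto
  have "v \<in> regular_subdiff (\<lambda>u. g (u, p)) x"
  proof (rule proximal_imp_regular_subdiff[where k = "1 / (2 * lam) + 3 * a / 2" and d = "\<delta> - dist xbar x"])
    show "g (x, p) = ereal \<alpha>" by (rule \<alpha>)
    show "0 < \<delta> - dist xbar x" using int by simp
    fix u assume "dist u x < \<delta> - dist xbar x"
    then have "u \<in> cball xbar \<delta>" using dist_triangle[of xbar u x] by (simp add: dist_commute)
    then have "ereal (\<alpha> + quad y x) \<le> g (u, p) + ereal (quad y u)"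
      using m by (simp add: minimizer_def \<alpha>)
    moreover have v': "A x + (1 / lam) *\<^sub>R (x - y) = - v" by (simp add: v_def algebra_simps)
    then have "quad y u \<le> quad y x - v \<bullet> (u - x) + (1 / (2 * lam) + 3 * a / 2) * (norm (u - x))\<^sup>2"
      using quad_expand_upper[of y u x] unfolding v' by simp
    ultimately show "ereal (\<alpha> + v \<bullet> (u - x) - (1 / (2 * lam) + 3 * a / 2) * (norm (u - x))\<^sup>2) \<le> g (u, p)"
      by (cases "g (u, p)") auto
  qed
  then show ?thesis unfolding v_def partial_subdiff_def using regular_subset_limiting_subdiff by blast
qed

lemma near_ref_point: "near xbar pbar vhat"
  using ref_subgradient \<delta> by (simp add: near_def)

text \<open>Stability of minimizers is used twice: at the reference point, to keep the minimizers in the interior of the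
  box, where the optimality condition holds, and at every other point, to make \<open>X\<close> continuous.\<close>

lemma chart_exists:
  obtains X h eta where "X (xbar + lam *\<^sub>R (vhat + A xbar)) pbar = xbar"
    "resolvent_chart (gph2 (partial_subdiff g)) A lam X h (xbar + lam *\<^sub>R (vhat + A xbar)) pbar eta"
proof -
  define ybar where "ybar = xbar + lam *\<^sub>R (vhat + A xbar)"
  define X where "X y p = (SOME x. minimizer y p x)" for y p
  define V where "V y p = (1 / lam) *\<^sub>R (y - X y p) - A (X y p)" for y p
  have Xm: "minimizer y p (X y p)" for y p unfolding X_def using minimizer_exists by (rule someI_ex)
  \<comment> \<open>The radii are such that \<open>V\<close> stays within \<open>\<delta>\<close> of \<open>vhat\<close>.\<close>
  define e where "e = min \<delta> (\<delta> / (2 * (1 / lam + a)))"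
  have la: "1 / lam + a > 0" using lam_pos a by (simp add: add_pos_pos)
  have e: "e > 0" "e \<le> \<delta>" using \<delta> la by (auto simp: e_def)
  have "e \<le> \<delta> / (2 * (1 / lam + a))" by (simp add: e_def)
  then have e2: "(1 / lam + a) * e \<le> \<delta> / 2" using la by (simp add: pos_le_divide_eq mult.commute mult.left_commute)
  obtain d where d: "d > 0" "\<And>y p x. dist p pbar < d \<Longrightarrow> dist y ybar < d \<Longrightarrow> minimizer y p x \<Longrightarrow>
     dist x xbar < e \<and> g (x, p) \<noteq> \<infinity>"
    using minimizer_stable[OF near_ref_point e(1)] unfolding ybar_def by metis
  define eta where "eta = min d (min \<delta> (lam * \<delta> / 2))"
  have eta: "eta > 0" "eta \<le> d" "eta \<le> \<delta>" "eta \<le> lam * \<delta> / 2" using d(1) \<delta> lam_pos by (auto simp: eta_def)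
  have Xnear: "near (X y p) p (V y p)" and Xy: "X y p + lam *\<^sub>R (V y p + A (X y p)) = y"
    if yp: "y \<in> ball ybar eta" "p \<in> ball pbar eta" for y p
  proof -
    have D: "dist (X y p) xbar < e" "g (X y p, p) \<noteq> \<infinity>"
      using d(2)[of p y "X y p"] Xm yp eta(2) by (auto simp: dist_commute)
    then have int: "X y p \<in> ball xbar \<delta>" using e(2) by (simp add: dist_commute)
    have sub: "V y p \<in> partial_subdiff g (X y p) p"
      unfolding V_def by (rule minimizer_subgradient[OF Xm int D(2)])
    have "vhat = (1 / lam) *\<^sub>R (ybar - xbar) - A xbar" using lam_pos by (simp add: ybar_def)
    then have "V y p - vhat = (1 / lam) *\<^sub>R (y - ybar) - ((1 / lam) *\<^sub>R (X y p - xbar) + A (X y p - xbar))"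
      by (simp add: V_def linear_diff[OF bounded_linear.linear[OF A]] algebra_simps)
    then have "norm (V y p - vhat) \<le> norm ((1 / lam) *\<^sub>R (y - ybar)) + (norm ((1 / lam) *\<^sub>R (X y p - xbar)) + norm (A (X y p - xbar)))"
      by (simp only:) (intro order_trans[OF norm_triangle_ineq4] add_left_mono norm_triangle_ineq)
    also have "\<dots> \<le> 1 / lam * norm (y - ybar) + (1 / lam + a) * norm (X y p - xbar)"
      using A_norm[of "X y p - xbar"] lam_pos by (simp add: distrib_right)
    also have "\<dots> < 1 / lam * eta + (1 / lam + a) * e"
      using yp(1) D(1) lam_pos la by (intro add_strict_mono mult_strict_left_mono) (auto simp: dist_norm norm_minus_commute)
    also have "\<dots> \<le> 1 / lam * (lam * \<delta> / 2) + \<delta> / 2"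
      using eta(4) e2 lam_pos by (intro add_mono mult_left_mono) auto
    also have "\<dots> = \<delta>" using lam_pos by simp
    finally have "V y p \<in> ball vhat \<delta>" by (simp add: dist_norm norm_minus_commute)
    moreover have "p \<in> ball pbar \<delta>" using yp(2) eta(3) by simp
    ultimately show "near (X y p) p (V y p)" unfolding near_def using sub int by blast
    show "X y p + lam *\<^sub>R (V y p + A (X y p)) = y" using lam_pos by (simp add: V_def)
  qed
  have Xbar: "X ybar pbar = xbar"
    using minimizer_unique[OF near_ref_point] Xm unfolding ybar_def by blast
  have Vbar: "V ybar pbar = vhat" using lam_pos by (simp add: V_def Xbar) (simp add: ybar_def)
  define h where "h y p = real_of_ereal (g (X y p, p)) + A (X y p) \<bullet> X y p / 2" for y p
  have contX: "continuous_on (ball ybar eta \<times> ball pbar eta) (\<lambda>(y, p). X y p)"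
    unfolding continuous_on_iff
  proof (intro ballI allI impI)
    fix yp0 and \<epsilon> :: real assume yp0: "yp0 \<in> ball ybar eta \<times> ball pbar eta" and \<epsilon>: "\<epsilon> > 0"
    obtain y0 p0 where eq: "yp0 = (y0, p0)" by (cases yp0)
    have in0: "y0 \<in> ball ybar eta" "p0 \<in> ball pbar eta" using yp0 eq by auto
    obtain s where s: "s > 0" "\<And>y p x. dist p p0 < s \<Longrightarrow> dist y y0 < s \<Longrightarrow> minimizer y p x \<Longrightarrow> dist x (X y0 p0) < \<epsilon>"
      using minimizer_stable[OF Xnear[OF in0] \<epsilon>] unfolding Xy[OF in0] by metis
    have "dist (X y p) (X y0 p0) < \<epsilon>" if "dist (y, p) (y0, p0) < s" for y p
    proof -
      have "dist y y0 < s" "dist p p0 < s"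
        using that dist_fst_le[of "(y, p)" "(y0, p0)"] dist_snd_le[of "(y, p)" "(y0, p0)"] by auto
      then show ?thesis using s(2) Xm by blast
    qed
    then show "\<exists>d>0. \<forall>x'\<in>ball ybar eta \<times> ball pbar eta. dist x' yp0 < d \<longrightarrow>
        dist (case x' of (y, p) \<Rightarrow> X y p) (case yp0 of (y, p) \<Rightarrow> X y p) < \<epsilon>"
      using s(1) eq by (intro exI[of _ s]) auto
  qed
  have "resolvent_chart (gph2 (partial_subdiff g)) A lam X h ybar pbar eta"
  proof (rule resolvent_chart.intro)
    show "bounded_linear A" by (rule A)
    show "A u \<bullet> v = u \<bullet> A v" for u v by (rule sym)
    show "lam > 0" by (rule lam_pos)
    show "eta > 0" by (rule eta(1))
    show "continuous_on (ball ybar eta \<times> ball pbar eta) (\<lambda>(y, p). X y p)" by (rule contX)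
    show "(X y p, p, (1 / lam) *\<^sub>R (y - X y p) - A (X y p)) \<in> gph2 (partial_subdiff g)"
      if "y \<in> ball ybar eta" "p \<in> ball pbar eta" for y p
      using Xnear[OF that] by (simp add: gph2_def near_def V_def)
    define H where "H = (\<lambda>(x, p::'p, v). (x + lam *\<^sub>R (v + A x), p))"
    have "isCont H (xbar, pbar, vhat)"
      unfolding H_def split_def by (intro continuous_intros bounded_linear.isCont[OF A])
    then have "(H \<longlongrightarrow> H (xbar, pbar, vhat)) (nhds (xbar, pbar, vhat))"
      unfolding isCont_def by (rule tendsto_at_iff_tendsto_nhds[THEN iffD1])
    moreover have "H (xbar, pbar, vhat) = (ybar, pbar)" by (simp add: H_def ybar_def)
    ultimately have "eventually (\<lambda>\<gamma>. H \<gamma> \<in> ball ybar eta \<times> ball pbar eta) (nhds (xbar, pbar, vhat))"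
      using eta(1) by (intro topological_tendstoD[where f = H and l = "(ybar, pbar)"]) (auto intro: open_Times)
    then obtain d1 where d1: "d1 > 0" "\<And>\<gamma>. dist \<gamma> (xbar, pbar, vhat) < d1 \<Longrightarrow> H \<gamma> \<in> ball ybar eta \<times> ball pbar eta"
      unfolding eventually_nhds_metric by blast
    have cov: "x + lam *\<^sub>R (v + A x) \<in> ball ybar eta \<and> p \<in> ball pbar eta \<and> X (x + lam *\<^sub>R (v + A x)) p = x"
      if G: "(x, p, v) \<in> gph2 (partial_subdiff g)" and D: "dist (x, p, v) (xbar, pbar, vhat) < min d1 \<delta>" for x p v
    proof -
      have "x + lam *\<^sub>R (v + A x) \<in> ball ybar eta" "p \<in> ball pbar eta"
        using d1(2)[of "(x, p, v)"] D by (auto simp: H_def)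
      moreover have "dist x xbar < \<delta>" "dist p pbar < \<delta>" "dist v vhat < \<delta>"
        using D dist_fst_le[of "(x, p, v)" "(xbar, pbar, vhat)"] dist_snd_le[of "(x, p, v)" "(xbar, pbar, vhat)"]
          dist_fst_le[of "(p, v)" "(pbar, vhat)"] dist_snd_le[of "(p, v)" "(pbar, vhat)"] by auto
      then have "near x p v" using G by (simp add: near_def gph2_def dist_commute)
      then have "X (x + lam *\<^sub>R (v + A x)) p = x" using minimizer_unique Xm by blast
      ultimately show ?thesis by blast
    qed
    have "0 < min d1 \<delta>" using d1(1) \<delta> by simp
    then show "\<exists>d>0. \<forall>x p v. (x, p, v) \<in> gph2 (partial_subdiff g) \<longrightarrow>
       dist (x, p, v) (X ybar pbar, pbar, (1 / lam) *\<^sub>R (ybar - X ybar pbar) - A (X ybar pbar)) < d \<longrightarrow>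
       x + lam *\<^sub>R (v + A x) \<in> ball ybar eta \<and> p \<in> ball pbar eta \<and> X (x + lam *\<^sub>R (v + A x)) p = x"
      unfolding Xbar Vbar[unfolded V_def Xbar] using cov by (intro exI[of _ "min d1 \<delta>"]) simp
    show "h y1 p + (1 / lam) *\<^sub>R (y1 - X y1 p) \<bullet> (X y2 p - X y1 p) - (norm (X y2 p - X y1 p))\<^sup>2 / (4 * lam) \<le> h y2 p"
      if yp: "y1 \<in> ball ybar eta" "y2 \<in> ball ybar eta" "p \<in> ball pbar eta" for y1 y2 p
    proof -
      have n: "near (X y1 p) p (V y1 p)" "near (X y2 p) p (V y2 p)" using Xnear yp by blast+
      obtain \<alpha>1 \<alpha>2 where \<alpha>: "g (X y1 p, p) = ereal \<alpha>1" "g (X y2 p, p) = ereal \<alpha>2"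
        using near_finite n by blast
      let ?d = "X y2 p - X y1 p"
      have "\<alpha>2 \<ge> \<alpha>1 + (V y1 p \<bullet> ?d - r / 2 * (norm ?d)\<^sup>2)"
        using prox_regular[of "V y1 p" "X y1 p" p "X y2 p"] n by (simp add: near_def \<alpha>)
      moreover have "A (X y2 p) \<bullet> X y2 p / 2 \<ge> A (X y1 p) \<bullet> X y1 p / 2 + A (X y1 p) \<bullet> ?d - a / 2 * (norm ?d)\<^sup>2"
        by (rule A_expand)
      moreover have "(norm ?d)\<^sup>2 / (4 * lam) = r / 2 * (norm ?d)\<^sup>2 + a / 2 * (norm ?d)\<^sup>2"
        using arg_cong[OF lam_eq', of "\<lambda>c. c * (norm ?d)\<^sup>2"] by (simp add: add_divide_distrib distrib_right)
      moreover have "(1 / lam) *\<^sub>R (y1 - X y1 p) \<bullet> ?d = V y1 p \<bullet> ?d + A (X y1 p) \<bullet> ?d"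
        by (simp add: V_def inner_diff_left)
      ultimately show ?thesis unfolding h_def \<alpha> real_of_ereal.simps by linarith
    qed
  qed
  then show thesis using that[of X h eta] Xbar unfolding ybar_def by blast
qed

end

lemma parametric_prox_from_assumptions:
  fixes g :: "'x::euclidean_space \<times> 'p::euclidean_space \<Rightarrow> ereal"
  assumes not_minf: "\<forall>z. g z \<noteq> - \<infinity>" and lsc: "lower_semicontinuous g"
    and A2: "assumption_A2 g xbar pbar vhat" and A3: "assumption_A3 g xbar pbar"
    and A: "bounded_linear A" "\<And>u v. A u \<bullet> v = u \<bullet> A v"
  obtains a r lam l \<delta> where "parametric_prox g A a r lam l \<delta> xbar vhat pbar"
proof -
  obtain a where a: "a > 0" "\<And>w. norm (A w) \<le> a * norm w"
    using bounded_linear.pos_bounded[OF A(1)] by (metis mult.commute)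
  have sub: "vhat \<in> partial_subdiff g xbar pbar" using A2 by (simp add: assumption_A2_def)
  then obtain \<gamma> where \<gamma>: "g (xbar, pbar) = ereal \<gamma>"
    unfolding partial_subdiff_def limiting_subdiff_def by (cases "g (xbar, pbar)") auto
  obtain U V Q \<epsilon> r where P: "\<epsilon> > 0" "r > 0" "xbar \<in> interior U" "vhat \<in> interior V" "pbar \<in> interior Q"
    "\<forall>u\<in>U. \<forall>p\<in>Q. \<forall>v \<in> partial_subdiff g u p \<inter> V. g (u, p) \<le> g (xbar, pbar) + ereal \<epsilon> \<longrightarrow>
       (\<forall>x\<in>U. g (x, p) \<ge> g (u, p) + ereal (v \<bullet> (x - u) - r / 2 * (norm (x - u))\<^sup>2))"
    using A2 unfolding assumption_A2_def by metis
  have cont: "continuous (at (xbar, pbar, vhat) within gph2 (partial_subdiff g)) (\<lambda>(x, p, v). g (x, p))"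
    using A2 by (simp add: assumption_A2_def)
  obtain Q' W l where E: "l > 0" "pbar \<in> interior Q'" "(xbar, \<gamma>) \<in> interior W"
    "\<forall>p\<in>Q'. \<forall>q\<in>Q'. epi (\<lambda>x. g (x, p)) \<inter> W \<subseteq> {y + (l * dist p q) *\<^sub>R b | y b. y \<in> epi (\<lambda>x. g (x, q)) \<and> b \<in> cball 0 1}"
    using A3 unfolding assumption_A3_def lipschitz_like_def by (auto simp: \<gamma>)
  obtain e1 where e1: "e1 > 0" "ball xbar e1 \<subseteq> U" using ball_in_interior[OF P(3)] .
  obtain e2 where e2: "e2 > 0" "ball vhat e2 \<subseteq> V" using ball_in_interior[OF P(4)] .
  obtain e3 where e3: "e3 > 0" "ball pbar e3 \<subseteq> Q" using ball_in_interior[OF P(5)] .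
  obtain e4 where e4: "e4 > 0" "ball pbar e4 \<subseteq> Q'" using ball_in_interior[OF E(2)] .
  obtain \<omega> where \<omega>: "\<omega> > 0" "ball (xbar, \<gamma>) \<omega> \<subseteq> W" using ball_in_interior[OF E(3)] .
  define \<tau> where "\<tau> = min \<epsilon> (\<omega> / 2)"
  have \<tau>: "\<tau> > 0" "\<tau> \<le> \<epsilon>" "\<tau> \<le> \<omega> / 2" using P(1) \<omega>(1) by (auto simp: \<tau>_def)
  let ?F = "at (xbar, pbar, vhat) within gph2 (partial_subdiff g)"
  have lim: "((\<lambda>(x, p, v). g (x, p)) \<longlongrightarrow> ereal \<gamma>) ?F"
    using cont by (simp add: continuous_within \<gamma>)
  have "eventually (\<lambda>z. (case z of (x, p, v) \<Rightarrow> g (x, p)) < ereal (\<gamma> + \<tau>)) ?F"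
    "eventually (\<lambda>z. (case z of (x, p, v) \<Rightarrow> g (x, p)) > ereal (\<gamma> - \<tau>)) ?F"
    using order_tendstoD[OF lim] \<tau>(1) by auto
  then have "eventually (\<lambda>z. (case z of (x, p, v) \<Rightarrow> g (x, p)) < ereal (\<gamma> + \<tau>) \<and>
      (case z of (x, p, v) \<Rightarrow> g (x, p)) > ereal (\<gamma> - \<tau>)) ?F"
    by (rule eventually_conj)
  then obtain d where d: "d > 0" "\<And>z. z \<in> gph2 (partial_subdiff g) \<Longrightarrow> z \<noteq> (xbar, pbar, vhat) \<Longrightarrow> dist z (xbar, pbar, vhat) < d \<Longrightarrow>
      (case z of (x, p, v) \<Rightarrow> g (x, p)) < ereal (\<gamma> + \<tau>) \<and> (case z of (x, p, v) \<Rightarrow> g (x, p)) > ereal (\<gamma> - \<tau>)"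
    unfolding eventually_at by blast
  have val: "g (x, p) < ereal (\<gamma> + \<tau>) \<and> g (x, p) > ereal (\<gamma> - \<tau>)"
    if "v \<in> partial_subdiff g x p" "dist (x, p, v) (xbar, pbar, vhat) < d" for x p v
    using d(2)[of "(x, p, v)"] that \<tau>(1) by (cases "(x, p, v) = (xbar, pbar, vhat)") (auto simp: gph2_def \<gamma>)
  define \<delta> where "\<delta> = min (min (d / 3) (e1 / 2)) (min (min e2 e3) (min e4 (\<omega> / 2)))"
  have \<delta>: "\<delta> > 0" "\<delta> \<le> d / 3" "\<delta> \<le> e1 / 2" "\<delta> \<le> e2" "\<delta> \<le> e3" "\<delta> \<le> e4" "\<delta> \<le> \<omega> / 2"
    using d(1) e1(1) e2(1) e3(1) e4(1) \<omega>(1) by (auto simp: \<delta>_def min_le_iff_disj)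
  have box: "g (x, p) < ereal (\<gamma> + \<tau>) \<and> g (x, p) > ereal (\<gamma> - \<tau>)"
    if "v \<in> partial_subdiff g x p" "x \<in> ball xbar \<delta>" "p \<in> ball pbar \<delta>" "v \<in> ball vhat \<delta>" for x p v
    by (rule val[OF that(1)], rule dist_triple_less) (use that \<delta>(2) in \<open>auto simp: dist_commute\<close>)
  define lam where "lam = 1 / (2 * (r + a))"
  have "parametric_prox g A a r lam l \<delta> xbar vhat pbar"
  proof (rule parametric_prox.intro)
    show "g z \<noteq> - \<infinity>" for z using not_minf by blast
    show "u \<in> cball xbar \<delta> \<Longrightarrow> g (x, p) + ereal (v \<bullet> (u - x) - r / 2 * (norm (u - x))\<^sup>2) \<le> g (u, p)"
      if v: "v \<in> partial_subdiff g x p" "x \<in> ball xbar \<delta>" "p \<in> ball pbar \<delta>" "v \<in> ball vhat \<delta>" for v x p u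
    proof -
      assume u: "u \<in> cball xbar \<delta>"
      have "x \<in> ball xbar e1" "u \<in> ball xbar e1" "p \<in> ball pbar e3" "v \<in> ball vhat e2"
        using v u \<delta> e1(1) by auto
      then have in1: "x \<in> U" "u \<in> U" "p \<in> Q" "v \<in> V" using e1 e2 e3 by blast+
      have "ereal (\<gamma> + \<tau>) \<le> g (xbar, pbar) + ereal \<epsilon>" using \<tau>(2) by (simp add: \<gamma>)
      then have "g (x, p) \<le> g (xbar, pbar) + ereal \<epsilon>" 
        by (rule order_trans[OF less_imp_le[OF conjunct1[OF box[OF v]]]])
      then show ?thesis using P(6) in1 v(1) by blast
    qed
    show "\<exists>x'. dist x' x \<le> l * dist p p' \<and> g (x', p') \<le> g (x, p) + ereal (l * dist p p')"
      if v: "v \<in> partial_subdiff g x p" "x \<in> ball xbar \<delta>" "p \<in> ball pbar \<delta>" "v \<in> ball vhat \<delta>"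
        and p': "p' \<in> ball pbar \<delta>" for v x p p'
    proof -
      obtain \<alpha> where \<alpha>: "g (x, p) = ereal \<alpha>" "\<gamma> - \<tau> < \<alpha>" "\<alpha> < \<gamma> + \<tau>"
        using box[OF v] by (cases "g (x, p)") auto
      have "dist (xbar, \<gamma>) (x, \<alpha>) \<le> dist xbar x + dist \<gamma> \<alpha>"
        by (rule dist_Pair_le)
      also have "\<dots> < \<omega>" using v(2) \<alpha> \<delta>(7) \<tau>(3) by (simp add: dist_real_def)
      finally have "(x, \<alpha>) \<in> epi (\<lambda>x. g (x, p)) \<inter> W" using \<omega>(2) \<alpha>(1) by (auto simp: epi_def)
      moreover have "p \<in> Q'" "p' \<in> Q'" using v(3) p' \<delta>(6) e4(2) by auto
      ultimately obtain y b where yb: "(x, \<alpha>) = y + (l * dist p p') *\<^sub>R b" "y \<in> epi (\<lambda>x. g (x, p'))" "b \<in> cball 0 1"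
        using E(4) by blast
      obtain x' \<alpha>' where y: "y = (x', \<alpha>')" by (cases y)
      obtain b1 b2 where b: "b = (b1, b2)" by (cases b)
      have nb: "norm b1 \<le> 1" "\<bar>b2\<bar> \<le> 1"
        using yb(3) norm_fst_le[of b1 b2] norm_snd_le[of b2 b1] by (auto simp: b)
      have eqs: "x = x' + (l * dist p p') *\<^sub>R b1" "\<alpha> = \<alpha>' + (l * dist p p') * b2" using yb(1) by (auto simp: y b)
      have ld: "l * dist p p' \<ge> 0" using E(1) by simp
      have "dist x' x = (l * dist p p') * norm b1" using eqs(1) ld by (simp add: dist_norm)
      also have "\<dots> \<le> l * dist p p'" using mult_left_mono[OF nb(1) ld] by simp
      finally have 1: "dist x' x \<le> l * dist p p'" .
      have "- b2 \<le> 1" using nb(2) by simp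
      then have "(l * dist p p') * (- b2) \<le> l * dist p p'" using mult_left_mono[of "- b2" 1, OF _ ld] by simp
      then have "\<alpha>' \<le> \<alpha> + l * dist p p'" using eqs(2) by simp
      moreover have "g (x', p') \<le> ereal \<alpha>'" using yb(2) by (simp add: y epi_def)
      ultimately have "g (x', p') \<le> ereal (\<alpha> + l * dist p p')" by (meson ereal_less_eq(3) order_trans)
      then show ?thesis using 1 by (auto simp: \<alpha>(1))
    qed
  qed (use lsc A a P(2) E(1) \<delta>(1) lam_def sub in auto)
  then show thesis using that by blast
qed

section \<open>Local estimates for the single-valued part\<close>

lemma has_derivative_grad_x:
  assumes "(\<lambda>u. f (u, p)) differentiable (at x)"
  shows "((\<lambda>u. f (u, p)) has_derivative blinfun_apply (grad_x f (x, p))) (at x)"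
proof -
  have d: "((\<lambda>u. f (u, p)) has_derivative frechet_derivative (\<lambda>u. f (u, p)) (at x)) (at x)"
    using assms by (simp add: frechet_derivative_works)
  then show ?thesis
    using bounded_linear_Blinfun_apply[OF has_derivative_bounded_linear[OF d]] by (simp add: grad_x_def)
qed

text \<open>The mean value inequality for \<open>u \<mapsto> f (u, p) - T u\<close> with \<open>T\<close> the partial derivative at the reference
  point.\<close>

lemma A1_estimates:
  fixes f :: "'x::euclidean_space \<times> 'p::euclidean_space \<Rightarrow> 'x"
  assumes A1: "assumption_A1 f xbar pbar" and e: "e > 0"
  obtains s L where "s > 0" "L > 0"
    "\<And>x p. x \<in> ball xbar s \<Longrightarrow> p \<in> ball pbar s \<Longrightarrow> (\<lambda>u. f (u, p)) differentiable (at x)"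
    "\<And>x1 x2 p. x1 \<in> ball xbar s \<Longrightarrow> x2 \<in> ball xbar s \<Longrightarrow> p \<in> ball pbar s \<Longrightarrow>
       norm (f (x2, p) - f (x1, p) - blinfun_apply (grad_x f (xbar, pbar)) (x2 - x1)) \<le> e * norm (x2 - x1)"
    "\<And>x1 x2 p1 p2. x1 \<in> ball xbar s \<Longrightarrow> x2 \<in> ball xbar s \<Longrightarrow> p1 \<in> ball pbar s \<Longrightarrow> p2 \<in> ball pbar s \<Longrightarrow>
       norm (f (x2, p2) - f (x1, p1)) \<le> L * (norm (x2 - x1) + norm (p2 - p1))"
proof -
  obtain N where N: "(xbar, pbar) \<in> interior N" "\<forall>(x, p)\<in>N. (\<lambda>u. f (u, p)) differentiable (at x)"
    using A1 unfolding assumption_A1_def by blast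
  obtain U Q L where L: "L > 0" "xbar \<in> interior U" "pbar \<in> interior Q"
    "\<forall>x\<in>U. \<forall>p1\<in>Q. \<forall>p2\<in>Q. norm (f (x, p1) - f (x, p2)) \<le> L * dist p1 p2"
    using A1 unfolding assumption_A1_def by blast
  have cont: "isCont (grad_x f) (xbar, pbar)" using A1 by (simp add: assumption_A1_def)
  obtain n where n: "n > 0" "ball (xbar, pbar) n \<subseteq> N" using ball_in_interior[OF N(1)] .
  obtain u where u: "u > 0" "ball xbar u \<subseteq> U" using ball_in_interior[OF L(2)] .
  obtain q where q: "q > 0" "ball pbar q \<subseteq> Q" using ball_in_interior[OF L(3)] .
  obtain c where c: "c > 0" "\<And>z. dist z (xbar, pbar) < c \<Longrightarrow> dist (grad_x f z) (grad_x f (xbar, pbar)) < e"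
    using cont e unfolding continuous_at_eps_delta by metis
  define s where "s = Min {n / 2, u, q, c / 2}"
  have s: "s > 0" "s \<le> n / 2" "s \<le> u" "s \<le> q" "s \<le> c / 2" using n(1) u(1) q(1) c(1) by (simp_all add: s_def)
  have dz: "dist (x, p) (xbar, pbar) < 2 * s" if "x \<in> ball xbar s" "p \<in> ball pbar s" for x p
  proof -
    have "dist (x, p) (xbar, pbar) \<le> dist x xbar + dist p pbar"
      by (rule dist_Pair_le)
    then show ?thesis using that by (simp add: dist_commute)
  qed
  have diff: "(\<lambda>u. f (u, p)) differentiable (at x)" if "x \<in> ball xbar s" "p \<in> ball pbar s" for x p
  proof -
    have "dist (x, p) (xbar, pbar) < n" using dz[OF that] s(2) by linarith
    then have "(x, p) \<in> N" using n(2) by (auto simp: dist_commute)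
    then show ?thesis using N(2) by auto
  qed
  define T where "T = grad_x f (xbar, pbar)"
  have inc: "norm (f (x2, p) - f (x1, p) - T (x2 - x1)) \<le> e * norm (x2 - x1)"
    if x: "x1 \<in> ball xbar s" "x2 \<in> ball xbar s" and p: "p \<in> ball pbar s" for x1 x2 p
  proof -
    have "norm ((f (x2, p) - T x2) - (f (x1, p) - T x1)) \<le> e * norm (x2 - x1)"
    proof (rule differentiable_bound[OF convex_ball])
      fix x assume x: "x \<in> ball xbar s"
      have "((\<lambda>u. f (u, p) - T u) has_derivative (\<lambda>h. grad_x f (x, p) h - T h)) (at x)"
        by (intro has_derivative_diff has_derivative_grad_x diff[OF x p] bounded_linear_imp_has_derivative blinfun.bounded_linear_right)
      then show "((\<lambda>u. f (u, p) - T u) has_derivative blinfun_apply (grad_x f (x, p) - T)) (at x within ball xbar s)"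
        unfolding minus_blinfun.rep_eq by (rule has_derivative_at_withinI)
      have "dist (x, p) (xbar, pbar) < c" using dz[OF x p] s(5) by linarith
      then have "norm (grad_x f (x, p) - T) \<le> e" using c(2)[of "(x, p)"] by (simp add: T_def dist_norm)
      then show "onorm (blinfun_apply (grad_x f (x, p) - T)) \<le> e" by (simp add: norm_blinfun.rep_eq)
    qed (use x in auto)
    then show ?thesis by (simp add: blinfun.diff_right algebra_simps)
  qed
  define L' where "L' = norm T + e + L"
  have "norm (f (x2, p2) - f (x1, p1)) \<le> L' * (norm (x2 - x1) + norm (p2 - p1))"
    if x: "x1 \<in> ball xbar s" "x2 \<in> ball xbar s" and p: "p1 \<in> ball pbar s" "p2 \<in> ball pbar s" for x1 x2 p1 p2
  proof -
    have "x1 \<in> U" "p1 \<in> Q" "p2 \<in> Q" using x p s(3,4) u(2) q(2) by auto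
    then have "norm (f (x1, p2) - f (x1, p1)) \<le> L * norm (p2 - p1)" using L(4) by (auto simp: dist_norm)
    moreover have "norm (f (x2, p2) - f (x1, p2)) \<le> norm (T (x2 - x1)) + e * norm (x2 - x1)"
      using inc[OF x p(2)] norm_triangle_ineq2[of "f (x2, p2) - f (x1, p2)" "T (x2 - x1)"] by linarith
    moreover have "norm (T (x2 - x1)) \<le> norm T * norm (x2 - x1)" by (rule norm_blinfun)
    moreover have "norm (f (x2, p2) - f (x1, p1)) \<le> norm (f (x2, p2) - f (x1, p2)) + norm (f (x1, p2) - f (x1, p1))"
      using norm_triangle_ineq[of "f (x2, p2) - f (x1, p2)" "f (x1, p2) - f (x1, p1)"] by simp
    moreover have "L' * (norm (x2 - x1) + norm (p2 - p1)) = (norm T * norm (x2 - x1) + e * norm (x2 - x1) + L * norm (p2 - p1))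
        + (L * norm (x2 - x1) + (norm T + e) * norm (p2 - p1))" by (simp add: L'_def algebra_simps)
    moreover have "L * norm (x2 - x1) + (norm T + e) * norm (p2 - p1) \<ge> 0" using L(1) e by simp
    ultimately show ?thesis by linarith
  qed
  moreover have "L' > 0" using L(1) e by (simp add: L'_def add_nonneg_pos)
  ultimately show thesis using that[of s L'] s(1) diff inc unfolding T_def by blast
qed


section \<open>Sufficiency\<close>

text \<open>Pass from \<open>(v1, p1)\<close> to \<open>(v2, p1)\<close> by monotonicity and from there to \<open>(v2, p2)\<close> by Lipschitz
  continuity.\<close>

lemma strongly_monotone_localization_imp_stable:
  assumes sol: "xbar \<in> S vbar pbar"
    and loc: "single_valued_localization S vbar pbar xbar V Q U \<theta>"
    and c: "c > 0" and L: "L > 0"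
    and mono: "\<And>v1 v2 p. v1 \<in> V \<Longrightarrow> v2 \<in> V \<Longrightarrow> p \<in> Q \<Longrightarrow>
       (v1 - v2) \<bullet> (\<theta> (v1, p) - \<theta> (v2, p)) \<ge> c * (norm (\<theta> (v1, p) - \<theta> (v2, p)))\<^sup>2"
    and lip: "\<And>v1 v2 p1 p2. v1 \<in> V \<Longrightarrow> v2 \<in> V \<Longrightarrow> p1 \<in> Q \<Longrightarrow> p2 \<in> Q \<Longrightarrow>
       norm (\<theta> (v1, p1) - \<theta> (v2, p2)) \<le> L * (norm (v1 - v2) + norm (p1 - p2))"
  shows "lipschitzian_fully_stable S vbar pbar xbar"
proof -
  have "norm ((v1 - v2) - (2 * c) *\<^sub>R (\<theta> (v1, p1) - \<theta> (v2, p2))) \<le> norm (v1 - v2) + (2 * c * L) * dist p1 p2"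
    if vp: "v1 \<in> V" "v2 \<in> V" "p1 \<in> Q" "p2 \<in> Q" for v1 v2 p1 p2
  proof -
    define x where "x = \<theta> (v1, p1) - \<theta> (v2, p1)"
    define y where "y = \<theta> (v2, p1) - \<theta> (v2, p2)"
    have "c * ((v1 - v2) \<bullet> x) \<ge> c * (c * (norm x)\<^sup>2)"
      using mono[OF vp(1,2,3)] c unfolding x_def by (intro mult_left_mono) auto
    moreover have "(norm ((v1 - v2) - (2 * c) *\<^sub>R x))\<^sup>2 = (norm (v1 - v2))\<^sup>2 - 4 * (c * ((v1 - v2) \<bullet> x)) + 4 * (c * (c * (norm x)\<^sup>2))"
      unfolding power2_norm_eq_inner by (simp add: inner_diff_left inner_diff_right inner_commute algebra_simps)
    ultimately have "(norm ((v1 - v2) - (2 * c) *\<^sub>R x))\<^sup>2 \<le> (norm (v1 - v2))\<^sup>2" by linarith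
    then have 1: "norm ((v1 - v2) - (2 * c) *\<^sub>R x) \<le> norm (v1 - v2)" by (rule power2_le_imp_le) simp
    have "norm y \<le> L * norm (p1 - p2)" using lip[OF vp(2,2,3,4)] by (simp add: y_def)
    then have "2 * c * norm y \<le> 2 * c * (L * norm (p1 - p2))" using c by (intro mult_left_mono) auto
    then have 2: "norm ((2 * c) *\<^sub>R y) \<le> (2 * c * L) * dist p1 p2" using c by (simp add: dist_norm)
    have eq: "(v1 - v2) - (2 * c) *\<^sub>R (\<theta> (v1, p1) - \<theta> (v2, p2)) = ((v1 - v2) - (2 * c) *\<^sub>R x) - (2 * c) *\<^sub>R y"
      by (simp add: x_def y_def algebra_simps)
    show ?thesis unfolding eq
      using norm_triangle_ineq4[of "(v1 - v2) - (2 * c) *\<^sub>R x" "(2 * c) *\<^sub>R y"] 1 2 by linarith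
  qed
  moreover have "2 * c * L > 0" using c L by simp
  ultimately show ?thesis unfolding lipschitzian_fully_stable_def using sol loc c by blast
qed

lemma Lipschitz_estimate_imp_lipschitz_localization:
  assumes loc: "single_valued_localization S vbar pbar xbar V Q U \<theta>" and L: "L > 0"
    and lip: "\<And>v1 v2 p1 p2. v1 \<in> V \<Longrightarrow> v2 \<in> V \<Longrightarrow> p1 \<in> Q \<Longrightarrow> p2 \<in> Q \<Longrightarrow>
       norm (\<theta> (v1, p1) - \<theta> (v2, p2)) \<le> L * (norm (v1 - v2) + norm (p1 - p2))"
  shows "lipschitz_localization S vbar pbar xbar"
proof -
  have "(2 * L)-lipschitz_on (V \<times> Q) \<theta>"
  proof (rule lipschitz_onI)
    fix z1 z2 assume z: "z1 \<in> V \<times> Q" "z2 \<in> V \<times> Q"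
    obtain v1 p1 v2 p2 where eq: "z1 = (v1, p1)" "z2 = (v2, p2)" by (cases z1, cases z2)
    have "norm (\<theta> (v1, p1) - \<theta> (v2, p2)) \<le> L * (norm (v1 - v2) + norm (p1 - p2))"
      using z by (intro lip) (auto simp: eq)
    also have "\<dots> \<le> L * (dist z1 z2 + dist z1 z2)"
      using L dist_fst_le[of z1 z2] dist_snd_le[of z1 z2]
      by (intro mult_left_mono add_mono) (auto simp: eq dist_norm)
    finally show "dist (\<theta> z1) (\<theta> z2) \<le> (2 * L) * dist z1 z2" by (simp add: eq dist_norm)
  qed (use L in simp)
  then show ?thesis unfolding lipschitz_localization_def using loc by blast
qed

text \<open>The localization is \<open>X\<close> composed with the inverse of \<open>(y, p) \<mapsto> (N y p, p)\<close>, where \<open>N y p\<close> is the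
  parameter \<open>v\<close> for which \<open>X y p\<close> is the solution at \<open>p\<close>.  Invariance of domain replaces an existence
  argument: it shows that all \<open>(v, p)\<close> near \<open>(vbar, pbar)\<close> are reached.\<close>

lemma conditions_imp_stable:
  fixes f :: "'x::euclidean_space \<times> 'p::euclidean_space \<Rightarrow> 'x" and g :: "'x \<times> 'p \<Rightarrow> ereal"
  assumes not_minf: "\<forall>z. g z \<noteq> - \<infinity>" and lsc: "lower_semicontinuous g"
    and A1: "assumption_A1 f xbar pbar" and A2: "assumption_A2 g xbar pbar (vbar - f (xbar, pbar))"
    and A3: "assumption_A3 g xbar pbar"
    and crit: "\<forall>q. (0, q, 0) \<in> limiting_normal_cone (gph2 (partial_subdiff g)) (xbar, pbar, vbar - f (xbar, pbar)) \<longrightarrow> q = 0"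
    and pd: "\<forall>z q w. w \<noteq> 0 \<longrightarrow>
      (z, q, - w) \<in> limiting_normal_cone (gph2 (partial_subdiff g)) (xbar, pbar, vbar - f (xbar, pbar)) \<longrightarrow>
      blinfun_apply (grad_x f (xbar, pbar)) w \<bullet> w + z \<bullet> w > 0"
    and sol: "xbar \<in> solution_map f g vbar pbar"
  shows "lipschitzian_fully_stable (solution_map f g) vbar pbar xbar"
    and "lipschitz_localization (solution_map f g) vbar pbar xbar"
proof -
  define vhat where "vhat = vbar - f (xbar, pbar)"
  define T where "T = blinfun_apply (grad_x f (xbar, pbar))"
  \<comment> \<open>Only the quadratic form of \<open>T\<close> matters; its symmetric part keeps the subdifferential a gradient.\<close>
  define A where "A w = (1 / 2) *\<^sub>R (T w + adjoint T w)" for w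
  have T: "bounded_linear T" unfolding T_def by (rule blinfun.bounded_linear_right)
  have adj: "u \<bullet> adjoint T v = T u \<bullet> v" for u v by (rule adjoint_works[OF bounded_linear.linear[OF T]])
  have A: "bounded_linear A"
    unfolding A_def
    by (intro bounded_linear_const_scaleR bounded_linear_add T linear_conv_bounded_linear[THEN iffD1]
        adjoint_linear bounded_linear.linear[OF T])
  have sym: "A u \<bullet> v = u \<bullet> A v" for u v
    using adj[of u v] adj[of v u] by (simp add: A_def inner_add_left inner_add_right inner_commute)
  have AT: "A w \<bullet> w = T w \<bullet> w" for w
    using adj[of w w] by (simp add: A_def inner_add_left inner_add_right inner_commute)
  obtain a r lam l \<delta> where "parametric_prox g A a r lam l \<delta> xbar vhat pbar"
    using parametric_prox_from_assumptions[OF not_minf lsc A2 A3 A sym] unfolding vhat_def by blast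
  then interpret PP: parametric_prox g A a r lam l \<delta> xbar vhat pbar .
  define ybar where "ybar = xbar + lam *\<^sub>R (vhat + A xbar)"
  obtain X h eta where Xbar: "X ybar pbar = xbar"
    and "resolvent_chart (gph2 (partial_subdiff g)) A lam X h ybar pbar eta"
    using PP.chart_exists unfolding ybar_def by blast
  then interpret RC: resolvent_chart "gph2 (partial_subdiff g)" A lam X h ybar pbar eta
    "\<lambda>y p. (1 / lam) *\<^sub>R (y - X y p)" "\<lambda>y p. (1 / lam) *\<^sub>R (y - X y p) - A (X y p)"
    "(X ybar pbar, pbar, (1 / lam) *\<^sub>R (ybar - X ybar pbar) - A (X ybar pbar))"
    by simp_all
  define M where "M y p = (1 / lam) *\<^sub>R (y - X y p)" for y p
  define S where "S y p = M y p - A (X y p)" for y p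
  have lam: "lam > 0" by (rule PP.lam_pos)
  have Sbar: "(1 / lam) *\<^sub>R (ybar - X ybar pbar) - A (X ybar pbar) = vhat"
    using lam by (simp add: Xbar) (simp add: ybar_def)
  have ref: "(X ybar pbar, pbar, (1 / lam) *\<^sub>R (ybar - X ybar pbar) - A (X ybar pbar)) = (xbar, pbar, vhat)"
    using Sbar Xbar by simp
  have crit': "\<forall>q. (0, q, 0) \<in> limiting_normal_cone (gph2 (partial_subdiff g)) (xbar, pbar, vhat) \<longrightarrow> q = 0"
    using crit by (simp add: vhat_def)
  have pd': "\<forall>z q w. w \<noteq> 0 \<longrightarrow> (z, q, - w) \<in> limiting_normal_cone (gph2 (partial_subdiff g)) (xbar, pbar, vhat) \<longrightarrow>
      A w \<bullet> w + z \<bullet> w > 0"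
    using pd unfolding AT T_def vhat_def .
  obtain \<rho>1 L1 where \<rho>1: "\<rho>1 > 0" "\<rho>1 \<le> eta" "L1 > 0"
    "\<And>y1 p1 y2 p2. y1 \<in> ball ybar \<rho>1 \<Longrightarrow> y2 \<in> ball ybar \<rho>1 \<Longrightarrow> p1 \<in> ball pbar \<rho>1 \<Longrightarrow> p2 \<in> ball pbar \<rho>1 \<Longrightarrow>
       norm (M y2 p2 - M y1 p1) \<le> L1 * (norm (y2 - y1) + norm (p2 - p1))"
    by (rule RC.joint_Lipschitz[unfolded ref, OF crit', folded M_def]) (rule that)
  obtain \<rho>2 c where \<rho>2: "\<rho>2 > 0" "\<rho>2 \<le> eta" "c > 0"
    "\<And>y1 y2 p. y1 \<in> ball ybar \<rho>2 \<Longrightarrow> y2 \<in> ball ybar \<rho>2 \<Longrightarrow> p \<in> ball pbar \<rho>2 \<Longrightarrow>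
       (M y2 p - M y1 p) \<bullet> (X y2 p - X y1 p) \<ge> c * (norm (X y2 p - X y1 p))\<^sup>2"
    by (rule RC.resolvent_strongly_monotone[unfolded ref, OF crit' pd', folded M_def]) (rule that)
  have half_pos_c: "c / 2 > 0" using \<rho>2(3) by simp
  obtain s L2 where s: "s > 0" "L2 > 0"
    "\<And>x p. x \<in> ball xbar s \<Longrightarrow> p \<in> ball pbar s \<Longrightarrow> (\<lambda>u. f (u, p)) differentiable (at x)"
    "\<And>x1 x2 p. x1 \<in> ball xbar s \<Longrightarrow> x2 \<in> ball xbar s \<Longrightarrow> p \<in> ball pbar s \<Longrightarrow>
       norm (f (x2, p) - f (x1, p) - T (x2 - x1)) \<le> c / 2 * norm (x2 - x1)"
    "\<And>x1 x2 p1 p2. x1 \<in> ball xbar s \<Longrightarrow> x2 \<in> ball xbar s \<Longrightarrow> p1 \<in> ball pbar s \<Longrightarrow> p2 \<in> ball pbar s \<Longrightarrow>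
       norm (f (x2, p2) - f (x1, p1)) \<le> L2 * (norm (x2 - x1) + norm (p2 - p1))"
    by (rule A1_estimates[OF A1 half_pos_c, folded T_def]) (rule that)
  obtain \<rho>3 where \<rho>3: "\<rho>3 > 0" "\<rho>3 \<le> eta"
    "\<And>y p. y \<in> ball ybar \<rho>3 \<Longrightarrow> p \<in> ball pbar \<rho>3 \<Longrightarrow> dist (X y p, p, S y p) (xbar, pbar, vhat) < s"
    by (rule RC.near_ref[unfolded ref, folded M_def, folded S_def, OF s(1)]) (rule that)
  obtain d where d: "d > 0" "\<And>x p v. (x, p, v) \<in> gph2 (partial_subdiff g) \<Longrightarrow> dist (x, p, v) (xbar, pbar, vhat) < d \<Longrightarrow>
      X (x + lam *\<^sub>R (v + A x)) p = x"
    using RC.covers unfolding ref by blast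
  define \<rho> where "\<rho> = Min {\<rho>1, \<rho>2, \<rho>3, s}"
  have \<rho>: "\<rho> > 0" "\<rho> \<le> \<rho>1" "\<rho> \<le> \<rho>2" "\<rho> \<le> \<rho>3" "\<rho> \<le> s"
    using \<rho>1(1) \<rho>2(1) \<rho>3(1) s(1) by (simp_all add: \<rho>_def)
  let ?B = "ball ybar \<rho> \<times> ball pbar \<rho>"
  have Bin: "y \<in> ball ybar \<rho>1" "p \<in> ball pbar \<rho>1" "y \<in> ball ybar \<rho>2" "p \<in> ball pbar \<rho>2"
     "y \<in> ball ybar eta" "p \<in> ball pbar eta" "p \<in> ball pbar s" "X y p \<in> ball xbar s"
    if "y \<in> ball ybar \<rho>" "p \<in> ball pbar \<rho>" for y p
  proof -
    show "y \<in> ball ybar \<rho>1" "p \<in> ball pbar \<rho>1" "y \<in> ball ybar \<rho>2" "p \<in> ball pbar \<rho>2"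
     "y \<in> ball ybar eta" "p \<in> ball pbar eta" "p \<in> ball pbar s"
      using that \<rho> \<rho>1(2) by auto
    have "dist (X y p, p, S y p) (xbar, pbar, vhat) < s" using \<rho>3(3)[of y p] that \<rho>(4) by auto
    then show "X y p \<in> ball xbar s"
      using dist_fst_le[of "(X y p, p, S y p)" "(xbar, pbar, vhat)"] by (simp add: dist_commute)
  qed
  define N where "N y p = S y p + f (X y p, p)" for y p
  have y_eq: "y = X y p + lam *\<^sub>R M y p" for y p using lam by (simp add: M_def)
  have NM: "N y2 p2 - N y1 p1 = (M y2 p2 - M y1 p1) - A (X y2 p2 - X y1 p1) + (f (X y2 p2, p2) - f (X y1 p1, p1))"
    for y1 p1 y2 p2
    by (simp add: N_def S_def linear_diff[OF bounded_linear.linear[OF A]] algebra_simps)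
  have mono: "(N y2 p - N y1 p) \<bullet> (X y2 p - X y1 p) \<ge> c / 2 * (norm (X y2 p - X y1 p))\<^sup>2"
    if yp: "y1 \<in> ball ybar \<rho>" "y2 \<in> ball ybar \<rho>" "p \<in> ball pbar \<rho>" for y1 y2 p
  proof -
    let ?x = "X y2 p - X y1 p" and ?f = "f (X y2 p, p) - f (X y1 p, p)"
    have 1: "(M y2 p - M y1 p) \<bullet> ?x \<ge> c * (norm ?x)\<^sup>2"
      using \<rho>2(4)[OF Bin(3)[OF yp(1,3)] Bin(3)[OF yp(2,3)] Bin(4)[OF yp(1,3)]] .
    have "norm (?f - T ?x) \<le> c / 2 * norm ?x"
      using s(4)[OF Bin(8)[OF yp(1,3)] Bin(8)[OF yp(2,3)] Bin(7)[OF yp(1,3)]] .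
    then have "norm (?f - T ?x) * norm ?x \<le> c / 2 * norm ?x * norm ?x" by (rule mult_right_mono) simp
    then have 2: "- ((?f - T ?x) \<bullet> ?x) \<le> c / 2 * (norm ?x)\<^sup>2"
      using Cauchy_Schwarz_ineq2[of "?f - T ?x" ?x] by (simp add: power2_eq_square abs_le_iff)
    have "(N y2 p - N y1 p) \<bullet> ?x = (M y2 p - M y1 p) \<bullet> ?x - A ?x \<bullet> ?x + ?f \<bullet> ?x"
      unfolding NM by (simp add: inner_add_left inner_diff_left[of _ "A ?x"])
    also have "\<dots> = (M y2 p - M y1 p) \<bullet> ?x + (?f - T ?x) \<bullet> ?x"
      unfolding AT by (simp only: inner_diff_left)
    finally show ?thesis using 1 2 by simp
  qed
  have X_strong: "c / 2 * norm (X y2 p - X y1 p) \<le> norm (N y2 p - N y1 p)"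
    if yp: "y1 \<in> ball ybar \<rho>" "y2 \<in> ball ybar \<rho>" "p \<in> ball pbar \<rho>" for y1 y2 p
  proof -
    have "c / 2 * norm (X y2 p - X y1 p) * norm (X y2 p - X y1 p) \<le> norm (N y2 p - N y1 p) * norm (X y2 p - X y1 p)"
      using mono[OF yp] norm_cauchy_schwarz[of "N y2 p - N y1 p" "X y2 p - X y1 p"] by (simp add: power2_eq_square)
    then show ?thesis by (cases "X y2 p = X y1 p") (auto simp: mult_le_cancel_right)
  qed
  have X_p: "norm (X y p2 - X y p1) \<le> lam * L1 * norm (p2 - p1)"
    and N_p: "norm (N y p2 - N y p1) \<le> (L1 + onorm A * (lam * L1) + L2 * (lam * L1 + 1)) * norm (p2 - p1)"
    if yp: "y \<in> ball ybar \<rho>" "p1 \<in> ball pbar \<rho>" "p2 \<in> ball pbar \<rho>" for y p1 p2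
  proof -
    have M: "norm (M y p2 - M y p1) \<le> L1 * norm (p2 - p1)"
      using \<rho>1(4)[OF Bin(1)[OF yp(1,2)] Bin(1)[OF yp(1,2)] Bin(2)[OF yp(1,2)] Bin(2)[OF yp(1,3)]] by simp
    have "X y p2 - X y p1 = - (lam *\<^sub>R (M y p2 - M y p1))" using lam by (simp add: M_def algebra_simps)
    then have "norm (X y p2 - X y p1) = lam * norm (M y p2 - M y p1)" using lam by simp
    also have "\<dots> \<le> lam * (L1 * norm (p2 - p1))" using M lam by (intro mult_left_mono) auto
    finally show x: "norm (X y p2 - X y p1) \<le> lam * L1 * norm (p2 - p1)" by simp
    have "norm (A (X y p2 - X y p1)) \<le> onorm A * norm (X y p2 - X y p1)" by (rule onorm[OF A])
    also have "\<dots> \<le> onorm A * (lam * L1 * norm (p2 - p1))" using x onorm_pos_le[OF A] by (intro mult_left_mono) auto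
    finally have a: "norm (A (X y p2 - X y p1)) \<le> onorm A * (lam * L1 * norm (p2 - p1))" .
    have "norm (f (X y p2, p2) - f (X y p1, p1)) \<le> L2 * (norm (X y p2 - X y p1) + norm (p2 - p1))"
      using s(5)[OF Bin(8)[OF yp(1,2)] Bin(8)[OF yp(1,3)] Bin(7)[OF yp(1,2)] Bin(7)[OF yp(1,3)]] .
    also have "\<dots> \<le> L2 * (lam * L1 * norm (p2 - p1) + norm (p2 - p1))" using x s(2) by (intro mult_left_mono) auto
    finally have f: "norm (f (X y p2, p2) - f (X y p1, p1)) \<le> L2 * (lam * L1 * norm (p2 - p1) + norm (p2 - p1))" .
    have "norm (N y p2 - N y p1) \<le> norm (M y p2 - M y p1) + norm (A (X y p2 - X y p1)) + norm (f (X y p2, p2) - f (X y p1, p1))"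
      unfolding NM by (meson add_right_mono norm_triangle_ineq norm_triangle_ineq4 order_trans)
    then have "norm (N y p2 - N y p1) \<le> L1 * norm (p2 - p1) + onorm A * (lam * L1 * norm (p2 - p1)) + L2 * (lam * L1 * norm (p2 - p1) + norm (p2 - p1))"
      using M a f by linarith
    then show "norm (N y p2 - N y p1) \<le> (L1 + onorm A * (lam * L1) + L2 * (lam * L1 + 1)) * norm (p2 - p1)"
      by (simp add: algebra_simps)
  qed
  define C where "C = L1 + onorm A * (lam * L1) + L2 * (lam * L1 + 1)"
  define L where "L = 2 / c + 2 / c * C + lam * L1"
  have C: "C > 0" using \<rho>1(3) onorm_pos_le[OF A] lam s(2) by (simp add: C_def add_pos_nonneg)
  have L: "L > 0" using \<rho>2(3) C lam \<rho>1(3) by (simp add: L_def add_pos_pos)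
  have X_N: "norm (X y2 p2 - X y1 p1) \<le> L * (norm (N y2 p2 - N y1 p1) + norm (p2 - p1))"
    if yp: "y1 \<in> ball ybar \<rho>" "y2 \<in> ball ybar \<rho>" "p1 \<in> ball pbar \<rho>" "p2 \<in> ball pbar \<rho>" for y1 y2 p1 p2
  proof -
    have "norm (N y2 p2 - N y1 p2) \<le> norm (N y2 p2 - N y1 p1) + norm (N y1 p2 - N y1 p1)"
      using norm_triangle_ineq4[of "N y2 p2 - N y1 p1" "N y1 p2 - N y1 p1"] by simp
    also have "\<dots> \<le> norm (N y2 p2 - N y1 p1) + C * norm (p2 - p1)"
      using N_p[OF yp(1,3,4)] by (simp add: C_def)
    finally have "c / 2 * norm (X y2 p2 - X y1 p2) \<le> norm (N y2 p2 - N y1 p1) + C * norm (p2 - p1)"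
      using X_strong[OF yp(1,2,4)] by linarith
    then have "2 / c * (c / 2 * norm (X y2 p2 - X y1 p2)) \<le> 2 / c * (norm (N y2 p2 - N y1 p1) + C * norm (p2 - p1))"
      using \<rho>2(3) by (intro mult_left_mono) auto
    then have "norm (X y2 p2 - X y1 p2) \<le> 2 / c * norm (N y2 p2 - N y1 p1) + 2 / c * C * norm (p2 - p1)"
      using \<rho>2(3) by (simp add: distrib_left)
    moreover have "norm (X y1 p2 - X y1 p1) \<le> lam * L1 * norm (p2 - p1)" by (rule X_p[OF yp(1,3,4)])
    moreover have "norm (X y2 p2 - X y1 p1) \<le> norm (X y2 p2 - X y1 p2) + norm (X y1 p2 - X y1 p1)"
      using norm_triangle_ineq[of "X y2 p2 - X y1 p2" "X y1 p2 - X y1 p1"] by simp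
    moreover have "L * (norm (N y2 p2 - N y1 p1) + norm (p2 - p1)) =
        (2 / c * norm (N y2 p2 - N y1 p1) + 2 / c * C * norm (p2 - p1) + lam * L1 * norm (p2 - p1))
        + (2 / c * C + lam * L1) * norm (N y2 p2 - N y1 p1) + 2 / c * norm (p2 - p1)"
      by (simp add: L_def algebra_simps)
    moreover have "(2 / c * C + lam * L1) * norm (N y2 p2 - N y1 p1) + 2 / c * norm (p2 - p1) \<ge> 0"
      using C lam \<rho>1(3) \<rho>2(3) by simp
    ultimately show ?thesis by linarith
  qed
  define \<Psi> where "\<Psi> = (\<lambda>(y, p). (N y p, p))"
  have inj: "inj_on \<Psi> ?B"
  proof (rule inj_onI)
    fix z1 z2 assume z: "z1 \<in> ?B" "z2 \<in> ?B" "\<Psi> z1 = \<Psi> z2"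
    obtain y1 p1 y2 p2 where eq: "z1 = (y1, p1)" "z2 = (y2, p2)" by (cases z1, cases z2)
    have p: "p2 = p1" and n: "N y2 p1 = N y1 p1" using z(3) by (auto simp: \<Psi>_def eq)
    have yp: "y1 \<in> ball ybar \<rho>" "y2 \<in> ball ybar \<rho>" "p1 \<in> ball pbar \<rho>" using z(1,2) by (auto simp: eq p)
    have "c / 2 * norm (X y2 p1 - X y1 p1) \<le> 0" using X_strong[OF yp] n by simp
    then have x: "X y2 p1 = X y1 p1" using \<rho>2(3) by (simp add: mult_le_0_iff)
    then have "M y2 p1 = M y1 p1" using n by (simp add: N_def S_def)
    then have "y2 = y1" using y_eq[of y1 p1] y_eq[of y2 p1] x by metis
    then show "z1 = z2" by (simp add: eq p)
  qed
  have cont_f: "continuous_on (ball xbar s \<times> ball pbar s) f"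
  proof (rule continuous_on_subset[of _ f], rule lipschitz_on_continuous_on)
    show "(2 * L2)-lipschitz_on (ball xbar s \<times> ball pbar s) f"
    proof (rule lipschitz_onI)
      fix z1 z2 assume z: "z1 \<in> ball xbar s \<times> ball pbar s" "z2 \<in> ball xbar s \<times> ball pbar s"
      obtain x1 p1 x2 p2 where eq: "z1 = (x1, p1)" "z2 = (x2, p2)" by (cases z1, cases z2)
      have "norm (f (x1, p1) - f (x2, p2)) \<le> L2 * (norm (x1 - x2) + norm (p1 - p2))"
        using z s(5)[of x2 x1 p2 p1] by (simp add: eq)
      also have "\<dots> \<le> L2 * (dist z1 z2 + dist z1 z2)"
        using s(2) dist_fst_le[of z1 z2] dist_snd_le[of z1 z2]
        by (intro mult_left_mono add_mono) (auto simp: eq dist_norm)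
      finally show "dist (f z1) (f z2) \<le> (2 * L2) * dist z1 z2" by (simp add: eq dist_norm)
    qed (use s(2) in simp)
  qed simp
  have Beta: "?B \<subseteq> ball ybar eta \<times> ball pbar eta" using Bin(5,6) by auto
  have contX: "continuous_on ?B (\<lambda>z. X (fst z) (snd z))"
    using continuous_on_subset[OF RC.cont_X Beta] by (simp add: split_def)
  have contS: "continuous_on ?B (\<lambda>z. S (fst z) (snd z))"
    using continuous_on_subset[OF RC.cont_V Beta] by (simp add: split_def S_def M_def)
  have "continuous_on ?B (\<lambda>z. f (X (fst z) (snd z), snd z))"
    by (rule continuous_on_compose2[OF cont_f]) (auto intro!: continuous_intros contX Bin(7,8) simp del: mem_ball)
  then have contPsi: "continuous_on ?B \<Psi>"
    unfolding \<Psi>_def N_def split_def by (intro continuous_intros contS)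
  have "open (\<Psi> ` ?B)" by (rule invariance_of_domain[OF contPsi _ inj]) (intro open_Times open_ball)
  moreover have "(vbar, pbar) \<in> \<Psi> ` ?B"
  proof (rule image_eqI[of _ _ "(ybar, pbar)"])
    have "S ybar pbar = vhat" using Sbar by (simp add: S_def M_def)
    then show "(vbar, pbar) = \<Psi> (ybar, pbar)" by (simp add: \<Psi>_def N_def Xbar vhat_def)
  qed (use \<rho>(1) in simp)
  ultimately obtain e where e: "e > 0" "ball (vbar, pbar) e \<subseteq> \<Psi> ` ?B"
    using open_contains_ball by blast
  define \<theta> where "\<theta> vp = (case inv_into ?B \<Psi> vp of (y, p) \<Rightarrow> X y p)" for vp
  have \<theta>_Psi: "\<theta> (N y p, p) = X y p" if "y \<in> ball ybar \<rho>" "p \<in> ball pbar \<rho>" for y p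
    using inv_into_f_f[OF inj, of "(y, p)"] that by (simp add: \<theta>_def \<Psi>_def)
  \<comment> \<open>Solutions near \<open>xbar\<close> for parameters near \<open>(vbar, pbar)\<close> come from the chart.\<close>
  define H where "H = (\<lambda>(x, p::'p, v). (x + lam *\<^sub>R (v - f (x, p) + A x), v - f (x, p)))"
  have "isCont H (xbar, pbar, vbar)"
  proof -
    have "isCont f (xbar, pbar)"
      using continuous_on_interior[OF cont_f] s(1) by (simp add: interior_open open_Times)
    then have "isCont (\<lambda>z::'x \<times> 'p \<times> 'x. f (fst z, fst (snd z))) (xbar, pbar, vbar)"
      by (intro isCont_o2[where g = f and f = "\<lambda>z::'x \<times> 'p \<times> 'x. (fst z, fst (snd z))"] continuous_intros) simp_all
    then show ?thesis
      unfolding H_def split_def by (intro continuous_intros bounded_linear.isCont[OF A])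
  qed
  moreover have "H (xbar, pbar, vbar) = (ybar, vhat)" by (simp add: H_def ybar_def vhat_def)
  ultimately obtain t where t: "t > 0" "\<And>z. dist z (xbar, pbar, vbar) < t \<Longrightarrow> dist (H z) (ybar, vhat) < min \<rho> (d / 3)"
    unfolding continuous_at_eps_delta using \<rho>(1) d(1) by (metis divide_pos_pos min_less_iff_conj zero_less_numeral)
  define \<mu> where "\<mu> = min (t / 3) (d / 3)"
  have \<mu>: "\<mu> > 0" "\<mu> \<le> t / 3" "\<mu> \<le> d / 3" using t(1) d(1) by (auto simp: \<mu>_def)
  define \<tau> where "\<tau> = Min {\<mu>, e / 2, \<mu> / (2 * L), \<rho>}"
  have \<tau>: "\<tau> > 0" "\<tau> \<le> \<mu>" "\<tau> \<le> e / 2" "\<tau> \<le> \<mu> / (2 * L)" "\<tau> \<le> \<rho>"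
    using \<mu>(1) e(1) L \<rho>(1) by (simp_all add: \<tau>_def)
  define V where "V = ball vbar \<tau>"
  define Q where "Q = ball pbar \<tau>"
  define U where "U = ball xbar \<mu>"
  have pre: "\<exists>y. y \<in> ball ybar \<rho> \<and> p \<in> ball pbar \<rho> \<and> N y p = v \<and> \<theta> (v, p) = X y p" if vp: "v \<in> V" "p \<in> Q" for v p
  proof -
    have "dist (vbar, pbar) (v, p) \<le> dist vbar v + dist pbar p"
      by (rule dist_Pair_le)
    then have "(v, p) \<in> ball (vbar, pbar) e" using vp \<tau>(3) by (simp add: V_def Q_def)
    then obtain y p' where "(y, p') \<in> ?B" "\<Psi> (y, p') = (v, p)" using e(2) by fastforce
    then have "y \<in> ball ybar \<rho>" "p \<in> ball pbar \<rho>" "N y p = v" by (auto simp: \<Psi>_def)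
    then show ?thesis using \<theta>_Psi by blast
  qed
  have Lip: "norm (\<theta> (v1, p1) - \<theta> (v2, p2)) \<le> L * (norm (v1 - v2) + norm (p1 - p2))"
    if vp: "v1 \<in> V" "v2 \<in> V" "p1 \<in> Q" "p2 \<in> Q" for v1 v2 p1 p2
  proof -
    obtain y1 y2 where "y1 \<in> ball ybar \<rho>" "p1 \<in> ball pbar \<rho>" "N y1 p1 = v1" "\<theta> (v1, p1) = X y1 p1"
      "y2 \<in> ball ybar \<rho>" "p2 \<in> ball pbar \<rho>" "N y2 p2 = v2" "\<theta> (v2, p2) = X y2 p2"
      using pre[OF vp(1,3)] pre[OF vp(2,4)] by blast
    then show ?thesis using X_N[of y2 y1 p2 p1] by simp
  qed
  have Mon: "c / 2 * (norm (\<theta> (v1, p) - \<theta> (v2, p)))\<^sup>2 \<le> (v1 - v2) \<bullet> (\<theta> (v1, p) - \<theta> (v2, p))"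
    if vp: "v1 \<in> V" "v2 \<in> V" "p \<in> Q" for v1 v2 p
  proof -
    obtain y1 y2 where "y1 \<in> ball ybar \<rho>" "p \<in> ball pbar \<rho>" "N y1 p = v1" "\<theta> (v1, p) = X y1 p"
      "y2 \<in> ball ybar \<rho>" "N y2 p = v2" "\<theta> (v2, p) = X y2 p"
      using pre[OF vp(1,3)] pre[OF vp(2,3)] by blast
    then show ?thesis using mono[of y2 y1 p] by simp
  qed
  have in0: "vbar \<in> V" "pbar \<in> Q" using \<tau>(1) by (auto simp: V_def Q_def)
  have \<theta>bar: "\<theta> (vbar, pbar) = xbar"
  proof -
    have "S ybar pbar = vhat" using Sbar by (simp add: S_def M_def)
    then have "N ybar pbar = vbar" by (simp add: N_def Xbar vhat_def)
    then show ?thesis using \<theta>_Psi[of ybar pbar] \<rho>(1) Xbar by simp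
  qed
  have \<theta>U: "\<theta> (v, p) \<in> U" if "v \<in> V" "p \<in> Q" for v p
  proof -
    have "norm (\<theta> (v, p) - xbar) \<le> L * (norm (v - vbar) + norm (p - pbar))"
      using Lip[OF that(1) in0(1) that(2) in0(2)] \<theta>bar by simp
    also have "\<dots> < L * (2 * \<tau>)"
      using that L by (intro mult_strict_left_mono) (auto simp: V_def Q_def dist_norm norm_minus_commute)
    also have "\<dots> \<le> \<mu>" using \<tau>(4) L by (simp add: pos_le_divide_eq mult.commute mult.left_commute)
    finally show ?thesis by (simp add: U_def dist_norm norm_minus_commute)
  qed
  have sol_iff: "x = \<theta> (v, p) \<longleftrightarrow> x \<in> solution_map f g v p \<and> x \<in> U" if vp: "v \<in> V" "p \<in> Q" for x v p
  proof
    assume x: "x = \<theta> (v, p)"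
    obtain y where y: "y \<in> ball ybar \<rho>" "p \<in> ball pbar \<rho>" "N y p = v" "\<theta> (v, p) = X y p" using pre[OF vp] by blast
    have "(X y p, p, S y p) \<in> gph2 (partial_subdiff g)"
      using RC.in_G[OF Bin(5)[OF y(1,2)] Bin(6)[OF y(1,2)]] by (simp add: S_def M_def)
    then have "S y p \<in> partial_subdiff g x p" using x y(4) by (simp add: gph2_def)
    moreover have "v = f (x, p) + S y p" using y(3,4) x by (simp add: N_def add.commute)
    ultimately have "x \<in> solution_map f g v p" unfolding solution_map_def by blast
    then show "x \<in> solution_map f g v p \<and> x \<in> U" using \<theta>U[OF vp] x by simp
  next
    assume "x \<in> solution_map f g v p \<and> x \<in> U"
    then have xU: "x \<in> U" and u: "v - f (x, p) \<in> partial_subdiff g x p" by (auto simp: solution_map_def)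
    define y where "y = x + lam *\<^sub>R (v - f (x, p) + A x)"
    have "dist x xbar < t / 3" "dist p pbar < t / 3" "dist v vbar < t / 3"
      using xU vp \<mu>(2) \<tau>(2) by (auto simp: U_def V_def Q_def dist_commute)
    then have "dist (x, p, v) (xbar, pbar, vbar) < t" by (rule dist_triple_less)
    then have "dist (y, v - f (x, p)) (ybar, vhat) < min \<rho> (d / 3)"
      using t(2)[of "(x, p, v)"] by (simp add: H_def y_def)
    then have yv: "dist y ybar < \<rho>" "dist (v - f (x, p)) vhat < d / 3"
      using dist_fst_le[of "(y, v - f (x, p))" "(ybar, vhat)"] dist_snd_le[of "(y, v - f (x, p))" "(ybar, vhat)"] by auto
    moreover have "dist x xbar < d / 3" "dist p pbar < d / 3"
      using xU vp \<mu>(3) \<tau>(2) by (auto simp: U_def Q_def dist_commute)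
    ultimately have "dist (x, p, v - f (x, p)) (xbar, pbar, vhat) < d" by (intro dist_triple_less)
    then have Xy: "X y p = x" using d(2)[of x p "v - f (x, p)"] u by (simp add: gph2_def y_def)
    have yp: "y \<in> ball ybar \<rho>" "p \<in> ball pbar \<rho>" using yv(1) vp(2) \<tau>(5) by (auto simp: Q_def dist_commute)
    have "M y p = v - f (x, p) + A x" unfolding M_def Xy using lam by (simp add: y_def)
    then have "N y p = v" by (simp add: N_def S_def Xy)
    then show "x = \<theta> (v, p)" using \<theta>_Psi[OF yp] Xy by simp
  qed
  have loc: "single_valued_localization (solution_map f g) vbar pbar xbar V Q U \<theta>"
    unfolding single_valued_localization_def
  proof (intro conjI)
    show "vbar \<in> interior V" "pbar \<in> interior Q" "xbar \<in> interior U"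
      using \<tau>(1) \<mu>(1) by (simp_all add: V_def Q_def U_def interior_open)
    show "\<theta> \<in> V \<times> Q \<rightarrow> U" using \<theta>U by auto
    show "{(v, p, x). v \<in> V \<and> p \<in> Q \<and> x = \<theta> (v, p)} = gph2 (solution_map f g) \<inter> V \<times> Q \<times> U"
      using sol_iff by (auto simp: gph2_def)
  qed
  show "lipschitzian_fully_stable (solution_map f g) vbar pbar xbar"
    by (rule strongly_monotone_localization_imp_stable[where S = "solution_map f g", OF sol loc half_pos_c L Mon Lip])
  show "lipschitz_localization (solution_map f g) vbar pbar xbar"
    by (rule Lipschitz_estimate_imp_lipschitz_localization[OF loc L Lip])
qed

section \<open>Necessity\<close>

text \<open>Here \<open>\<theta>\<close> is the localization at the fixed parameter \<open>p0\<close>.  With \<open>a = z + adjoint T w\<close> the normal is tested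
  at the points for \<open>v0 + f (x0, p0) + t *\<^sub>R h\<close> with \<open>h = a / (2 * \<kappa>) - w\<close>.  Nonexpansiveness of
  \<open>v \<mapsto> v - 2 * \<kappa> * \<theta> v\<close> at \<open>v0 + f (x0, p0)\<close> then gives \<open>norm h \<le> norm (a / (2 * \<kappa>))\<close>, and squaring this
  is the claim.\<close>

lemma normal_coercive_of_localization:
  fixes f :: "'x::euclidean_space \<times> 'p::euclidean_space \<Rightarrow> 'x"
  assumes nor: "(z, q, - w) \<in> regular_normal_cone G (x0, p0, v0)"
    and der: "((\<lambda>u. f (u, p0)) has_derivative T) (at x0)"
    and \<kappa>: "\<kappa> > 0" and s: "s > 0"
    and \<theta>0: "\<theta> (v0 + f (x0, p0)) = x0"
    and gr: "\<And>v. dist v (v0 + f (x0, p0)) < s \<Longrightarrow> (\<theta> v, p0, v - f (\<theta> v, p0)) \<in> G"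
    and nonexp: "\<And>v. dist v (v0 + f (x0, p0)) < s \<Longrightarrow>
      norm ((v - (v0 + f (x0, p0))) - (2 * \<kappa>) *\<^sub>R (\<theta> v - x0)) \<le> norm (v - (v0 + f (x0, p0)))"
  shows "T w \<bullet> w + z \<bullet> w \<ge> \<kappa> * (norm w)\<^sup>2"
proof -
  define v1 where "v1 = v0 + f (x0, p0)"
  have T: "bounded_linear T" using der by (rule has_derivative_bounded_linear)
  have adj: "u \<bullet> adjoint T v = T u \<bullet> v" for u v by (rule adjoint_works[OF bounded_linear.linear[OF T]])
  obtain b where b: "b > 0" "\<And>u. norm (T u) \<le> b * norm u"
    using bounded_linear.pos_bounded[OF T] by (metis mult.commute)
  define a where "a = z + adjoint T w"
  define h where "h = (1 / (2 * \<kappa>)) *\<^sub>R a - w"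
  define C where "C = norm h * (1 / \<kappa> + (1 + (b + 1) / \<kappa>) + norm w / \<kappa>)"
  have C: "C \<ge> 0" using \<kappa> b(1) by (simp add: C_def)
  have key: "h \<bullet> h \<le> norm ((1 / (2 * \<kappa>)) *\<^sub>R a) * norm h + \<epsilon> * C" if \<epsilon>: "0 < \<epsilon>" "\<epsilon> \<le> 1" for \<epsilon>
  proof -
    obtain d1 where d1: "d1 > 0" "\<forall>\<gamma>\<in>G. dist \<gamma> (x0, p0, v0) < d1 \<longrightarrow>
        (z, q, - w) \<bullet> (\<gamma> - (x0, p0, v0)) \<le> \<epsilon> * norm (\<gamma> - (x0, p0, v0))"
      using regular_normal_coneD[OF nor \<epsilon>(1)] by blast
    obtain d2 where d2: "d2 > 0" "\<And>u. norm (u - x0) < d2 \<Longrightarrow> norm (f (u, p0) - f (x0, p0) - T (u - x0)) \<le> \<epsilon> * norm (u - x0)"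
      using der[unfolded has_derivative_at_alt] \<epsilon>(1) by blast
    define K where "K = 1 / \<kappa> + (1 + (b + 1) / \<kappa>)"
    have K: "K > 0" using \<kappa> b(1) by (simp add: K_def add_pos_pos)
    define t where "t = min (s / 2) (min (d2 * \<kappa> / 2) (d1 / (2 * K))) / (norm h + 1)"
    have nh: "norm h + 1 > 0" by (simp add: add_nonneg_pos)
    have t: "t > 0" using s d1(1) d2(1) \<kappa> K nh by (simp add: t_def)
    have "t * (norm h + 1) = min (s / 2) (min (d2 * \<kappa> / 2) (d1 / (2 * K)))" using nh by (simp add: t_def)
    then have "t * norm h + t \<le> s / 2" "t * norm h + t \<le> d2 * \<kappa> / 2" "t * norm h + t \<le> d1 / (2 * K)"
      by (simp_all add: distrib_left)
    moreover have "s / 2 < s" "d2 * \<kappa> / 2 < d2 * \<kappa>" "d1 / (2 * K) < d1 / K"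
      using s d1(1) d2(1) \<kappa> K by (simp_all add: divide_strict_left_mono)
    ultimately have th: "t * norm h < s" "t * norm h < d2 * \<kappa>" "t * norm h < d1 / K"
      using t by linarith+
    define v where "v = v1 + t *\<^sub>R h"
    define x where "x = \<theta> v"
    have nv: "norm (v - v1) = t * norm h" using t by (simp add: v_def)
    have ds: "dist v (v0 + f (x0, p0)) < s" using nv th(1) by (simp add: dist_norm v1_def)
    define u where "u = (v - v1) - (2 * \<kappa>) *\<^sub>R (x - x0)"
    have nu: "norm u \<le> t * norm h" using nonexp[OF ds] nv by (simp add: u_def x_def v1_def)
    have "(2 * \<kappa>) *\<^sub>R (x - x0) = (v - v1) - u" by (simp add: u_def)
    then have "norm ((2 * \<kappa>) *\<^sub>R (x - x0)) \<le> norm (v - v1) + norm u" by (metis norm_triangle_ineq4)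
    then have "\<kappa> * norm (x - x0) \<le> t * norm h" using nu nv \<kappa> by simp
    then have nx: "norm (x - x0) \<le> t * norm h / \<kappa>" using \<kappa> by (simp add: pos_le_divide_eq mult.commute)
    have "t * norm h / \<kappa> < d2" using th(2) \<kappa> by (simp add: pos_divide_less_eq)
    then have fx: "norm (f (x, p0) - f (x0, p0) - T (x - x0)) \<le> \<epsilon> * norm (x - x0)" using d2(2) nx by force
    define F where "F = f (x, p0) - f (x0, p0)"
    have "norm F \<le> norm (F - T (x - x0)) + norm (T (x - x0))"
      using norm_triangle_ineq[of "F - T (x - x0)" "T (x - x0)"] by simp
    also have "\<dots> \<le> 1 * norm (x - x0) + b * norm (x - x0)"
      using fx b(2)[of "x - x0"] mult_right_mono[OF \<epsilon>(2), of "norm (x - x0)"] by (simp add: F_def)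
    also have "\<dots> = (b + 1) * norm (x - x0)" by (simp add: algebra_simps)
    also have "\<dots> \<le> (b + 1) * (t * norm h / \<kappa>)" using nx b(1) by (intro mult_left_mono) auto
    finally have nF: "norm F \<le> (b + 1) * (t * norm h / \<kappa>)" .
    define \<gamma> where "\<gamma> = (x, p0, v - f (x, p0))"
    have \<gamma>d: "\<gamma> - (x0, p0, v0) = (x - x0, 0, (v - v1) - F)" by (simp add: \<gamma>_def F_def v1_def)
    have "norm (\<gamma> - (x0, p0, v0)) \<le> norm (x - x0) + norm ((v - v1) - F)"
      unfolding \<gamma>d by (intro order_trans[OF norm_Pair_le]) simp
    also have "\<dots> \<le> t * norm h / \<kappa> + (t * norm h + (b + 1) * (t * norm h / \<kappa>))"
      using nx nF nv norm_triangle_ineq4[of "v - v1" F] by linarith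
    also have "\<dots> = K * (t * norm h)" by (simp add: K_def field_simps)
    finally have n\<gamma>: "norm (\<gamma> - (x0, p0, v0)) \<le> K * (t * norm h)" .
    have "K * (t * norm h) < d1" using th(3) K by (simp add: pos_less_divide_eq mult.commute)
    then have "dist \<gamma> (x0, p0, v0) < d1" using n\<gamma> by (simp add: dist_norm)
    moreover have "\<gamma> \<in> G" using gr[OF ds] by (simp add: \<gamma>_def x_def)
    ultimately have "(z, q, - w) \<bullet> (\<gamma> - (x0, p0, v0)) \<le> \<epsilon> * norm (\<gamma> - (x0, p0, v0))" using d1(2) by blast
    also have "\<dots> \<le> \<epsilon> * (K * (t * norm h))" using n\<gamma> \<epsilon>(1) by (intro mult_left_mono) auto
    finally have 1: "z \<bullet> (x - x0) - w \<bullet> (v - v1) + w \<bullet> F \<le> \<epsilon> * (K * (t * norm h))"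
      unfolding \<gamma>d by (simp add: inner_diff_right)
    have "\<bar>w \<bullet> (F - T (x - x0))\<bar> \<le> norm w * norm (F - T (x - x0))" by (rule Cauchy_Schwarz_ineq2)
    also have "\<dots> \<le> norm w * (\<epsilon> * (t * norm h / \<kappa>))"
      using fx nx \<epsilon>(1) unfolding F_def by (intro mult_left_mono order_trans[OF fx]) auto
    finally have 2: "w \<bullet> T (x - x0) \<le> w \<bullet> F + norm w * (\<epsilon> * (t * norm h / \<kappa>))" by (simp add: inner_diff_right)
    have "a \<bullet> (x - x0) = z \<bullet> (x - x0) + w \<bullet> T (x - x0)"
      unfolding a_def inner_add_left by (simp only: inner_commute[of "adjoint T w"] inner_commute[of w] adj)
    then have 3: "a \<bullet> (x - x0) - w \<bullet> (v - v1) \<le> \<epsilon> * (t * C)"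
      using 1 2 by (simp add: C_def K_def algebra_simps)
    have "x - x0 = (1 / (2 * \<kappa>)) *\<^sub>R ((v - v1) - u)" using \<kappa> by (simp add: u_def)
    then have "a \<bullet> (x - x0) - w \<bullet> (v - v1) = h \<bullet> (v - v1) - ((1 / (2 * \<kappa>)) *\<^sub>R a) \<bullet> u"
      by (simp add: h_def inner_diff_left inner_diff_right right_diff_distrib)
    moreover have "((1 / (2 * \<kappa>)) *\<^sub>R a) \<bullet> u \<le> norm ((1 / (2 * \<kappa>)) *\<^sub>R a) * (t * norm h)"
      by (rule order_trans[OF norm_cauchy_schwarz]) (use nu in \<open>intro mult_left_mono\<close>, auto)
    ultimately have "t * (h \<bullet> h) \<le> t * (norm ((1 / (2 * \<kappa>)) *\<^sub>R a) * norm h + \<epsilon> * C)"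
      using 3 by (simp add: v_def algebra_simps)
    then show ?thesis using t by simp
  qed
  have "h \<bullet> h \<le> norm ((1 / (2 * \<kappa>)) *\<^sub>R a) * norm h"
  proof (rule field_le_epsilon)
    fix \<epsilon> :: real assume \<epsilon>: "\<epsilon> > 0"
    define \<epsilon>' where "\<epsilon>' = min 1 (\<epsilon> / (C + 1))"
    have "\<epsilon>' > 0" "\<epsilon>' \<le> 1" using \<epsilon> C by (auto simp: \<epsilon>'_def)
    moreover have "\<epsilon>' * C \<le> \<epsilon>"
    proof -
      have "\<epsilon>' * (C + 1) \<le> \<epsilon>" using C by (simp add: \<epsilon>'_def pos_le_divide_eq[symmetric])
      then show ?thesis using \<open>\<epsilon>' > 0\<close> by (simp add: distrib_left)
    qed
    ultimately show "h \<bullet> h \<le> norm ((1 / (2 * \<kappa>)) *\<^sub>R a) * norm h + \<epsilon>" using key[of \<epsilon>'] by linarith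
  qed
  then have "norm h * norm h \<le> norm ((1 / (2 * \<kappa>)) *\<^sub>R a) * norm h"
    by (simp add: dot_square_norm power2_eq_square)
  then have "norm h \<le> norm ((1 / (2 * \<kappa>)) *\<^sub>R a)"
    by (cases "h = 0") (simp, rule mult_right_le_imp_le[of _ "norm h"], simp_all only: zero_less_norm_iff not_False_eq_True)
  then have "(norm h)\<^sup>2 \<le> (norm ((1 / (2 * \<kappa>)) *\<^sub>R a))\<^sup>2" by (intro power_mono) auto
  moreover have "(norm h)\<^sup>2 = (norm ((1 / (2 * \<kappa>)) *\<^sub>R a))\<^sup>2 - (1 / \<kappa>) * (a \<bullet> w) + (norm w)\<^sup>2"
    unfolding h_def power2_norm_eq_inner using \<kappa> by (simp add: inner_diff_left inner_diff_right inner_commute)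
  ultimately have "(norm w)\<^sup>2 \<le> (1 / \<kappa>) * (a \<bullet> w)" by simp
  then have "\<kappa> * (norm w)\<^sup>2 \<le> a \<bullet> w" using \<kappa> by (simp add: pos_le_divide_eq mult.commute)
  moreover have "a \<bullet> w = z \<bullet> w + T w \<bullet> w"
    unfolding a_def inner_add_left by (simp only: inner_commute[of "adjoint T w"] adj)
  ultimately show ?thesis by simp
qed

text \<open>Here \<open>\<theta>\<close> is the localization at fixed \<open>v = v0 + f (x0, p0)\<close>; the parameter moves in the direction
  \<open>q\<close>.\<close>

lemma normal_bound_of_localization:
  fixes f :: "'x::euclidean_space \<times> 'p::euclidean_space \<Rightarrow> 'x"
  assumes nor: "(z, q, - w) \<in> regular_normal_cone G (x0, p0, v0)"
    and s: "s > 0" and C1: "C1 \<ge> 0" and C2: "C2 \<ge> 0"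
    and gr: "\<And>p. dist p p0 < s \<Longrightarrow> (\<theta> p, p, v0 + f (x0, p0) - f (\<theta> p, p)) \<in> G"
    and lip: "\<And>p. dist p p0 < s \<Longrightarrow> norm (\<theta> p - x0) \<le> C1 * norm (p - p0)"
    and lipf: "\<And>p. dist p p0 < s \<Longrightarrow> norm (f (\<theta> p, p) - f (x0, p0)) \<le> C2 * norm (p - p0)"
  shows "norm q \<le> C1 * norm z + C2 * norm w"
proof -
  have "norm q * norm q \<le> (C1 * norm z + C2 * norm w) * norm q"
  proof (rule field_le_epsilon)
    fix \<epsilon> :: real assume \<epsilon>: "\<epsilon> > 0"
    define K where "K = C1 + 1 + C2"
    have K: "K > 0" using C1 C2 by (simp add: K_def)
    define \<epsilon>' where "\<epsilon>' = \<epsilon> / (K * (norm q + 1))"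
    have nq: "norm q + 1 > 0" by (simp add: add_nonneg_pos)
    have \<epsilon>': "\<epsilon>' > 0" using \<epsilon> K nq by (simp add: \<epsilon>'_def)
    obtain d1 where d1: "d1 > 0" "\<forall>\<gamma>\<in>G. dist \<gamma> (x0, p0, v0) < d1 \<longrightarrow>
        (z, q, - w) \<bullet> (\<gamma> - (x0, p0, v0)) \<le> \<epsilon>' * norm (\<gamma> - (x0, p0, v0))"
      using regular_normal_coneD[OF nor \<epsilon>'] by blast
    define t where "t = min s (d1 / K) / (2 * (norm q + 1))"
    have t: "t > 0" using s d1(1) K nq by (simp add: t_def)
    have "t * (2 * (norm q + 1)) = min s (d1 / K)" using nq by (simp add: t_def)
    then have "t * norm q * 2 + 2 * t \<le> s" "t * norm q * 2 + 2 * t \<le> d1 / K" by (simp_all add: algebra_simps)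
    moreover have "t * norm q \<ge> 0" using t by simp
    ultimately have tq: "t * norm q < s" "t * norm q < d1 / K" using t by linarith+
    define p where "p = p0 + t *\<^sub>R q"
    define x where "x = \<theta> p"
    define F where "F = f (x, p) - f (x0, p0)"
    have np: "norm (p - p0) = t * norm q" using t by (simp add: p_def)
    have ds: "dist p p0 < s" using np tq(1) by (simp add: dist_norm)
    have nx: "norm (x - x0) \<le> C1 * (t * norm q)" using lip[OF ds] np by (simp add: x_def)
    have nF: "norm F \<le> C2 * (t * norm q)" using lipf[OF ds] np by (simp add: x_def F_def)
    define \<gamma> where "\<gamma> = (x, p, v0 + f (x0, p0) - f (x, p))"
    have \<gamma>d: "\<gamma> - (x0, p0, v0) = (x - x0, p - p0, - F)" by (simp add: \<gamma>_def F_def)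
    have "norm (\<gamma> - (x0, p0, v0)) \<le> norm (x - x0) + (norm (p - p0) + norm (- F))"
      unfolding \<gamma>d by (intro order_trans[OF norm_Pair_le] add_left_mono norm_Pair_le)
    also have "\<dots> \<le> K * (t * norm q)" using nx nF np by (simp add: K_def distrib_right)
    finally have n\<gamma>: "norm (\<gamma> - (x0, p0, v0)) \<le> K * (t * norm q)" .
    have "K * (t * norm q) < d1" using tq(2) K by (simp add: pos_less_divide_eq mult.commute)
    then have "dist \<gamma> (x0, p0, v0) < d1" using n\<gamma> by (simp add: dist_norm)
    moreover have "\<gamma> \<in> G" using gr[OF ds] by (simp add: \<gamma>_def x_def)
    ultimately have "(z, q, - w) \<bullet> (\<gamma> - (x0, p0, v0)) \<le> \<epsilon>' * norm (\<gamma> - (x0, p0, v0))" using d1(2) by blast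
    also have "\<dots> \<le> \<epsilon>' * (K * (t * norm q))" using n\<gamma> \<epsilon>' by (intro mult_left_mono) auto
    finally have "z \<bullet> (x - x0) + q \<bullet> (p - p0) + w \<bullet> F \<le> \<epsilon>' * (K * (t * norm q))"
      unfolding \<gamma>d by simp
    moreover have "- (z \<bullet> (x - x0)) \<le> norm z * (C1 * (t * norm q))"
      using Cauchy_Schwarz_ineq2[of z "x - x0"] mult_left_mono[OF nx, of "norm z"] by (simp add: abs_le_iff)
    moreover have "- (w \<bullet> F) \<le> norm w * (C2 * (t * norm q))"
      using Cauchy_Schwarz_ineq2[of w F] mult_left_mono[OF nF, of "norm w"] by (simp add: abs_le_iff)
    moreover have "q \<bullet> (p - p0) = t * (norm q * norm q)" by (simp add: p_def dot_square_norm power2_eq_square)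
    ultimately have "t * (norm q * norm q) \<le> t * ((C1 * norm z + C2 * norm w) * norm q + \<epsilon>' * K * norm q)"
      by (simp add: algebra_simps)
    then have "norm q * norm q \<le> (C1 * norm z + C2 * norm w) * norm q + \<epsilon>' * K * norm q" using t by simp
    moreover have "\<epsilon>' * K * norm q \<le> \<epsilon>"
    proof -
      have "\<epsilon>' * K * (norm q + 1) = \<epsilon>" using K nq by (simp add: \<epsilon>'_def)
      moreover have "\<epsilon>' * K > 0" using \<epsilon>' K by simp
      ultimately show ?thesis by (simp add: distrib_left)
    qed
    ultimately show "norm q * norm q \<le> (C1 * norm z + C2 * norm w) * norm q + \<epsilon>" by linarith
  qed
  then show ?thesis using C1 C2 by (cases "q = 0") (auto simp: mult_le_cancel_right)
qed

text \<open>The estimates for regular normals have constants that are uniform near the reference point, so they hold for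
  limiting normals as well.\<close>

lemma fully_stable_imp_conditions:
  fixes f :: "'x::euclidean_space \<times> 'p::euclidean_space \<Rightarrow> 'x" and g :: "'x \<times> 'p \<Rightarrow> ereal"
  assumes A1: "assumption_A1 f xbar pbar"
    and stable: "lipschitzian_fully_stable (solution_map f g) vbar pbar xbar"
    and nor: "(z, q, - w) \<in> limiting_normal_cone (gph2 (partial_subdiff g)) (xbar, pbar, vbar - f (xbar, pbar))"
  shows "z = 0 \<Longrightarrow> w = 0 \<Longrightarrow> q = 0"
    and "w \<noteq> 0 \<Longrightarrow> blinfun_apply (grad_x f (xbar, pbar)) w \<bullet> w + z \<bullet> w > 0"
proof -
  define vhat where "vhat = vbar - f (xbar, pbar)"
  let ?G = "gph2 (partial_subdiff g)"
  obtain V Q U \<theta> \<kappa> l where loc: "single_valued_localization (solution_map f g) vbar pbar xbar V Q U \<theta>"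
    and \<kappa>: "\<kappa> > 0" "l > 0" and est: "\<forall>v1\<in>V. \<forall>v2\<in>V. \<forall>p1\<in>Q. \<forall>p2\<in>Q.
          norm ((v1 - v2) - (2 * \<kappa>) *\<^sub>R (\<theta> (v1, p1) - \<theta> (v2, p2))) \<le> norm (v1 - v2) + l * dist p1 p2"
    using stable unfolding lipschitzian_fully_stable_def by metis
  have nb: "vbar \<in> interior V" "pbar \<in> interior Q" "xbar \<in> interior U"
    and gph: "{(v, p, x). v \<in> V \<and> p \<in> Q \<and> x = \<theta> (v, p)} = gph2 (solution_map f g) \<inter> (V \<times> Q \<times> U)"
    using loc unfolding single_valued_localization_def by auto
  have mem: "x = \<theta> (v, p) \<longleftrightarrow> x \<in> solution_map f g v p \<and> x \<in> U" if "v \<in> V" "p \<in> Q" for x v p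
  proof -
    have "(v, p, x) \<in> {(v, p, x). v \<in> V \<and> p \<in> Q \<and> x = \<theta> (v, p)} \<longleftrightarrow> (v, p, x) \<in> gph2 (solution_map f g) \<inter> (V \<times> Q \<times> U)"
      using gph by simp
    then show ?thesis using that by (auto simp: gph2_def)
  qed
  have gr: "(\<theta> (v, p), p, v - f (\<theta> (v, p), p)) \<in> ?G" if "v \<in> V" "p \<in> Q" for v p
  proof -
    have "\<theta> (v, p) \<in> solution_map f g v p" using mem[OF that] by blast
    then obtain y where y: "y \<in> partial_subdiff g (\<theta> (v, p)) p" "v = f (\<theta> (v, p), p) + y"
      unfolding solution_map_def by blast
    have "v - f (\<theta> (v, p), p) = y" using y(2) by (metis add_diff_cancel_left')
    then show ?thesis using y(1) by (simp add: gph2_def)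
  qed
  have th0: "\<theta> (v + f (x, p), p) = x" if "(x, p, v) \<in> ?G" "v + f (x, p) \<in> V" "p \<in> Q" "x \<in> U" for x p v
    using mem[OF that(2,3), of x] that by (auto simp: gph2_def solution_map_def)
  obtain s L where s: "s > 0" "L > 0"
    "\<And>x p. x \<in> ball xbar s \<Longrightarrow> p \<in> ball pbar s \<Longrightarrow> (\<lambda>u. f (u, p)) differentiable (at x)"
    "\<And>x1 x2 p. x1 \<in> ball xbar s \<Longrightarrow> x2 \<in> ball xbar s \<Longrightarrow> p \<in> ball pbar s \<Longrightarrow>
       norm (f (x2, p) - f (x1, p) - blinfun_apply (grad_x f (xbar, pbar)) (x2 - x1)) \<le> 1 * norm (x2 - x1)"
    "\<And>x1 x2 p1 p2. x1 \<in> ball xbar s \<Longrightarrow> x2 \<in> ball xbar s \<Longrightarrow> p1 \<in> ball pbar s \<Longrightarrow> p2 \<in> ball pbar s \<Longrightarrow>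
       norm (f (x2, p2) - f (x1, p1)) \<le> L * (norm (x2 - x1) + norm (p2 - p1))"
    by (rule A1_estimates[OF A1 zero_less_one]) (rule that)
  define C1 where "C1 = l / (2 * \<kappa>)"
  define C2 where "C2 = L * (C1 + 1)"
  have C1: "C1 > 0" using \<kappa> by (simp add: C1_def)
  have C2: "C2 > 0" using C1 s(2) by (simp add: C2_def)
  have reg: "norm q \<le> C1 * norm z + C2 * norm w \<and>
      blinfun_apply (grad_x f (x0, p0)) w \<bullet> w + z \<bullet> w \<ge> \<kappa> * (norm w)\<^sup>2"
    if nor: "(z, q, - w) \<in> regular_normal_cone ?G (x0, p0, v0)"
      and G0: "(x0, p0, v0) \<in> ?G" and x0: "x0 \<in> interior U" "x0 \<in> ball xbar s"
      and p0: "p0 \<in> interior Q" "p0 \<in> ball pbar s" and v0: "v0 + f (x0, p0) \<in> interior V"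
    for x0 p0 v0 z q w
  proof
    define v1 where "v1 = v0 + f (x0, p0)"
    have in0: "v1 \<in> V" "p0 \<in> Q" "x0 \<in> U" using v0 p0(1) x0(1) interior_subset by (auto simp: v1_def)
    have th: "\<theta> (v1, p0) = x0" using th0[OF G0] in0 by (simp add: v1_def)
    obtain e1 where e1: "e1 > 0" "ball v1 e1 \<subseteq> V" using ball_in_interior[OF v0] unfolding v1_def .
    obtain e2 where e2: "e2 > 0" "ball p0 e2 \<subseteq> Q" using ball_in_interior[OF p0(1)] .
    define e3 where "e3 = s - dist xbar x0"
    define e4 where "e4 = s - dist pbar p0"
    have e34: "e3 > 0" "e4 > 0" using x0(2) p0(2) by (auto simp: e3_def e4_def)
    define m where "m = Min {e2, e4, e3 / C1}"
    have m: "m > 0" "m \<le> e2" "m \<le> e4" "m \<le> e3 / C1" using e2(1) e34 C1 by (simp_all add: m_def)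
    have pQ: "p \<in> Q" if "dist p p0 < m" for p using that m(2) e2(2) by (auto simp: dist_commute)
    have lip: "norm (\<theta> (v1, p) - x0) \<le> C1 * norm (p - p0)" if "dist p p0 < m" for p
    proof -
      have "norm ((v1 - v1) - (2 * \<kappa>) *\<^sub>R (\<theta> (v1, p) - \<theta> (v1, p0))) \<le> norm (v1 - v1) + l * dist p p0"
        using est in0 pQ[OF that] by blast
      then have "2 * \<kappa> * norm (\<theta> (v1, p) - x0) \<le> l * norm (p - p0)" using \<kappa>(1) by (simp add: th dist_norm)
      then show ?thesis using \<kappa>(1) by (simp add: C1_def field_simps)
    qed
    show "norm q \<le> C1 * norm z + C2 * norm w"
    proof (rule normal_bound_of_localization[OF nor m(1), where \<theta> = "\<lambda>p. \<theta> (v1, p)" and f = f])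
      fix p assume p: "dist p p0 < m"
      show "(\<theta> (v1, p), p, v0 + f (x0, p0) - f (\<theta> (v1, p), p)) \<in> ?G"
        using gr[OF in0(1) pQ[OF p]] by (simp add: v1_def)
      show "norm (\<theta> (v1, p) - x0) \<le> C1 * norm (p - p0)" by (rule lip[OF p])
      have "p \<in> ball pbar s" using p m(3) dist_triangle[of pbar p p0] by (simp add: e4_def dist_commute)
      moreover have "C1 * norm (p - p0) < e3" using p m(4) C1 by (simp add: dist_norm pos_le_divide_eq less_le_trans mult.commute)
         (smt (verit, ccfv_SIG) mult_less_cancel_left_pos)
      then have "dist x0 (\<theta> (v1, p)) < e3" using lip[OF p] by (simp add: dist_norm norm_minus_commute)
      then have "\<theta> (v1, p) \<in> ball xbar s" using dist_triangle[of xbar "\<theta> (v1, p)" x0] by (simp add: e3_def)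
      ultimately have "norm (f (\<theta> (v1, p), p) - f (x0, p0)) \<le> L * (norm (\<theta> (v1, p) - x0) + norm (p - p0))"
        using s(5) x0(2) p0(2) by blast
      also have "\<dots> \<le> L * (C1 * norm (p - p0) + norm (p - p0))" using lip[OF p] s(2) by (intro mult_left_mono) auto
      finally show "norm (f (\<theta> (v1, p), p) - f (x0, p0)) \<le> C2 * norm (p - p0)" by (simp add: C2_def algebra_simps)
    qed (use C1 C2 in auto)
    show "\<kappa> * (norm w)\<^sup>2 \<le> blinfun_apply (grad_x f (x0, p0)) w \<bullet> w + z \<bullet> w"
    proof (rule normal_coercive_of_localization[OF nor _ \<kappa>(1) e1(1), where \<theta> = "\<lambda>v. \<theta> (v, p0)" and f = f])
      show "((\<lambda>u. f (u, p0)) has_derivative blinfun_apply (grad_x f (x0, p0))) (at x0)"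
        by (rule has_derivative_grad_x[OF s(3)[OF x0(2) p0(2)]])
      show "\<theta> (v0 + f (x0, p0), p0) = x0" using th by (simp add: v1_def)
      fix v assume v: "dist v (v0 + f (x0, p0)) < e1"
      then have vV: "v \<in> V" using e1(2) by (auto simp: v1_def dist_commute)
      show "(\<theta> (v, p0), p0, v - f (\<theta> (v, p0), p0)) \<in> ?G" by (rule gr[OF vV in0(2)])
      have "norm ((v - v1) - (2 * \<kappa>) *\<^sub>R (\<theta> (v, p0) - \<theta> (v1, p0))) \<le> norm (v - v1) + l * dist p0 p0"
        using est in0 vV by blast
      then show "norm (v - (v0 + f (x0, p0)) - (2 * \<kappa>) *\<^sub>R (\<theta> (v, p0) - x0)) \<le> norm (v - (v0 + f (x0, p0)))"
        unfolding th by (simp add: v1_def)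
    qed
  qed
  obtain \<gamma> \<zeta> where seq: "\<And>k::nat. \<gamma> k \<in> ?G" "\<And>k. \<zeta> k \<in> regular_normal_cone ?G (\<gamma> k)"
    "\<gamma> \<longlonglongrightarrow> (xbar, pbar, vhat)" "\<zeta> \<longlonglongrightarrow> (z, q, - w)"
    using nor unfolding limiting_normal_cone_def vhat_def by blast
  define x where "x k = fst (\<gamma> k)" for k
  define p where "p k = fst (snd (\<gamma> k))" for k
  define v where "v k = snd (snd (\<gamma> k))" for k
  define z' where "z' k = fst (\<zeta> k)" for k
  define q' where "q' k = fst (snd (\<zeta> k))" for k
  define w' where "w' k = - snd (snd (\<zeta> k))" for k
  have \<gamma>: "\<gamma> k = (x k, p k, v k)" for k by (simp add: x_def p_def v_def)
  have \<zeta>: "\<zeta> k = (z' k, q' k, - w' k)" for k by (simp add: z'_def q'_def w'_def)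
  have lx: "x \<longlonglongrightarrow> xbar" using tendsto_fst[OF seq(3)] by (simp add: x_def[abs_def])
  have lp: "p \<longlonglongrightarrow> pbar" using tendsto_fst[OF tendsto_snd[OF seq(3)]] by (simp add: p_def[abs_def])
  have lv: "v \<longlonglongrightarrow> vhat" using tendsto_snd[OF tendsto_snd[OF seq(3)]] by (simp add: v_def[abs_def])
  have lz: "z' \<longlonglongrightarrow> z" using tendsto_fst[OF seq(4)] by (simp add: z'_def[abs_def])
  have lq: "q' \<longlonglongrightarrow> q" using tendsto_fst[OF tendsto_snd[OF seq(4)]] by (simp add: q'_def[abs_def])
  have lw: "w' \<longlonglongrightarrow> w" using tendsto_minus[OF tendsto_snd[OF tendsto_snd[OF seq(4)]]] by (simp add: w'_def[abs_def])
  have ex: "eventually (\<lambda>k. x k \<in> interior U \<inter> ball xbar s) sequentially"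
    using nb s(1) by (intro topological_tendstoD[OF lx]) auto
  have ep: "eventually (\<lambda>k. p k \<in> interior Q \<inter> ball pbar s) sequentially"
    using nb s(1) by (intro topological_tendstoD[OF lp]) auto
  have lf: "(\<lambda>k. f (x k, p k)) \<longlonglongrightarrow> f (xbar, pbar)"
  proof (rule tendsto_dist_iff[THEN iffD2], rule Lim_null_comparison)
    show "eventually (\<lambda>k. norm (dist (f (x k, p k)) (f (xbar, pbar))) \<le> L * (dist (x k) xbar + dist (p k) pbar)) sequentially"
      using ex ep
    proof eventually_elim
      case (elim k)
      then show ?case using s(5)[of xbar "x k" pbar "p k"] s(1) by (simp add: dist_norm)
    qed
    have "(\<lambda>k. L * (dist (x k) xbar + dist (p k) pbar)) \<longlonglongrightarrow> L * (0 + 0)"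
      using lx lp by (intro tendsto_intros) (auto simp: tendsto_dist_iff[symmetric])
    then show "(\<lambda>k. L * (dist (x k) xbar + dist (p k) pbar)) \<longlonglongrightarrow> 0" by simp
  qed
  have "(\<lambda>k. v k + f (x k, p k)) \<longlonglongrightarrow> vhat + f (xbar, pbar)" by (intro tendsto_add lv lf)
  then have ev: "eventually (\<lambda>k. v k + f (x k, p k) \<in> interior V) sequentially"
    using nb by (intro topological_tendstoD) (auto simp: vhat_def)
  have "isCont (grad_x f) (xbar, pbar)" using A1 by (simp add: assumption_A1_def)
  then have lg: "(\<lambda>k. grad_x f (x k, p k)) \<longlonglongrightarrow> grad_x f (xbar, pbar)"
    by (rule isCont_tendsto_compose) (intro tendsto_Pair lx lp)
  have bounds: "eventually (\<lambda>k. norm (q' k) \<le> C1 * norm (z' k) + C2 * norm (w' k) \<and>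
      blinfun_apply (grad_x f (x k, p k)) (w' k) \<bullet> w' k + z' k \<bullet> w' k \<ge> \<kappa> * (norm (w' k))\<^sup>2) sequentially"
    using ex ep ev
  proof eventually_elim
    case (elim k)
    show ?case by (rule reg[of _ _ _ "x k" "p k" "v k"]) (use elim seq(1,2)[of k] \<gamma>[of k] \<zeta>[of k] in auto)
  qed
  have 1: "norm q \<le> C1 * norm z + C2 * norm w"
    by (rule tendsto_le[of sequentially "\<lambda>k. C1 * norm (z' k) + C2 * norm (w' k)" _ "\<lambda>k. norm (q' k)"])
      (use lz lw lq in \<open>auto intro!: tendsto_intros eventually_mono[OF bounds]\<close>)
  have 2: "\<kappa> * (norm w)\<^sup>2 \<le> blinfun_apply (grad_x f (xbar, pbar)) w \<bullet> w + z \<bullet> w"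
    by (rule tendsto_le[of sequentially "\<lambda>k. blinfun_apply (grad_x f (x k, p k)) (w' k) \<bullet> w' k + z' k \<bullet> w' k" _ "\<lambda>k. \<kappa> * (norm (w' k))\<^sup>2"])
      (use lz lw lg in \<open>auto intro!: tendsto_intros eventually_mono[OF bounds]\<close>)
  show "q = 0" if "z = 0" "w = 0" using 1 that by simp
  show "blinfun_apply (grad_x f (xbar, pbar)) w \<bullet> w + z \<bullet> w > 0" if "w \<noteq> 0"
  proof -
    have "\<kappa> * (norm w)\<^sup>2 > 0" using that \<kappa>(1) by simp
    then show ?thesis using 2 by linarith
  qed
qed

section \<open>The characterization\<close>

theorem theorem4p7:
  fixes f :: "'x::euclidean_space \<times> 'p::euclidean_space \<Rightarrow> 'x"
    and g :: "'x \<times> 'p \<Rightarrow> ereal"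
    and vbar xbar vhat :: 'x and pbar :: 'p
  assumes g_not_minf: "\<forall>z. g z \<noteq> -\<infinity>"
    and g_lsc: "lower_semicontinuous g"
    and sol: "xbar \<in> solution_map f g vbar pbar"
    and vhat: "vhat = vbar - f (xbar, pbar)"
    and A1: "assumption_A1 f xbar pbar"
    and A2: "assumption_A2 g xbar pbar vhat"
    and A3: "assumption_A3 g xbar pbar"
  defines "D \<equiv> limiting_coderivative (partial_subdiff g) xbar pbar vhat"
  defines "conditions \<equiv>
      (\<forall>q. (0, q) \<in> D 0 \<longrightarrow> q = 0) \<and>
      (\<forall>w z q. w \<noteq> 0 \<longrightarrow> (z, q) \<in> D w \<longrightarrow>
         blinfun_apply (grad_x f (xbar, pbar)) w \<bullet> w + z \<bullet> w > 0)"
  shows "(lipschitzian_fully_stable (solution_map f g) vbar pbar xbar \<longleftrightarrow> conditions) \<and>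
         (conditions \<longrightarrow> lipschitz_localization (solution_map f g) vbar pbar xbar)"
proof -
  have D: "(z, q) \<in> D w \<longleftrightarrow> (z, q, - w) \<in> limiting_normal_cone (gph2 (partial_subdiff g)) (xbar, pbar, vbar - f (xbar, pbar))"
    for z q w by (simp add: D_def limiting_coderivative_def vhat)
  have "conditions" if stable: "lipschitzian_fully_stable (solution_map f g) vbar pbar xbar"
    unfolding conditions_def D
  proof (intro conjI allI impI)
    fix q assume "(0, q, - 0) \<in> limiting_normal_cone (gph2 (partial_subdiff g)) (xbar, pbar, vbar - f (xbar, pbar))"
    then show "q = 0" by (rule fully_stable_imp_conditions(1)[OF A1 stable]) simp_all
  next
    fix w z q assume "w \<noteq> 0" "(z, q, - w) \<in> limiting_normal_cone (gph2 (partial_subdiff g)) (xbar, pbar, vbar - f (xbar, pbar))"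
    then show "0 < blinfun_apply (grad_x f (xbar, pbar)) w \<bullet> w + z \<bullet> w"
      by (intro fully_stable_imp_conditions(2)[OF A1 stable])
  qed
  moreover have "lipschitzian_fully_stable (solution_map f g) vbar pbar xbar \<and>
      lipschitz_localization (solution_map f g) vbar pbar xbar" if cond: "conditions"
  proof -
    have crit: "\<forall>q. (0, q, 0) \<in> limiting_normal_cone (gph2 (partial_subdiff g)) (xbar, pbar, vbar - f (xbar, pbar)) \<longrightarrow> q = 0"
      and pd: "\<forall>z q w. w \<noteq> 0 \<longrightarrow>
        (z, q, - w) \<in> limiting_normal_cone (gph2 (partial_subdiff g)) (xbar, pbar, vbar - f (xbar, pbar)) \<longrightarrow>
        blinfun_apply (grad_x f (xbar, pbar)) w \<bullet> w + z \<bullet> w > 0"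
      using cond unfolding conditions_def D minus_zero by blast+
    show ?thesis
      using conditions_imp_stable[OF g_not_minf g_lsc A1 A2[unfolded vhat] A3 crit pd sol] by blast
  qed
  ultimately show ?thesis by blast
qed

end
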